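(* Let $M$ be a compact Riemannian manifold without boundary, of dimension $d$, isometrically embedded into $\mathbb R^m$, with volume measure $\lambda_M$, and let $\varphi:[0,1]\to M\subset\mathbb R^m$ be a twice continuously differentiable function. For $0\le s<t\le1$ and $z,y\in M$ let $$q_\varphi(s,z,t,y)=\frac{e^{-\frac{|z-y-(\varphi(s)-\varphi(t))|^2}{2(t-s)}}}{\int_Me^{-\frac{|z-\bar y-(\varphi(s)-\varphi(t))|^2}{2(t-s)}}\lambda_M(d\bar y)},$$ and for a partition $\mathcal P=\{s=t_0<t_1<\cdots<t_n=t\}$ of $[s,t]\subset[0,1]$ let $$q_{\mathcal P}(s,x,t,y)=\int_Mq_\varphi(s,x,t_1,x_1)\lambda_M(dx_1)\int_Mq_\varphi(t_1,x_1,t_2,x_2)\lambda_M(dx_2)\cdots\int_Mq_\varphi(t_{n-2},x_{n-2},t_{n-1},x_{n-1})\,q_\varphi(t_{n-1},x_{n-1},t,y)\,\lambda_M(dx_{n-1}).$$ Then, as the mesh of $\mathcal P$ tends to zero, for every $g\in C(M)$ the following convergence holds in $C(M)$: $$\int_Mq_{\mathcal P}(s,\cdot,t,y)\,g(y)\,\lambda_M(dy)\to\int_Mp(s,\cdot,t,y)\,g(y)\,\lambda_M(dy),$$ where $p(s,x,t,y)$ is the transition density function of the process generated by $$A_s=(\varphi'(s),\nabla_M)_{\mathbb R^m}-\frac12\Delta_M.$$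
   Context: $C(M)$ carries the supremum norm. $\nabla_M$ is the Riemannian gradient on $M$, with $\nabla_Mg(x)\in T_xM$ regarded as a vector in $\mathbb R^m$ via the embedding, so $(A_sg)(x)=(\varphi'(s),\nabla_Mg(x))_{\mathbb R^m}-\frac12\Delta_Mg(x)$, with $(\cdot,\cdot)_{\mathbb R^m}$ the Euclidean inner product. Sign convention: $\Delta_M$ is the nonnegative Laplace–Beltrami operator, $\Delta_M=-\operatorname{div}_M\nabla_M$. The process generated by $A_s$ is the time-inhomogeneous diffusion $X_t(s,x)$ on $M$, started at $x$ at time $s$, with time-dependent generators $A_s$; its transition density $p$ with respect to $\lambda_M$ satisfies $\int_Mp(s,x,t,y)f(y)\lambda_M(dy)=\mathbb E[f(X_t(s,x))]$ for $f\in C(M)$, and for smooth $f$ the function $u(s,x)=\mathbb E[f(X_t(s,x))]$ solves $\frac{\partial}{\partial s}u=-A_su$, $u(t,\cdot)=f$. When $n=1$, $q_{\mathcal P}=q_\varphi$. *)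

theory Defs
  imports "HOL-Probability.Probability"
begin

section \<open>Smooth maps and embedded submanifolds of Euclidean space\<close>

primrec Ck_on :: "nat \<Rightarrow> 'a::euclidean_space set \<Rightarrow> ('a \<Rightarrow> 'b::real_normed_vector) \<Rightarrow> bool" where
  "Ck_on 0 U f \<longleftrightarrow> continuous_on U f"
| "Ck_on (Suc k) U f \<longleftrightarrow> (\<forall>x\<in>U. f differentiable (at x)) \<and>
     (\<forall>v. Ck_on k U (\<lambda>x. frechet_derivative f (at x) v))"

text \<open>\<^const>\<open>Ck_on\<close> and \<open>smooth_on\<close> are only meant for open \<open>U\<close>.\<close>

definition smooth_on :: "'a::euclidean_space set \<Rightarrow> ('a \<Rightarrow> 'b::real_normed_vector) \<Rightarrow> bool" where
  "smooth_on U f \<longleftrightarrow> (\<forall>k. Ck_on k U f)"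

definition local_param ::
    "'a::euclidean_space set \<Rightarrow> (real ^ 'd::finite) set \<Rightarrow> (real ^ 'd \<Rightarrow> 'a) \<Rightarrow> bool" where
  "local_param M U \<psi> \<longleftrightarrow>
     open U \<and> smooth_on U \<psi> \<and> (\<forall>u\<in>U. inj (frechet_derivative \<psi> (at u))) \<and>
     openin (top_of_set M) (\<psi> ` U) \<and> (\<exists>\<xi>. homeomorphism U (\<psi> ` U) \<psi> \<xi>)"

text \<open>The dimension of the manifold is the cardinality of the index type \<open>'d\<close>. Parameter domains
  are open in \<open>real ^ 'd\<close>, so there is no boundary. The Riemannian metric is the one induced by
  the ambient inner product.\<close>

definition embedded_submanifold :: "'d::finite itself \<Rightarrow> 'a::euclidean_space set \<Rightarrow> bool" where
  "embedded_submanifold d M \<longleftrightarrow>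
     (\<forall>x\<in>M. \<exists>(U :: (real ^ 'd) set) \<psi>. local_param M U \<psi> \<and> x \<in> \<psi> ` U)"

definition smooth_fun :: "'d::finite itself \<Rightarrow> 'a::euclidean_space set \<Rightarrow> ('a \<Rightarrow> real) \<Rightarrow> bool" where
  "smooth_fun d M f \<longleftrightarrow>
     (\<forall>(U :: (real ^ 'd) set) \<psi>. local_param M U \<psi> \<longrightarrow> smooth_on U (f \<circ> \<psi>))"

section \<open>Riemannian volume\<close>

definition gram :: "(real ^ 'd \<Rightarrow> 'a::euclidean_space) \<Rightarrow> real ^ 'd \<Rightarrow> real ^ 'd::finite ^ 'd" where
  "gram \<psi> u = (\<chi> i j. frechet_derivative \<psi> (at u) (axis i 1) \<bullet>
                       frechet_derivative \<psi> (at u) (axis j 1))"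

text \<open>In local coordinates the volume is \<open>sqrt (det (g\<^sub>i\<^sub>j)) du\<close>; together with the
  \<open>\<sigma>\<close>-algebra this determines the measure uniquely, since \<open>M\<close> is covered by countably many
  coordinate patches.\<close>

definition volume_measure :: "'d::finite itself \<Rightarrow> 'a::euclidean_space set \<Rightarrow> 'a measure \<Rightarrow> bool" where
  "volume_measure d M vol \<longleftrightarrow>
     space vol = M \<and> sets vol = sets (restrict_space borel M) \<and>
     (\<forall>(U :: (real ^ 'd) set) \<psi> B. local_param M U \<psi> \<and> B \<in> sets borel \<and> B \<subseteq> U \<longrightarrow>
        emeasure vol (\<psi> ` B) = (\<integral>\<^sup>+u\<in>B. ennreal (sqrt (det (gram \<psi> u))) \<partial>lborel))"

section \<open>Gradient, divergence and Laplace--Beltrami operator\<close>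

definition tangent_space :: "'a::euclidean_space set \<Rightarrow> 'a \<Rightarrow> 'a set" where
  "tangent_space M x = {w. \<exists>\<gamma> e. (0::real) < e \<and> smooth_on {-e<..<e} \<gamma> \<and> \<gamma> ` {-e<..<e} \<subseteq> M \<and>
     \<gamma> 0 = x \<and> (\<gamma> has_vector_derivative w) (at 0)}"

text \<open>A derivative within \<open>M\<close> is determined only on the tangent space, where it is the differential
  of \<open>g\<close> as a function on \<open>M\<close>; the gradient is the tangent vector that represents it.\<close>

definition mgrad :: "'a::euclidean_space set \<Rightarrow> ('a \<Rightarrow> real) \<Rightarrow> 'a \<Rightarrow> 'a" where
  "mgrad M g x = (THE v. v \<in> tangent_space M x \<and> (g has_derivative (\<lambda>h. v \<bullet> h)) (at x within M))"

text \<open>The Levi-Civita connection of \<open>M\<close> is the tangential part of the Euclidean derivative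
  \<open>D\<close>, so the divergence of \<open>V\<close>, the trace of \<open>w \<mapsto> \<nabla>\<^sub>w V\<close> on the tangent space, is the sum
  of \<open>D e \<bullet> e\<close> over any orthonormal basis of the tangent space.\<close>

definition mdiv :: "'a::euclidean_space set \<Rightarrow> ('a \<Rightarrow> 'a) \<Rightarrow> 'a \<Rightarrow> real" where
  "mdiv M V x = (THE c. \<exists>D B. (V has_derivative D) (at x within M) \<and>
     pairwise orthogonal B \<and> (\<forall>e\<in>B. norm e = 1) \<and> span B = tangent_space M x \<and>
     c = (\<Sum>e\<in>B. D e \<bullet> e))"

text \<open>Sign convention: the Laplacian is nonnegative.\<close>

definition laplace_beltrami :: "'a::euclidean_space set \<Rightarrow> ('a \<Rightarrow> real) \<Rightarrow> 'a \<Rightarrow> real" where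
  "laplace_beltrami M g x = - mdiv M (mgrad M g) x"

section \<open>Diffusions with time-dependent generator\<close>

definition C12_on ::
    "'d::finite itself \<Rightarrow> 'a::euclidean_space set \<Rightarrow> real \<Rightarrow> (real \<Rightarrow> 'a \<Rightarrow> real) \<Rightarrow> bool" where
  "C12_on d M t u \<longleftrightarrow>
     (\<exists>u'. (\<forall>s\<in>{0..t}. \<forall>x\<in>M. ((\<lambda>r. u r x) has_real_derivative u' s x) (at s within {0..t})) \<and>
           continuous_on ({0..t} \<times> M) (\<lambda>(s, x). u' s x)) \<and>
     continuous_on ({0..t} \<times> M) (\<lambda>(s, x). u s x) \<and>
     (\<forall>(U :: (real ^ 'd) set) \<psi>. local_param M U \<psi> \<longrightarrow>
        (\<forall>s\<in>{0..t}. Ck_on 2 U (u s \<circ> \<psi>)) \<and>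
        (\<forall>v w.
          continuous_on ({0..t} \<times> U) (\<lambda>(s, a). frechet_derivative (u s \<circ> \<psi>) (at a) v) \<and>
          continuous_on ({0..t} \<times> U) (\<lambda>(s, a).
            frechet_derivative (\<lambda>b. frechet_derivative (u s \<circ> \<psi>) (at b) v) (at a) w)))"

text \<open>Classical solutions of the backward equation on the closed time interval, with one-sided
  time derivatives at its end points.\<close>

definition backward_solution ::
    "'d::finite itself \<Rightarrow> 'a::euclidean_space set \<Rightarrow> (real \<Rightarrow> ('a \<Rightarrow> real) \<Rightarrow> 'a \<Rightarrow> real) \<Rightarrow>
     real \<Rightarrow> ('a \<Rightarrow> real) \<Rightarrow> (real \<Rightarrow> 'a \<Rightarrow> real) \<Rightarrow> bool" where
  "backward_solution d M A t f u \<longleftrightarrow>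
     C12_on d M t u \<and>
     (\<forall>s\<in>{0..t}. \<forall>x\<in>M. ((\<lambda>r. u r x) has_real_derivative - A s (u s) x) (at s within {0..t})) \<and>
     (\<forall>x\<in>M. u t x = f x)"

definition past :: "'w measure \<Rightarrow> (real \<Rightarrow> 'w \<Rightarrow> 'a::euclidean_space) \<Rightarrow> real \<Rightarrow> real \<Rightarrow> 'w measure" where
  "past N Y s r = sigma (space N) (\<Union>q\<in>{s..r}. {Y q -` B \<inter> space N | B. B \<in> sets borel})"

text \<open>\<open>X s x t\<close> is the position at time \<open>t\<close> of the process started in \<open>x\<close> at time \<open>s\<close>, a random
  variable on the probability space \<open>N s x\<close>.\<close>

definition diffusion_generated_by ::
    "'d::finite itself \<Rightarrow> 'a::euclidean_space set \<Rightarrow> (real \<Rightarrow> ('a \<Rightarrow> real) \<Rightarrow> 'a \<Rightarrow> real) \<Rightarrow>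
     (real \<Rightarrow> 'a \<Rightarrow> 'w measure) \<Rightarrow> (real \<Rightarrow> 'a \<Rightarrow> real \<Rightarrow> 'w \<Rightarrow> 'a) \<Rightarrow> bool" where
  "diffusion_generated_by d M A N X \<longleftrightarrow>
     (\<forall>s\<in>{0..1}. \<forall>x\<in>M.
        prob_space (N s x) \<and>
        (\<forall>t\<in>{s..1}. X s x t \<in> measurable (N s x) (restrict_space borel M)) \<and>
        (\<forall>\<omega>\<in>space (N s x). continuous_on {s..1} (\<lambda>t. X s x t \<omega>)) \<and>
        (AE \<omega> in N s x. X s x s \<omega> = x) \<and>
        (\<forall>r t f. s \<le> r \<and> r \<le> t \<and> t \<le> 1 \<and> continuous_on M f \<longrightarrow>
           (AE \<omega> in N s x.
              real_cond_exp (N s x) (past (N s x) (X s x) s r) (\<lambda>\<omega>. f (X s x t \<omega>)) \<omega> =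
              (\<integral>\<omega>'. f (X r (X s x r \<omega>) t \<omega>') \<partial>N r (X s x r \<omega>))))) \<and>
     (\<forall>t f. 0 < t \<and> t \<le> 1 \<and> smooth_fun d M f \<longrightarrow>
        backward_solution d M A t f (\<lambda>s x. \<integral>\<omega>. f (X s x t \<omega>) \<partial>N s x))"

definition transition_density ::
    "'a::euclidean_space set \<Rightarrow> 'a measure \<Rightarrow> (real \<Rightarrow> 'a \<Rightarrow> 'w measure) \<Rightarrow>
     (real \<Rightarrow> 'a \<Rightarrow> real \<Rightarrow> 'w \<Rightarrow> 'a) \<Rightarrow> (real \<Rightarrow> 'a \<Rightarrow> real \<Rightarrow> 'a \<Rightarrow> real) \<Rightarrow> bool" where
  "transition_density M vol N X p \<longleftrightarrow>
     (\<forall>s t. \<forall>x\<in>M. 0 \<le> s \<and> s < t \<and> t \<le> 1 \<longrightarrow>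
        (\<forall>y\<in>M. 0 \<le> p s x t y) \<and>
        distributed (N s x) vol (X s x t) (\<lambda>y. ennreal (p s x t y)))"

section \<open>The approximating kernels\<close>

definition q_kernel ::
    "'a::euclidean_space measure \<Rightarrow> (real \<Rightarrow> 'a) \<Rightarrow> real \<Rightarrow> 'a \<Rightarrow> real \<Rightarrow> 'a \<Rightarrow> real" where
  "q_kernel vol \<phi> s z t y =
     exp (- (norm (z - y - (\<phi> s - \<phi> t)))\<^sup>2 / (2 * (t - s))) /
     (\<integral>w. exp (- (norm (z - w - (\<phi> s - \<phi> t)))\<^sup>2 / (2 * (t - s))) \<partial>vol)"

text \<open>A partition \<open>s = t\<^sub>0 < \<dots> < t\<^sub>n = t\<close> is the list of its points.\<close>

definition partitions :: "real \<Rightarrow> real \<Rightarrow> real list set" where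
  "partitions s t = {P. 2 \<le> length P \<and> sorted_wrt (<) P \<and> hd P = s \<and> last P = t}"

definition mesh :: "real list \<Rightarrow> real" where
  "mesh P = Max {P ! Suc i - P ! i | i. Suc i < length P}"

text \<open>The value on lists with fewer than two points is irrelevant.\<close>

fun q_partition ::
    "'a::euclidean_space measure \<Rightarrow> (real \<Rightarrow> 'a) \<Rightarrow> real list \<Rightarrow> 'a \<Rightarrow> 'a \<Rightarrow> real" where
  "q_partition vol \<phi> [s, t] x y = q_kernel vol \<phi> s x t y"
| "q_partition vol \<phi> (s # r # t # P) x y =
     (\<integral>z. q_kernel vol \<phi> s x r z * q_partition vol \<phi> (r # t # P) z y \<partial>vol)"
| "q_partition vol \<phi> _ x y = 0"

definition mesh_to_0 :: "real \<Rightarrow> real \<Rightarrow> real list filter" where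
  "mesh_to_0 s t = inf (filtercomap mesh (at_right 0)) (principal (partitions s t))"

end

theory Submission
  imports Defs "HOL-Library.Landau_Symbols"
begin

text \<open>Let \<open>Q\<^sub>r\<^sub>,\<^sub>r\<^sub>'\<close> be the averaging operator with kernel \<open>q\<^sub>\<phi>(r, \<cdot>, r', \<cdot>)\<close> and \<open>u\<close> the solution of
  the backward equation with smooth terminal value \<open>f\<close>. The operators are contractions, so
  telescoping over a partition reduces the theorem for \<open>f\<close> to the consistency estimate
  \<open>Q\<^sub>r\<^sub>,\<^sub>r\<^sub>' u(r') - u(r) = o(r' - r)\<close>, uniformly on \<open>M\<close>; polynomials are dense in \<open>C(M)\<close>.

  For the consistency only the first two moments of the kernel in a chart \<open>\<psi>\<close> are needed, and no
  Gaussian integral has to be computed: with \<open>h = r' - r\<close>, \<open>\<alpha> = \<phi>(r) - \<phi>(r')\<close> and base point \<open>z\<close>,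
  integrating by parts against \<open>exp(-|z - \<alpha> - \<psi>|\<^sup>2/2h) sqrt(det g)\<close> expresses the mean of
  \<open>c (\<psi> - z + \<alpha>) \<bullet> \<partial>\<^sub>k\<psi> / h\<close> by that of \<open>\<partial>\<^sub>kc + c \<partial>\<^sub>k log sqrt(det g)\<close>. In a chart which is isometric to
  first order at the limit point, \<open>c = (b - a)\<^sub>j\<close> gives second moments \<open>h \<delta>\<^sub>j\<^sub>k + o(h)\<close>, and \<open>c = 1\<close> gives
  first moments \<open>h (\<phi>' \<bullet> \<partial>\<^sub>k\<psi> - 1/2 \<Sum>\<^sub>i \<partial>\<^sub>i\<partial>\<^sub>i\<psi> \<bullet> \<partial>\<^sub>k\<psi>) + o(h)\<close>; the derivative of the volume density
  cancels against the variation of \<open>\<partial>\<^sub>k\<psi>\<close>.\<close>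

section \<open>Calculus of \<open>C\<^sup>k\<close> maps\<close>

text \<open>The function \<open>u\<close> is not constructed here: for smooth terminal values it is
  the expectation of the terminal value along the diffusion, which solves the backward equation by
  hypothesis. The obstacle is uniformity in the base point. A chart can be made isometric at one
  point only, the limit \<open>a0\<close> of a sequence of base points, whereas the kernels are
  centred at the moving points \<open>a n\<close>. All expansions are therefore made about
  \<open>a n\<close>, with remainders uniform in \<open>n\<close> and quadratic coefficients frozen
  at \<open>a0\<close>. Freezing the linear coefficients as well would change the first moments by
  more than \<open>o(h)\<close>; they keep the Gram matrix at \<open>a n\<close>, and the moments
  solve a linear system whose matrix tends to the identity. A second obstacle is that a remainder of
  order \<open>o\<close> of the squared distance is \<open>o(h)\<close> on average only if second
  moments are \<open>O(h)\<close>. This a priori bound comes from the same integration by parts,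
  summed over the diagonal \<open>j = k\<close>, and from coercivity of the chart.\<close>

lemma frechet_derivative_cong_open:
  assumes "open U" "x \<in> U" "\<And>y. y \<in> U \<Longrightarrow> f y = g y"
  shows "frechet_derivative f (at x) = frechet_derivative g (at x)"
proof -
  have "(f has_derivative D) (at x) \<longleftrightarrow> (g has_derivative D) (at x)" for D
    by (metis assms has_derivative_transform_within_open)
  then show ?thesis unfolding frechet_derivative_def by simp
qed

lemma Ck_on_cong:
  assumes "open U" "\<And>y. y \<in> U \<Longrightarrow> f y = g y"
  shows "Ck_on k U f \<longleftrightarrow> Ck_on k U g"
  using assms(2)
proof (induction k arbitrary: f g)
  case 0
  then show ?case by (simp cong: continuous_on_cong)
next
  case (Suc k)
  have "f differentiable (at x) \<longleftrightarrow> g differentiable (at x)" if "x \<in> U" for x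
    unfolding differentiable_def
    by (metis assms(1) Suc.prems that has_derivative_transform_within_open)
  moreover have "Ck_on k U (\<lambda>x. frechet_derivative f (at x) v) \<longleftrightarrow>
      Ck_on k U (\<lambda>x. frechet_derivative g (at x) v)" for v
    by (rule Suc.IH) (simp add: frechet_derivative_cong_open[OF assms(1) _ Suc.prems])
  ultimately show ?case by simp
qed

lemma Ck_on_continuous_on:
  assumes "Ck_on k U f" shows "continuous_on U f"
proof (cases k)
  case 0
  then show ?thesis using assms by simp
next
  case (Suc j)
  then show ?thesis using assms
    by (auto intro!: continuous_at_imp_continuous_on differentiable_imp_continuous_within)
qed

lemma Ck_on_SucD: "Ck_on (Suc k) U f \<Longrightarrow> Ck_on k U f"
proof (induction k arbitrary: f)
  case 0
  then show ?case using Ck_on_continuous_on by fastforce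
next
  case (Suc k)
  then show ?case by (metis Ck_on.simps(2))
qed

lemma Ck_on_has_derivative:
  "Ck_on (Suc k) U f \<Longrightarrow> x \<in> U \<Longrightarrow> (f has_derivative frechet_derivative f (at x)) (at x)"
  by (simp add: frechet_derivative_works)

text \<open>\<open>Ck_on\<close> is built on the choice \<open>frechet_derivative\<close>; here an
  explicit formula \<open>f'\<close> takes its place, so that closure properties of order
  \<open>k + 1\<close> reduce to order \<open>k\<close> for that formula.\<close>

lemma Ck_on_has_derivativeI:
  assumes "open U" "\<And>x. x \<in> U \<Longrightarrow> (f has_derivative f' x) (at x)"
    and "\<And>v. Ck_on k U (\<lambda>x. f' x v)"
  shows "Ck_on (Suc k) U f"
proof -
  have "frechet_derivative f (at x) = f' x" if "x \<in> U" for x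
    using assms(2)[OF that] frechet_derivative_at by metis
  then have "Ck_on k U (\<lambda>x. frechet_derivative f (at x) v)" for v
    by (subst Ck_on_cong[OF assms(1), where g = "\<lambda>x. f' x v"]) (simp_all add: assms(3))
  then show ?thesis using assms(2) by (auto simp: differentiable_def)
qed

lemma Ck_on_const: "open U \<Longrightarrow> Ck_on k U (\<lambda>x. c)"
  by (induction k arbitrary: c) auto

lemma Ck_on_add:
  assumes "open U" "Ck_on k U f" "Ck_on k U g"
  shows "Ck_on k U (\<lambda>x. f x + g x)"
  using assms(2,3)
proof (induction k arbitrary: f g)
  case 0
  then show ?case by (simp add: continuous_on_add)
next
  case (Suc k)
  have "\<And>v. Ck_on k U (\<lambda>x. frechet_derivative f (at x) v)"
    "\<And>v. Ck_on k U (\<lambda>x. frechet_derivative g (at x) v)" using Suc.prems by auto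
  then show ?case
    by (intro Ck_on_has_derivativeI[OF assms(1), of _ "\<lambda>x v. frechet_derivative f (at x) v + frechet_derivative g (at x) v"]
        has_derivative_add Ck_on_has_derivative[OF Suc.prems(1)] Ck_on_has_derivative[OF Suc.prems(2)] Suc.IH)
qed

lemma Ck_on_bilinear:
  assumes "open U" "bounded_bilinear (B :: 'b::real_normed_vector \<Rightarrow> 'c::real_normed_vector \<Rightarrow> 'd::real_normed_vector)"
    "Ck_on k U f" "Ck_on k U g"
  shows "Ck_on k U (\<lambda>x. B (f x) (g x))"
  using assms(3,4)
proof (induction k arbitrary: f g)
  case 0
  then show ?case using bounded_bilinear.continuous_on[OF assms(2)] by auto
next
  case (Suc k)
  have f: "Ck_on k U f" and g: "Ck_on k U g" using Suc.prems Ck_on_SucD by blast+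
  have *: "\<And>v. Ck_on k U (\<lambda>x. frechet_derivative f (at x) v)"
    "\<And>v. Ck_on k U (\<lambda>x. frechet_derivative g (at x) v)" using Suc.prems by auto
  show ?case
  proof (rule Ck_on_has_derivativeI[OF assms(1)])
    show "((\<lambda>x. B (f x) (g x)) has_derivative (\<lambda>v. B (f x) (frechet_derivative g (at x) v) + B (frechet_derivative f (at x) v) (g x))) (at x)"
      if "x \<in> U" for x
      by (rule bounded_bilinear.FDERIV[OF assms(2) Ck_on_has_derivative[OF Suc.prems(1) that] Ck_on_has_derivative[OF Suc.prems(2) that]])
    show "Ck_on k U (\<lambda>x. B (f x) (frechet_derivative g (at x) v) + B (frechet_derivative f (at x) v) (g x))" for v
      by (intro Ck_on_add assms(1) Suc.IH f g *)
  qed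
qed

lemmas Ck_on_mult = Ck_on_bilinear[OF _ bounded_bilinear_mult]
lemmas Ck_on_inner = Ck_on_bilinear[OF _ bounded_bilinear_inner]

lemma Ck_on_sum: "open U \<Longrightarrow> (\<And>i. i \<in> I \<Longrightarrow> Ck_on k U (f i)) \<Longrightarrow> Ck_on k U (\<lambda>x. \<Sum>i\<in>I. f i x)"
  by (induction I rule: infinite_finite_induct) (auto intro: Ck_on_const Ck_on_add)

lemma Ck_on_prod:
  fixes f :: "'i \<Rightarrow> 'a::euclidean_space \<Rightarrow> real"
  shows "open U \<Longrightarrow> (\<And>i. i \<in> I \<Longrightarrow> Ck_on k U (f i)) \<Longrightarrow> Ck_on k U (\<lambda>x. \<Prod>i\<in>I. f i x)"
  by (induction I rule: infinite_finite_induct) (auto intro: Ck_on_const Ck_on_mult)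

text \<open>For an affine inner map the derivative in direction \<open>v\<close> is a derivative of
  \<open>f\<close> in the fixed direction \<open>L v\<close>, composed with the same map, so the
  induction closes without a chain rule of order \<open>k\<close>. It serves for straight lines in
  parameter domains and for linear changes of coordinates.\<close>

lemma Ck_on_compose_affine:
  fixes L :: "'b::euclidean_space \<Rightarrow> 'a::euclidean_space"
  assumes "Ck_on k U f" "open V" "linear L" "\<And>x. x \<in> V \<Longrightarrow> c + L x \<in> U"
  shows "Ck_on k V (\<lambda>x. f (c + L x))"
  using assms(1)
proof (induction k arbitrary: f)
  case 0
  have "continuous_on V (\<lambda>x. c + L x)"
    using assms(3) by (intro continuous_intros linear_continuous_on linear_conv_bounded_linear[THEN iffD1])
  then show ?case using 0 assms(4) by (auto intro!: continuous_on_compose2[of U f])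
next
  case (Suc k)
  have L: "bounded_linear L" using assms(3) linear_conv_bounded_linear by blast
  show ?case
  proof (rule Ck_on_has_derivativeI[OF assms(2)])
    show "((\<lambda>x. f (c + L x)) has_derivative (\<lambda>v. frechet_derivative f (at (c + L x)) (L v))) (at x)"
      if "x \<in> V" for x
    proof -
      have "((\<lambda>x. c + L x) has_derivative L) (at x)"
        using bounded_linear_imp_has_derivative[OF L] by (auto intro!: derivative_eq_intros)
      from has_derivative_compose[OF this Ck_on_has_derivative[OF Suc.prems assms(4)[OF that]]]
      show ?thesis by simp
    qed
    show "Ck_on k V (\<lambda>x. frechet_derivative f (at (c + L x)) (L v))" for v
      using Suc.IH[of "\<lambda>y. frechet_derivative f (at y) (L v)"] Suc.prems by simp
  qed
qed

text \<open>Ambient polynomials are the smooth terminal values used below. In the linear case a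
  bounded functional commutes with directional derivatives, which settles the induction on the
  order.\<close>

lemma real_polynomial_function_smooth_on:
  assumes "real_polynomial_function f" "open U" "smooth_on U \<psi>"
  shows "smooth_on U (f \<circ> \<psi>)"
  using assms(1)
proof (induction f rule: real_polynomial_function.induct)
  case (linear f)
  have "Ck_on k U (\<lambda>x. f (g x))" if "Ck_on k U g" for k g
    using that
  proof (induction k arbitrary: g)
    case 0
    then show ?case using bounded_linear.continuous_on[OF linear] by simp
  next
    case (Suc k)
    show ?case
    proof (rule Ck_on_has_derivativeI[OF assms(2)])
      show "((\<lambda>x. f (g x)) has_derivative (\<lambda>v. f (frechet_derivative g (at x) v))) (at x)" if "x \<in> U" for x
        using bounded_linear.has_derivative[OF linear Ck_on_has_derivative[OF Suc.prems that]] .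
      show "Ck_on k U (\<lambda>x. f (frechet_derivative g (at x) v))" for v
        using Suc by simp
    qed
  qed
  then show ?case using assms(3) by (simp add: smooth_on_def o_def)
next
  case (const c)
  show ?case using Ck_on_const[OF assms(2), of _ c] unfolding smooth_on_def o_def by blast
next
  case (add f g)
  then show ?case using Ck_on_add[OF assms(2)] unfolding smooth_on_def o_def by blast
next
  case (mult f g)
  then show ?case using Ck_on_mult[OF assms(2)] unfolding smooth_on_def o_def by blast
qed

text \<open>The mean value inequality is applied to \<open>g' - t H\<close> and again to
  \<open>g\<close> minus a quadratic polynomial. \<open>H\<close> is kept apart from
  \<open>g'' 0\<close>: later it is a second derivative at the limit point, while the expansion
  starts at a nearby point.\<close>

lemma quadratic_bound:
  fixes g :: "real \<Rightarrow> 'b::real_normed_vector"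
  assumes g: "\<And>t. t \<in> {0..1} \<Longrightarrow> (g has_vector_derivative g' t) (at t)"
    and g': "\<And>t. t \<in> {0..1} \<Longrightarrow> (g' has_vector_derivative g'' t) (at t)"
    and B: "\<And>t. t \<in> {0..1} \<Longrightarrow> norm (g'' t - H) \<le> B"
  shows "norm (g 1 - g 0 - g' 0 - (1/2) *\<^sub>R H) \<le> B"
proof -
  have 1: "norm (g' t - g' 0 - t *\<^sub>R H) \<le> B" if t: "t \<in> {0..1}" for t
  proof -
    have "norm ((\<lambda>s. g' s - s *\<^sub>R H) t - (\<lambda>s. g' s - s *\<^sub>R H) 0) \<le> B * norm (t - 0)"
    proof (rule differentiable_bound[where f' = "\<lambda>s x. x *\<^sub>R (g'' s - H)" and S = "{0..1}"])
      show "((\<lambda>s. g' s - s *\<^sub>R H) has_derivative (\<lambda>x. x *\<^sub>R (g'' s - H))) (at s within {0..1})" if "s \<in> {0..1}" for s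
        by (rule derivative_eq_intros has_derivative_at_withinI[OF g'[OF that, unfolded has_vector_derivative_def]] refl)+
          (simp add: algebra_simps)
      show "onorm (\<lambda>x. x *\<^sub>R (g'' s - H)) \<le> B" if "s \<in> {0..1}" for s
        using B[OF that] by (intro onorm_le) (simp add: mult.commute[of B] mult_left_mono)
    qed (use t in auto)
    also have "\<dots> \<le> B * 1" using t order_trans[OF norm_ge_zero B[of 0]]
      by (intro mult_left_mono) auto
    finally show ?thesis by (simp add: algebra_simps)
  qed
  have "norm ((\<lambda>s. g s - s *\<^sub>R g' 0 - (s^2/2) *\<^sub>R H) 1 - (\<lambda>s. g s - s *\<^sub>R g' 0 - (s^2/2) *\<^sub>R H) 0) \<le> B * norm (1 - 0::real)"
  proof (rule differentiable_bound[where f' = "\<lambda>s x. x *\<^sub>R (g' s - g' 0 - s *\<^sub>R H)" and S = "{0..1}"])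
    show "((\<lambda>s. g s - s *\<^sub>R g' 0 - (s^2/2) *\<^sub>R H) has_derivative (\<lambda>x. x *\<^sub>R (g' s - g' 0 - s *\<^sub>R H))) (at s within {0..1})" if "s \<in> {0..1}" for s
    proof -
      have "((\<lambda>s. s^2/2) has_derivative (\<lambda>x. x * s)) (at s within {0..1})"
        by (auto intro!: derivative_eq_intros)
      note q = has_derivative_scaleR_left[OF this, of H]
      show ?thesis
        by (rule has_derivative_eq_rhs[OF has_derivative_diff[OF has_derivative_diff[OF
            has_derivative_at_withinI[OF g[OF that, unfolded has_vector_derivative_def]]
            has_derivative_scaleR_left[OF has_derivative_ident]] q]])
          (simp add: fun_eq_iff algebra_simps)
    qed
    show "onorm (\<lambda>x. x *\<^sub>R (g' s - g' 0 - s *\<^sub>R H)) \<le> B" if "s \<in> {0..1}" for s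
      using 1[OF that] by (intro onorm_le) (simp add: mult.commute[of B] mult_left_mono)
  qed auto
  then show ?thesis by (simp add: algebra_simps)
qed

lemma taylor2_bound:
  fixes f :: "'a::euclidean_space \<Rightarrow> 'b::real_normed_vector"
  assumes f: "Ck_on 2 U f" and B: "convex B" "B \<subseteq> U" "a \<in> B" "b \<in> B"
    and H: "\<And>x. x \<in> B \<Longrightarrow> norm (frechet_derivative (\<lambda>y. frechet_derivative f (at y) (b - a)) (at x) (b - a) - H) \<le> e"
  shows "norm (f b - f a - frechet_derivative f (at a) (b - a) - (1/2) *\<^sub>R H) \<le> e"
proof -
  define c where "c t = a + t *\<^sub>R (b - a)" for t
  have c: "c t \<in> B" if "t \<in> {0..1}" for t
    using convexD_alt[OF B(1,3,4), of t] that by (simp add: c_def algebra_simps)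
  have cd: "(c has_vector_derivative (b - a)) (at t)" for t
    unfolding c_def by (auto intro!: derivative_eq_intros)
  have f2: "Ck_on (Suc 1) U f" using f by (simp add: numeral_2_eq_2)
  then have f1: "Ck_on (Suc 0) U (\<lambda>y. frechet_derivative f (at y) (b - a))" by simp
  have chain: "((\<lambda>t. k (c t)) has_vector_derivative frechet_derivative k (at (c t)) (b - a)) (at t)"
    if k: "Ck_on (Suc j) U k" and t: "t \<in> {0..1}" for k :: "'a \<Rightarrow> 'b" and t j
  proof -
    have D: "(k has_derivative frechet_derivative k (at (c t))) (at (c t))"
      using Ck_on_has_derivative[OF k] c[OF t] B(2) by blast
    have "((\<lambda>t. k (c t)) has_derivative (\<lambda>x. frechet_derivative k (at (c t)) (x *\<^sub>R (b - a)))) (at t)"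
      using has_derivative_compose[OF cd[unfolded has_vector_derivative_def] D] .
    then show ?thesis
      unfolding has_vector_derivative_def
      using linear_scale[OF has_derivative_linear[OF D]] by (simp add: )
  qed
  have "norm ((\<lambda>t. f (c t)) 1 - (\<lambda>t. f (c t)) 0 - (\<lambda>t. frechet_derivative f (at (c t)) (b - a)) 0 - (1/2) *\<^sub>R H) \<le> e"
    by (rule quadratic_bound[OF chain[OF f2] chain[OF f1]]) (use c H in auto)
  then show ?thesis by (simp add: c_def)
qed

text \<open>The second difference is symmetric in \<open>v\<close> and \<open>w\<close>, whereas
  \<open>H\<close> approximates a derivative taken first along \<open>v\<close>; comparing both
  orders yields symmetry of second derivatives. The proof uses the mean value inequality along
  \<open>w\<close> for the derivative along \<open>v\<close>, and then along \<open>v\<close> for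
  \<open>f\<close>.\<close>

lemma second_difference_bound:
  fixes f :: "'a::euclidean_space \<Rightarrow> 'b::real_normed_vector"
  assumes f: "Ck_on 2 U f" and S: "convex S" "S \<subseteq> U" "a \<in> S" "a + v \<in> S" "a + w \<in> S" "a + (v + w) \<in> S"
    and H: "\<And>x. x \<in> S \<Longrightarrow> norm (frechet_derivative (\<lambda>y. frechet_derivative f (at y) v) (at x) w - H) \<le> e"
  shows "norm (f (a + (v + w)) - f (a + v) - f (a + w) + f a - H) \<le> e"
proof -
  have f2: "Ck_on (Suc 1) U f" using f by (simp add: numeral_2_eq_2)
  then have f1: "Ck_on (Suc 0) U (\<lambda>y. frechet_derivative f (at y) v)" by simp
  have chain: "((\<lambda>t. k (x + t *\<^sub>R u)) has_derivative (\<lambda>h. h *\<^sub>R frechet_derivative k (at (x + t *\<^sub>R u)) u)) (at t)"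
    if k: "Ck_on (Suc j) U k" and t: "x + t *\<^sub>R u \<in> S" for k :: "'a \<Rightarrow> 'b" and t j x u
  proof -
    have D: "(k has_derivative frechet_derivative k (at (x + t *\<^sub>R u))) (at (x + t *\<^sub>R u))"
      using Ck_on_has_derivative[OF k] t S(2) by blast
    have cd: "((\<lambda>t. x + t *\<^sub>R u) has_derivative (\<lambda>h. h *\<^sub>R u)) (at t)"
      by (auto intro!: derivative_eq_intros)
    have "((\<lambda>t. k (x + t *\<^sub>R u)) has_derivative (\<lambda>h. frechet_derivative k (at (x + t *\<^sub>R u)) (h *\<^sub>R u))) (at t)"
      using has_derivative_compose[OF cd D] .
    then show ?thesis
      using linear_scale[OF has_derivative_linear[OF D]] by simp
  qed
  have mem1: "a + t *\<^sub>R v \<in> S" and mem2: "(a + w) + t *\<^sub>R v \<in> S" if "t \<in> {0..1}" for t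
    using convexD_alt[OF S(1,3,4), of t] convexD_alt[OF S(1,5,6), of t] that by (simp_all add: fun_eq_iff algebra_simps)
  have mem: "(a + t *\<^sub>R v) + r *\<^sub>R w \<in> S" if "t \<in> {0..1}" "r \<in> {0..1}" for t r
    using convexD_alt[OF S(1) mem1[OF that(1)] mem2[OF that(1)], of r] that by (simp add: algebra_simps)
  have e: "0 \<le> e" using order_trans[OF norm_ge_zero H[OF S(3)]] .
  let ?g = "\<lambda>y. frechet_derivative f (at y) v"
  have 1: "norm (?g ((a + w) + t *\<^sub>R v) - ?g (a + t *\<^sub>R v) - H) \<le> e" if t: "t \<in> {0..1}" for t
  proof -
    have "norm ((\<lambda>r. ?g ((a + t *\<^sub>R v) + r *\<^sub>R w) - r *\<^sub>R H) 1 - (\<lambda>r. ?g ((a + t *\<^sub>R v) + r *\<^sub>R w) - r *\<^sub>R H) 0) \<le> e * norm (1 - 0 :: real)"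
    proof (rule differentiable_bound[where f' = "\<lambda>r h. h *\<^sub>R (frechet_derivative ?g (at ((a + t *\<^sub>R v) + r *\<^sub>R w)) w - H)" and S = "{0..1}"])
      show "((\<lambda>r. ?g ((a + t *\<^sub>R v) + r *\<^sub>R w) - r *\<^sub>R H) has_derivative (\<lambda>h. h *\<^sub>R (frechet_derivative ?g (at ((a + t *\<^sub>R v) + r *\<^sub>R w)) w - H))) (at r within {0..1})" if "r \<in> {0..1}" for r
        by (rule derivative_eq_intros has_derivative_at_withinI[OF chain[OF f1 mem[OF t that]]] refl)+
          (simp_all add: fun_eq_iff algebra_simps)
      show "onorm (\<lambda>h. h *\<^sub>R (frechet_derivative ?g (at ((a + t *\<^sub>R v) + r *\<^sub>R w)) w - H)) \<le> e" if "r \<in> {0..1}" for r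
        using H[OF mem[OF t that]] by (intro onorm_le) (simp add: mult.commute[of e] mult_left_mono)
    qed auto
    then show ?thesis by (simp add: algebra_simps)
  qed
  have "norm ((\<lambda>t. f ((a + w) + t *\<^sub>R v) - f (a + t *\<^sub>R v) - t *\<^sub>R H) 1 - (\<lambda>t. f ((a + w) + t *\<^sub>R v) - f (a + t *\<^sub>R v) - t *\<^sub>R H) 0) \<le> e * norm (1 - 0 :: real)"
  proof (rule differentiable_bound[where f' = "\<lambda>t h. h *\<^sub>R (?g ((a + w) + t *\<^sub>R v) - ?g (a + t *\<^sub>R v) - H)" and S = "{0..1}"])
    show "((\<lambda>t. f ((a + w) + t *\<^sub>R v) - f (a + t *\<^sub>R v) - t *\<^sub>R H) has_derivative (\<lambda>h. h *\<^sub>R (?g ((a + w) + t *\<^sub>R v) - ?g (a + t *\<^sub>R v) - H))) (at t within {0..1})" if "t \<in> {0..1}" for t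
      by (rule derivative_eq_intros has_derivative_at_withinI[OF chain[OF f2 mem1[OF that]]]
          has_derivative_at_withinI[OF chain[OF f2 mem2[OF that]]] refl)+
        (simp_all add: fun_eq_iff algebra_simps)
    show "onorm (\<lambda>h. h *\<^sub>R (?g ((a + w) + t *\<^sub>R v) - ?g (a + t *\<^sub>R v) - H)) \<le> e" if "t \<in> {0..1}" for t
      using 1[OF that] by (intro onorm_le) (simp add: mult.commute[of e] mult_left_mono)
  qed auto
  then show ?thesis by (simp add: algebra_simps)
qed

lemma frechet_derivative_second_linear:
  assumes "open U" "x \<in> U" "Ck_on 2 U f"
  shows "linear (\<lambda>v. frechet_derivative (\<lambda>y. frechet_derivative f (at y) v) (at x) w)"
    and "linear (\<lambda>w. frechet_derivative (\<lambda>y. frechet_derivative f (at y) v) (at x) w)"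
proof -
  let ?g = "\<lambda>v y. frechet_derivative f (at y) v"
  have f2: "Ck_on (Suc 1) U f" using assms(3) by (simp add: numeral_2_eq_2)
  have lin: "linear (frechet_derivative f (at y))" if "y \<in> U" for y
    using Ck_on_has_derivative[OF f2 that] has_derivative_linear by blast
  have d: "(?g v has_derivative frechet_derivative (?g v) (at x)) (at x)" for v
    using f2 assms(2) by (intro Ck_on_has_derivative[of 0 U]) auto
  show "linear (\<lambda>w. frechet_derivative (?g v) (at x) w)"
    using d has_derivative_linear by blast
  show "linear (\<lambda>v. frechet_derivative (?g v) (at x) w)"
  proof (rule linearI)
    fix v u c
    have "(?g (v + u) has_derivative (\<lambda>w. frechet_derivative (?g v) (at x) w + frechet_derivative (?g u) (at x) w)) (at x)"
      by (rule has_derivative_transform_within_open[OF has_derivative_add[OF d[of v] d[of u]] assms(1,2)])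
        (simp add: linear_add[OF lin])
    then show "frechet_derivative (?g (v + u)) (at x) w = frechet_derivative (?g v) (at x) w + frechet_derivative (?g u) (at x) w"
      by (rule fun_cong[OF frechet_derivative_at, symmetric])
    have "(?g (c *\<^sub>R v) has_derivative (\<lambda>w. c *\<^sub>R frechet_derivative (?g v) (at x) w)) (at x)"
      by (rule has_derivative_transform_within_open[OF has_derivative_scaleR_right[OF d[of v], of c] assms(1,2)])
        (simp add: linear_scale[OF lin])
    then show "frechet_derivative (?g (c *\<^sub>R v)) (at x) w = c *\<^sub>R frechet_derivative (?g v) (at x) w"
      by (rule fun_cong[OF frechet_derivative_at, symmetric])
  qed
qed

lemma frechet_derivative_second_symmetric:
  fixes f :: "'a::euclidean_space \<Rightarrow> 'b::real_normed_vector"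
  assumes U: "open U" "a \<in> U" and f: "Ck_on 2 U f"
  shows "frechet_derivative (\<lambda>y. frechet_derivative f (at y) v) (at a) w =
    frechet_derivative (\<lambda>y. frechet_derivative f (at y) w) (at a) v"
proof (rule ccontr)
  define D where "D v w x = frechet_derivative (\<lambda>y. frechet_derivative f (at y) v) (at x) w" for v w x
  assume "\<not> ?thesis"
  then have ne: "norm (D v w a - D w v a) > 0" by (simp add: D_def)
  \<comment> \<open>Both orders of differentiation approximate the same second difference up to a
    scaled error \<open>e\<close>, so they differ by at most \<open>2 * e\<close>; a third of their
    distance contradicts this.\<close>
  define e where "e = norm (D v w a - D w v a) / 3"
  have "e > 0" using ne by (simp add: e_def)
  have "continuous_on U (D v w)" for v w using f by (simp add: numeral_2_eq_2 D_def)
  then have lim: "(D v w \<longlongrightarrow> D v w a) (at a)" for v w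
    using U by (simp add: continuous_on_eq_continuous_at isCont_def)
  have "\<forall>\<^sub>F x in nhds a. dist (D v w x) (D v w a) < e \<and> dist (D w v x) (D w v a) < e \<and> x \<in> U"
  proof -
    have *: "\<forall>\<^sub>F x in nhds a. dist (D v w x) (D v w a) < e" for v w
      using tendstoD[OF lim[of v w] \<open>e > 0\<close>] \<open>e > 0\<close>
      unfolding eventually_at_filter by (elim eventually_mono) (metis UNIV_I dist_self)
    show ?thesis by (intro eventually_conj * eventually_nhds_in_open U)
  qed
  then obtain d where d: "d > 0" "\<And>x. dist x a < d \<Longrightarrow> dist (D v w x) (D v w a) < e \<and> dist (D w v x) (D w v a) < e \<and> x \<in> U"
    unfolding eventually_nhds_metric by blast
  \<comment> \<open>Scaling by \<open>s\<close> keeps the whole parallelogram in the ball of radius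
    \<open>d\<close>; the summand 1 keeps the denominator positive when \<open>v\<close> and
    \<open>w\<close> vanish.\<close>
  define s where "s = d / (2 * (norm v + norm w + 1))"
  have s: "s > 0" unfolding s_def using d(1) by (intro divide_pos_pos mult_pos_pos add_nonneg_pos) auto
  have "s * (norm v + norm w + 1) = d / 2" 
    using add_nonneg_pos[of "norm v + norm w" 1] unfolding s_def by (simp add: field_simps)
  moreover have "s * (norm v + norm w) \<le> s * (norm v + norm w + 1)" using s by simp
  ultimately have small: "s * norm v + s * norm w < d" using d(1) by (simp add: algebra_simps)
  have sv: "0 \<le> s * norm v" "0 \<le> s * norm w" using s by auto
  have nvw: "norm (s *\<^sub>R v + s *\<^sub>R w) < d"
    using norm_triangle_ineq[of "s *\<^sub>R v" "s *\<^sub>R w"] small s by simp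
  have S: "ball a d \<subseteq> U" using d(2) by (auto simp: dist_commute)
  have lv: "linear (\<lambda>v. D v w x)" "linear (\<lambda>w. D v w x)" if "x \<in> U" for v w x
    unfolding D_def using frechet_derivative_second_linear[OF U(1) that f] by auto
  have key: "norm (f (a + (s *\<^sub>R v + s *\<^sub>R w)) - f (a + s *\<^sub>R v) - f (a + s *\<^sub>R w) + f a - s^2 *\<^sub>R D v w a) \<le> s^2 * e"
    if "\<And>x. dist x a < d \<Longrightarrow> dist (D v w x) (D v w a) < e" "s * norm v + s * norm w < d" "0 \<le> s * norm v" "0 \<le> s * norm w"
      "norm (s *\<^sub>R v + s *\<^sub>R w) < d" for v w
  proof (rule second_difference_bound[OF f convex_ball[of a d] S])
    fix x assume x: "x \<in> ball a d"
    then have "x \<in> U" using S by auto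
    have "D (s *\<^sub>R v) (s *\<^sub>R w) x = s^2 *\<^sub>R D v w x"
      using linear_scale[OF lv(1)[OF \<open>x \<in> U\<close>]] linear_scale[OF lv(2)[OF \<open>x \<in> U\<close>]] by (simp add: power2_eq_square)
    then have "norm (D (s *\<^sub>R v) (s *\<^sub>R w) x - s^2 *\<^sub>R D v w a) = s^2 * dist (D v w x) (D v w a)"
      by (simp add: dist_norm flip: scaleR_diff_right)
    also have "\<dots> \<le> s^2 * e" using that(1)[of x] x by (intro mult_left_mono) (auto simp: dist_commute)
    finally show "norm (frechet_derivative (\<lambda>y. frechet_derivative f (at y) (s *\<^sub>R v)) (at x) (s *\<^sub>R w) - s^2 *\<^sub>R D v w a) \<le> s^2 * e"
      unfolding D_def .
  next
    have "s * norm v < d" "s * norm w < d" using that(2-4) by linarith+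
    moreover have "norm (- (s *\<^sub>R v) - s *\<^sub>R w) < d"
      using that(5) norm_minus_cancel[of "s *\<^sub>R v + s *\<^sub>R w"] by simp
    ultimately show "a \<in> ball a d" "a + s *\<^sub>R v \<in> ball a d" "a + s *\<^sub>R w \<in> ball a d" "a + (s *\<^sub>R v + s *\<^sub>R w) \<in> ball a d"
      using d(1) that(5) s by (simp_all add: mem_ball dist_commute[of a] dist_norm)
  qed
  let ?d = "f (a + (s *\<^sub>R v + s *\<^sub>R w)) - f (a + s *\<^sub>R v) - f (a + s *\<^sub>R w) + f a"
  have k1: "norm (?d - s^2 *\<^sub>R D v w a) \<le> s^2 * e"
    by (rule key) (use d sv small nvw in auto)
  have k2: "norm (?d - s^2 *\<^sub>R D w v a) \<le> s^2 * e"
    using key[of w v] d sv small nvw by (simp add: add.commute algebra_simps)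
  have "s^2 *\<^sub>R (D v w a - D w v a) = (?d - s^2 *\<^sub>R D w v a) - (?d - s^2 *\<^sub>R D v w a)"
    by (simp add: algebra_simps)
  then have "norm (s^2 *\<^sub>R (D v w a - D w v a)) \<le> s^2 * e + s^2 * e"
    using norm_triangle_ineq4[of "?d - s^2 *\<^sub>R D w v a" "?d - s^2 *\<^sub>R D v w a"] k1 k2 by (simp only:)
  then have "s^2 * norm (D v w a - D w v a) \<le> s^2 * (2 * e)" by (simp add: mult_ac)
  then have "norm (D v w a - D w v a) \<le> 2 * e" using s by simp
  then show False using \<open>e > 0\<close> by (simp add: e_def)
qed

section \<open>Integration by parts and a cutoff function\<close>

text \<open>Translation invariance of Lebesgue measure makes every difference quotient in direction
  \<open>p\<close> integrate to 0, and dominated convergence passes to the derivative. The majorant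
  is a Lipschitz constant on a ball containing the support and its translates.\<close>

lemma integral_derivative_compact_support:
  fixes f :: "'a::euclidean_space \<Rightarrow> real"
  assumes f: "\<And>x. (f has_derivative f' x) (at x)"
    and cont: "continuous_on UNIV (\<lambda>x. f' x p)"
    and supp: "\<And>x. x \<notin> K \<Longrightarrow> f x = 0" and K: "compact K"
  shows "(\<integral>x. f' x p \<partial>lborel) = 0"
proof -
  have f'0: "f' x p = 0" if "x \<notin> K" for x
  proof -
    have "(f has_derivative (\<lambda>h. 0)) (at x)"
      by (rule has_derivative_transform_within_open[where f = "\<lambda>_. 0" and s = "- K"])
        (use that K supp in \<open>auto simp: compact_imp_closed\<close>)
    then show ?thesis using has_derivative_unique[OF f] by metis
  qed
  have "bounded ((\<lambda>x. f' x p) ` K)"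
    by (intro compact_imp_bounded compact_continuous_image K continuous_on_subset[OF cont]) auto
  then obtain B where B: "\<And>x. x \<in> K \<Longrightarrow> \<bar>f' x p\<bar> \<le> B" by (auto simp: bounded_iff)
  define C where "C = max B 0"
  have C: "\<bar>f' x p\<bar> \<le> C" for x
    using B[of x] f'0[of x] by (cases "x \<in> K") (auto simp: C_def)
  have C0: "0 \<le> C" by (simp add: C_def)
  obtain r where r: "\<And>x. x \<in> K \<Longrightarrow> norm x \<le> r" using compact_imp_bounded[OF K] by (auto simp: bounded_iff)
  \<comment> \<open>The step sizes \<open>s n\<close> are at most 1, so outside the ball of radius
    \<open>R\<close> neither \<open>x\<close> nor its translate lies in \<open>K\<close>.\<close>
  define R where "R = r + norm p"
  define s where "s n = inverse (real (Suc n))" for n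
  have s: "0 < s n" "s n \<le> 1" for n by (auto simp: s_def inverse_eq_divide)
  have s0: "s \<longlonglongrightarrow> 0" unfolding s_def by (rule LIMSEQ_inverse_real_of_nat)
  have fc: "continuous_on UNIV f"
    using f by (meson continuous_at_imp_continuous_on has_derivative_continuous)
  have fm: "f \<in> borel_measurable borel" using fc by (rule borel_measurable_continuous_onI)
  have fint: "integrable lborel f"
    using borel_integrable_compact[OF K continuous_on_subset[OF fc]] supp
    by (subst Bochner_Integration.integrable_cong[of lborel lborel f "\<lambda>x. indicator K x *\<^sub>R f x"]) (auto simp: indicator_def)
  have fint2: "integrable lborel (\<lambda>x. f (t + x))" for t
    using fint integrable_distr_eq[of "(+) t" lborel borel f] by (simp add: fm lborel_distr_plus)
  have feq: "(\<integral>x. f (t + x) \<partial>lborel) = (\<integral>x. f x \<partial>lborel)" for t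
    by (subst (2) lborel_distr_plus[of t, symmetric]) (simp add: integral_distr fm)
  have lip: "\<bar>f (s *\<^sub>R p + x) - f x\<bar> \<le> C * \<bar>s\<bar>" for s x
  proof -
    have 0: "((\<lambda>t. f (t *\<^sub>R p + x)) has_derivative (\<lambda>h. h * f' (t *\<^sub>R p + x) p)) (at t within UNIV)" for t
    proof -
      have "((\<lambda>t. t *\<^sub>R p + x) has_derivative (\<lambda>h. h *\<^sub>R p)) (at t)" by (auto intro!: derivative_eq_intros)
      from has_derivative_compose[OF this f] show ?thesis
        using linear_scale[OF has_derivative_linear[OF f]] by simp
    qed
    have "norm ((\<lambda>t. f (t *\<^sub>R p + x)) s - (\<lambda>t. f (t *\<^sub>R p + x)) 0) \<le> C * norm (s - 0)"
      by (rule differentiable_bound[OF convex_UNIV 0])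
        (auto intro!: onorm_le simp: abs_mult mult.commute[of C] mult_left_mono C)
    then show ?thesis by simp
  qed
  have "(\<lambda>n. \<integral>x. (f (s n *\<^sub>R p + x) - f x) / s n \<partial>lborel) \<longlonglongrightarrow> (\<integral>x. f' x p \<partial>lborel)"
  proof (rule integral_dominated_convergence[where w = "\<lambda>x. indicator (cball 0 R) x *\<^sub>R C"])
    show "(\<lambda>x. f' x p) \<in> borel_measurable lborel"
      using borel_measurable_continuous_onI[OF cont] by simp
    show "(\<lambda>x. (f (s n *\<^sub>R p + x) - f x) / s n) \<in> borel_measurable lborel" for n
      using fint fint2[of "s n *\<^sub>R p"] by (auto dest!: borel_measurable_integrable)
    show "integrable lborel (\<lambda>x. indicator (cball 0 R) x *\<^sub>R C :: real)"
      by (rule borel_integrable_compact) auto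
    show "AE x in lborel. (\<lambda>n. (f (s n *\<^sub>R p + x) - f x) / s n) \<longlonglongrightarrow> f' x p"
    proof (rule AE_I2)
      fix x
      have "((\<lambda>t. t *\<^sub>R p + x) has_derivative (\<lambda>h. h *\<^sub>R p)) (at 0)" by (auto intro!: derivative_eq_intros)
      from has_derivative_compose[OF this, of f "f' x"] f[of x]
      have "((\<lambda>t. f (t *\<^sub>R p + x)) has_derivative (\<lambda>h. f' x (h *\<^sub>R p))) (at 0)" by simp
      moreover have "(\<lambda>h. f' x (h *\<^sub>R p)) = (*) (f' x p)"
        using linear_scale[OF has_derivative_linear[OF f[of x]]] by (simp add: fun_eq_iff mult.commute)
      ultimately have "((\<lambda>t. f (t *\<^sub>R p + x)) has_real_derivative f' x p) (at 0)"
        by (simp add: has_field_derivative_def)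
      then have "((\<lambda>t. (f (t *\<^sub>R p + x) - f x) / t) \<longlongrightarrow> f' x p) (at 0)"
        by (simp add: DERIV_def)
      moreover have "filterlim s (at 0) sequentially"
        using s0 s(1) by (auto simp: filterlim_at less_imp_neq[symmetric] intro!: always_eventually)
      ultimately show "(\<lambda>n. (f (s n *\<^sub>R p + x) - f x) / s n) \<longlonglongrightarrow> f' x p"
        by (rule filterlim_compose)
    qed
    show "AE x in lborel. norm ((f (s n *\<^sub>R p + x) - f x) / s n) \<le> indicator (cball 0 R) x *\<^sub>R C" for n
    proof (rule AE_I2)
      fix x
      show "norm ((f (s n *\<^sub>R p + x) - f x) / s n) \<le> indicator (cball 0 R) x *\<^sub>R C"
      proof (cases "norm x \<le> R")
        case True
        then show ?thesis using lip[of "s n" x] s(1)[of n] by (simp add: divide_le_eq)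
      next
        case False
        have "norm p \<ge> s n * norm p" using s[of n] by (simp add: mult_left_le_one_le)
        then have "norm (s n *\<^sub>R p + x) > r" "norm x > r"
          using False norm_triangle_ineq2[of x "- (s n *\<^sub>R p)"] s[of n] by (auto simp: R_def add.commute) (smt (verit) norm_ge_zero)
        then have "x \<notin> K" "s n *\<^sub>R p + x \<notin> K" using r by force+
        then show ?thesis using supp C0 by (auto simp: indicator_def)
      qed
    qed
  qed
  moreover have "(\<integral>x. (f (s n *\<^sub>R p + x) - f x) / s n \<partial>lborel) = 0" for n
    using fint fint2[of "s n *\<^sub>R p"] feq by simp
  ultimately show ?thesis by (simp only: LIMSEQ_const_iff)
qed

text \<open>Only one derivative is ever put on the cutoff, so a squared positive part suffices: the
  square makes the derivative continuous across the sphere of radius \<open>\<rho>\<close>. At the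
  centre the value is 1 with vanishing derivative, so the deviation from 1 is quadratic.\<close>

definition cutoff :: "real \<Rightarrow> 'a::euclidean_space \<Rightarrow> 'a \<Rightarrow> real" where
  "cutoff \<rho> a b = (max 0 (1 - (norm (b - a))\<^sup>2 / \<rho>\<^sup>2))\<^sup>2"

definition cutoff' :: "real \<Rightarrow> 'a::euclidean_space \<Rightarrow> 'a \<Rightarrow> 'a \<Rightarrow> real" where
  "cutoff' \<rho> a b v = - 4 / \<rho>\<^sup>2 * max 0 (1 - (norm (b - a))\<^sup>2 / \<rho>\<^sup>2) * ((b - a) \<bullet> v)"

lemma has_derivative_cutoff: "(cutoff \<rho> a has_derivative cutoff' \<rho> a b) (at b)"
proof -
  have "((\<lambda>x::real. (max 0 x)\<^sup>2) has_real_derivative 2 * max 0 x) (at x)" for x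
  proof (cases x "0::real" rule: linorder_cases)
    case less
    show ?thesis
      by (rule has_field_derivative_transform_within_open[where f = "\<lambda>x. 0" and S = "{..<0}"]) (use less in auto)
  next
    case greater
    show ?thesis
      by (rule has_field_derivative_transform_within_open[where f = "\<lambda>x. x\<^sup>2" and S = "{0<..}"])
        (use greater in \<open>auto intro!: derivative_eq_intros\<close>)
  next
    case equal
    have "((\<lambda>h::real. (max 0 h)\<^sup>2 / h) \<longlongrightarrow> 0) (at 0)"
    proof (rule tendsto_rabs_zero_cancel, rule tendsto_sandwich[of "\<lambda>_. 0" _ _ "\<lambda>h. \<bar>h\<bar>"])
      show "\<forall>\<^sub>F h in at 0. \<bar>(max 0 h)\<^sup>2 / h\<bar> \<le> \<bar>h::real\<bar>"
        by (rule always_eventually) (auto simp: max_def power2_eq_square)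
    qed (auto intro!: tendsto_eq_intros)
    then show ?thesis using equal by (simp add: DERIV_def)
  qed
  note d = has_derivative_compose[OF _ this[unfolded has_field_derivative_def]]
  have "((\<lambda>b. 1 - (norm (b - a))\<^sup>2 / \<rho>\<^sup>2) has_derivative (\<lambda>v. - 2 * ((b - a) \<bullet> v) / \<rho>\<^sup>2)) (at b)"
    unfolding power2_norm_eq_inner divide_inverse
    by (auto intro!: derivative_eq_intros simp: inner_commute)
  from d[OF this] show ?thesis
    unfolding cutoff_def[abs_def] cutoff'_def[abs_def] by (rule has_derivative_eq_rhs) (auto simp: fun_eq_iff)
qed

lemma cutoff_bounds: "0 \<le> cutoff \<rho> a b" "cutoff \<rho> a b \<le> 1"
proof -
  have "max 0 (1 - (norm (b - a))\<^sup>2 / \<rho>\<^sup>2) \<le> 1" by simp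
  then show "cutoff \<rho> a b \<le> 1" unfolding cutoff_def by (intro power_le_one) auto
qed (simp add: cutoff_def)

lemma cutoff_eq_0: "\<rho> > 0 \<Longrightarrow> b \<notin> cball a \<rho> \<Longrightarrow> cutoff \<rho> a b = 0"
proof -
  assume "\<rho> > 0" "b \<notin> cball a \<rho>"
  then have "\<rho>\<^sup>2 \<le> (norm (b - a))\<^sup>2" by (intro power_mono) (auto simp: dist_norm norm_minus_commute)
  then show ?thesis using \<open>\<rho> > 0\<close> by (simp add: cutoff_def max_def)
qed

text \<open>Thanks to this quadratic bound the cutoff drops out of expansions: multiplied by a
  quantity tending to 0 its error is \<open>o\<close> of the squared distance. It also shows that
  the cutoff is at least 1/2 on the ball of half the radius.\<close>

lemma cutoff_lower: "1 - cutoff \<rho> a b \<le> 2 * (norm (b - a))\<^sup>2 / \<rho>\<^sup>2"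
proof -
  define x where "x = (norm (b - a))\<^sup>2 / \<rho>\<^sup>2"
  have "x \<ge> 0" by (simp add: x_def)
  have "1 - (max 0 (1 - x))\<^sup>2 \<le> 2 * x"
  proof (cases "x \<le> 1")
    case True
    have "1 - (1 - x)\<^sup>2 \<le> 2 * x" by (simp add: power2_eq_square algebra_simps)
    then show ?thesis using True by simp
  qed (simp add: max_def)
  then show ?thesis unfolding x_def cutoff_def by simp
qed

lemma continuous_on_cutoff: "continuous_on S (cutoff \<rho> a)"
  using has_derivative_cutoff by (meson continuous_at_imp_continuous_on has_derivative_continuous)

lemma continuous_on_cutoff': "continuous_on S (\<lambda>b. cutoff' \<rho> a b v)"
  unfolding cutoff'_def divide_inverse by (intro continuous_intros)

section \<open>Second-order expansions along a sequence of base points\<close>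

text \<open>The filter is \<open>nhds x\<close> and not \<open>at x\<close> because the points of a
  sequence may coincide with their limit.\<close>

lemma continuous_on_open_tendsto_nhds:
  fixes f :: "'a::t2_space \<Rightarrow> 'b::topological_space"
  shows "open U \<Longrightarrow> x \<in> U \<Longrightarrow> continuous_on U f \<Longrightarrow> (f \<longlongrightarrow> f x) (nhds x)"
  by (subst tendsto_at_iff_tendsto_nhds[symmetric]) (auto simp: continuous_on_eq_continuous_at isCont_def)

lemma linear_axis_expansion:
  fixes f :: "real ^ 'd::finite \<Rightarrow> 'b::real_vector"
  assumes "linear f"
  shows "f v = (\<Sum>i\<in>UNIV. v $ i *\<^sub>R f (axis i 1))"
proof -
  have "f v = f (\<Sum>i\<in>UNIV. v $ i *\<^sub>R axis i 1)"
    using basis_expansion[of v] by (simp add: scalar_mult_eq_scaleR)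
  also have "\<dots> = (\<Sum>i\<in>UNIV. v $ i *\<^sub>R f (axis i 1))"
    by (simp add: linear_sum[OF assms] linear_scale[OF assms])
  finally show ?thesis .
qed

lemma linear_axis_bound:
  fixes f :: "real ^ 'd::finite \<Rightarrow> 'b::real_normed_vector" and e :: real
  assumes "linear f" "\<And>i. norm (f (axis i 1)) \<le> e"
  shows "norm (f v) \<le> CARD('d) * e * norm v"
proof -
  have "norm (f v) \<le> (\<Sum>i\<in>UNIV. norm (v $ i *\<^sub>R f (axis i 1)))"
    by (subst linear_axis_expansion[OF assms(1)]) (rule norm_sum)
  also have "\<dots> \<le> (\<Sum>i\<in>(UNIV::'d set). norm v * e)"
    by (intro sum_mono) (auto intro!: mult_mono component_le_norm_cart assms(2))
  finally show ?thesis by (simp add: mult_ac)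
qed

lemma frechet_derivative_second_expansion:
  fixes f :: "real ^ 'd::finite \<Rightarrow> 'b::real_normed_vector"
  assumes "open U" "x \<in> U" "Ck_on 2 U f"
  shows "frechet_derivative (\<lambda>y. frechet_derivative f (at y) v) (at x) w =
    (\<Sum>i\<in>UNIV. \<Sum>j\<in>UNIV. (v $ i * w $ j) *\<^sub>R frechet_derivative (\<lambda>y. frechet_derivative f (at y) (axis i 1)) (at x) (axis j 1))"
  apply (subst linear_axis_expansion[OF frechet_derivative_second_linear(1)[OF assms]])
  apply (subst linear_axis_expansion[OF frechet_derivative_second_linear(2)[OF assms]])
  apply (simp add: scaleR_sum_right)
  done

lemma smallo_inner:
  fixes f k :: "'x \<Rightarrow> 'b::real_inner"
  assumes "(\<lambda>x. norm (f x)) \<in> o[F](g1)" "(\<lambda>x. norm (k x)) \<in> O[F](g2)"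
  shows "(\<lambda>x. f x \<bullet> k x) \<in> o[F](\<lambda>x. g1 x * g2 x :: real)"
    and "(\<lambda>x. k x \<bullet> f x) \<in> o[F](\<lambda>x. g2 x * g1 x :: real)"
proof -
  have 1: "(\<lambda>x. f x \<bullet> k x) \<in> O[F](\<lambda>x. norm (f x) * norm (k x))"
    by (rule bigoI[of _ 1]) (simp add: Cauchy_Schwarz_ineq2)
  have 2: "(\<lambda>x. norm (f x) * norm (k x)) \<in> o[F](\<lambda>x. g1 x * g2 x)"
    by (rule landau_o.small_big_mult[OF assms])
  show 3: "(\<lambda>x. f x \<bullet> k x) \<in> o[F](\<lambda>x. g1 x * g2 x)"
    by (rule landau_o.big_small_trans[OF 1 2])
  then show "(\<lambda>x. k x \<bullet> f x) \<in> o[F](\<lambda>x. g2 x * g1 x)" by (simp add: inner_commute mult.commute)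
qed

lemma bigo_inner:
  fixes f k :: "'x \<Rightarrow> 'b::real_inner"
  assumes "(\<lambda>x. norm (f x)) \<in> O[F](g1)" "(\<lambda>x. norm (k x)) \<in> O[F](g2)"
  shows "(\<lambda>x. f x \<bullet> k x) \<in> O[F](\<lambda>x. g1 x * g2 x :: real)"
proof -
  have 1: "(\<lambda>x. f x \<bullet> k x) \<in> O[F](\<lambda>x. norm (f x) * norm (k x))"
    by (rule bigoI[of _ 1]) (simp add: Cauchy_Schwarz_ineq2)
  have 2: "(\<lambda>x. norm (f x) * norm (k x)) \<in> O[F](\<lambda>x. g1 x * g2 x)"
    by (rule landau_o.big_mult[OF assms])
  show ?thesis by (rule landau_o.big_trans[OF 1 2])
qed

lemma smallo_norm_tendsto:
  fixes f :: "'x \<Rightarrow> 'b::real_normed_vector"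
  assumes "(f \<longlongrightarrow> l) F"
  shows "(\<lambda>x. norm (f x - l)) \<in> o[F](\<lambda>_. 1 :: real)"
proof (rule landau_o.smallI)
  fix c :: real assume "c > 0"
  from tendstoD[OF assms this] show "\<forall>\<^sub>F x in F. norm (norm (f x - l)) \<le> c * norm (1::real)"
    by eventually_elim (simp add: dist_norm)
qed

lemma bigo_norm_tendsto:
  fixes f :: "'x \<Rightarrow> 'b::real_normed_vector"
  assumes "(f \<longlongrightarrow> l) F"
  shows "(\<lambda>x. norm (f x)) \<in> O[F](\<lambda>_. 1 :: real)"
proof (rule landau_o.bigI[of "norm l + 1"])
  show "\<forall>\<^sub>F x in F. norm (norm (f x)) \<le> (norm l + 1) * norm (1::real)"
    using tendstoD[OF tendsto_norm[OF assms] zero_less_one]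
    by eventually_elim (auto simp: dist_real_def)
qed (auto intro: add_nonneg_pos)

locale point_sequence =
  fixes a :: "nat \<Rightarrow> real ^ 'd::finite" and a0 :: "real ^ 'd"
  assumes a_lim: "a \<longlonglongrightarrow> a0"
begin

text \<open>The index tends to infinity and the point to \<open>a0\<close> independently, so a
  Landau estimate along \<open>F\<close> is uniform over all late base points and all points near
  them. The distance \<open>N\<close> is measured from the moving base point, not from
  \<open>a0\<close>.\<close>

definition F :: "(nat \<times> (real ^ 'd)) filter" where "F = sequentially \<times>\<^sub>F nhds a0"

definition N :: "nat \<times> (real ^ 'd) \<Rightarrow> real" where "N x = norm (snd x - a (fst x))"

lemma tendsto_fst_F: "(f \<longlongrightarrow> l) sequentially \<Longrightarrow> ((\<lambda>x. f (fst x)) \<longlongrightarrow> l) F"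
  unfolding F_def by (rule filterlim_compose[OF _ filterlim_fst])

lemma eventually_snd_F: "eventually P (nhds a0) \<Longrightarrow> eventually (\<lambda>x. P (snd x)) F"
  unfolding F_def using filterlim_snd filterlim_iff by metis

lemma eventually_fst_F: "eventually P sequentially \<Longrightarrow> eventually (\<lambda>x. P (fst x)) F"
  unfolding F_def using filterlim_fst filterlim_iff by metis

lemma snd_lim [tendsto_intros]: "(snd \<longlongrightarrow> a0) F"
  unfolding F_def by (rule filterlim_snd)

lemma a_fst_lim [tendsto_intros]: "((\<lambda>x. a (fst x)) \<longlongrightarrow> a0) F"
  by (rule tendsto_fst_F[OF a_lim])

lemma N_lim [tendsto_intros]: "(N \<longlongrightarrow> 0) F"
  unfolding N_def[abs_def] by (auto intro!: tendsto_eq_intros)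

text \<open>Half of the radius around \<open>a0\<close> absorbs the distance from \<open>a n\<close>
  to \<open>a0\<close>; the other half is left for a ball around \<open>a n\<close> whose radius
  does not depend on \<open>n\<close>.\<close>

lemma eventually_F_D:
  assumes "eventually P F"
  obtains n0 d where "d > 0" "\<And>n b. n \<ge> n0 \<Longrightarrow> norm (b - a n) < d \<Longrightarrow> P (n, b)"
proof -
  obtain P1 P2 where P: "eventually P1 sequentially" "eventually P2 (nhds a0)" "\<And>n b. P1 n \<Longrightarrow> P2 b \<Longrightarrow> P (n, b)"
    using assms unfolding F_def eventually_prod_filter by auto
  obtain e where e: "e > 0" "\<And>b. dist b a0 < e \<Longrightarrow> P2 b" using P(2) unfolding eventually_nhds_metric by auto
  have "\<forall>\<^sub>F n in sequentially. P1 n \<and> dist (a n) a0 < e / 2"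
    using tendstoD[OF a_lim, of "e / 2"] e(1) by (intro eventually_conj P(1)) auto
  then obtain n0 where n0: "\<And>n. n \<ge> n0 \<Longrightarrow> P1 n \<and> dist (a n) a0 < e / 2" unfolding eventually_sequentially by auto
  show thesis
  proof (rule that[of "e / 2" n0])
    fix n b assume "n \<ge> n0" "norm (b - a n) < e / 2"
    then have "dist b a0 < e" using n0[of n] dist_triangle[of b a0 "a n"] by (simp add: dist_norm)
    then show "P (n, b)" using P(3) e(2) n0[OF \<open>n \<ge> n0\<close>] by blast
  qed (use e in auto)
qed

lemma comp_bigo: "(\<lambda>x. (snd x - a (fst x)) $ k) \<in> O[F](N)"
  using component_le_norm_cart[of "snd x - a (fst x)" k for x]
  by (intro bigoI[of _ 1] always_eventually) (simp add: N_def del: vector_minus_component)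

lemma linear_bigo:
  assumes "linear f"
  shows "(\<lambda>x. norm (f (snd x - a (fst x)))) \<in> O[F](N)"
proof -
  obtain B where "\<And>v. norm (f v) \<le> B * norm v" using linear_bounded[OF assms] by blast
  then show ?thesis by (intro bigoI[of _ B]) (simp add: N_def)
qed

text \<open>A continuous derivative is strict: one linear map serves for differences of two points
  that both tend to \<open>a0\<close>. The mean value inequality is applied to \<open>f\<close>
  minus this map on a ball around \<open>a0\<close>.\<close>

lemma strict_derivative_smallo:
  fixes f :: "real ^ 'd \<Rightarrow> 'b::real_normed_vector"
  assumes "open U" "a0 \<in> U" "Ck_on 1 U f"
  shows "(\<lambda>x. norm (f (snd x) - f (a (fst x)) - frechet_derivative f (at a0) (snd x - a (fst x)))) \<in> o[F](N)"
proof (rule landau_o.smallI)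
  fix c :: real assume c: "c > 0"
  have f1: "Ck_on (Suc 0) U f" using assms(3) by simp
  define e where "e = c / CARD('d)"
  have e: "e > 0" using c by (simp add: e_def)
  have "\<forall>\<^sub>F b in nhds a0. \<forall>i. dist (frechet_derivative f (at b) (axis i 1)) (frechet_derivative f (at a0) (axis i 1)) < e"
  proof (rule eventually_all_finite)
    fix i
    have "continuous_on U (\<lambda>b. frechet_derivative f (at b) (axis i 1))" using f1 by simp
    then have "((\<lambda>b. frechet_derivative f (at b) (axis i 1)) \<longlongrightarrow> frechet_derivative f (at a0) (axis i 1)) (nhds a0)"
      by (rule continuous_on_open_tendsto_nhds[OF assms(1,2)])
    from tendstoD[OF this e] show "\<forall>\<^sub>F b in nhds a0. dist (frechet_derivative f (at b) (axis i 1)) (frechet_derivative f (at a0) (axis i 1)) < e" .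
  qed
  with eventually_nhds_in_open[OF assms(1,2)]
  have "\<forall>\<^sub>F b in nhds a0. b \<in> U \<and> (\<forall>i. dist (frechet_derivative f (at b) (axis i 1)) (frechet_derivative f (at a0) (axis i 1)) < e)"
    by (rule eventually_conj)
  then obtain d where d: "d > 0" "\<And>b. dist b a0 < d \<Longrightarrow> b \<in> U \<and> (\<forall>i. dist (frechet_derivative f (at b) (axis i 1)) (frechet_derivative f (at a0) (axis i 1)) < e)"
    unfolding eventually_nhds_metric by blast
  have lin: "linear (frechet_derivative f (at b))" if "b \<in> U" for b
    using Ck_on_has_derivative[OF f1 that] has_derivative_linear by blast
  have bd: "norm (frechet_derivative f (at b) v - frechet_derivative f (at a0) v) \<le> c * norm v" if "dist b a0 < d" for b v
  proof -
    have "linear (\<lambda>v. frechet_derivative f (at b) v - frechet_derivative f (at a0) v)"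
      using lin d(2)[OF that] assms(2) by (intro linear_compose_sub) auto
    from linear_axis_bound[OF this, of e v] d(2)[OF that] show ?thesis
      by (auto simp: dist_norm less_imp_le e_def)
  qed
  have main: "norm (f b - f b' - frechet_derivative f (at a0) (b - b')) \<le> c * norm (b - b')"
    if "b \<in> ball a0 d" "b' \<in> ball a0 d" for b b'
  proof -
    have "norm ((\<lambda>b. f b - frechet_derivative f (at a0) b) b - (\<lambda>b. f b - frechet_derivative f (at a0) b) b') \<le> c * norm (b - b')"
    proof (rule differentiable_bound[where f' = "\<lambda>b v. frechet_derivative f (at b) v - frechet_derivative f (at a0) v" and S = "ball a0 d"])
      fix x assume x: "x \<in> ball a0 d"
      then have "x \<in> U" using d(2) by (simp add: dist_commute)
      have "((frechet_derivative f (at a0)) has_derivative (frechet_derivative f (at a0))) (at x)"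
        using lin[OF assms(2)] by (intro bounded_linear_imp_has_derivative) (simp add: linear_conv_bounded_linear)
      then show "((\<lambda>b. f b - frechet_derivative f (at a0) b) has_derivative (\<lambda>v. frechet_derivative f (at x) v - frechet_derivative f (at a0) v)) (at x within ball a0 d)"
        by (rule has_derivative_diff[OF has_derivative_at_withinI[OF Ck_on_has_derivative[OF f1 \<open>x \<in> U\<close>]] has_derivative_at_withinI])
      show "onorm (\<lambda>v. frechet_derivative f (at x) v - frechet_derivative f (at a0) v) \<le> c"
        using bd[of x] x by (intro onorm_le) (auto simp: dist_commute)
    qed (use that in auto)
    then show ?thesis unfolding linear_diff[OF lin[OF assms(2)], of b b'] by (simp add: algebra_simps)
  qed
  have "\<forall>\<^sub>F x in F. dist (snd x) a0 < d" "\<forall>\<^sub>F x in F. dist (a (fst x)) a0 < d"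
    using tendstoD[OF snd_lim d(1)] tendstoD[OF a_fst_lim d(1)] .
  then show "\<forall>\<^sub>F x in F. norm (norm (f (snd x) - f (a (fst x)) - frechet_derivative f (at a0) (snd x - a (fst x)))) \<le> c * norm (N x)"
    by eventually_elim (auto simp: N_def dist_commute intro!: main)
qed

text \<open>The linear term stays at \<open>a n\<close>, since moving it to \<open>a0\<close> would
  in general cost more than \<open>o\<close> of the squared distance; the quadratic term can be
  frozen at its limit \<open>H\<close>. The functions depend on \<open>n\<close> because the
  solution is later read at times depending on \<open>n\<close>.\<close>

lemma second_order_smallo:
  fixes f :: "nat \<Rightarrow> real ^ 'd \<Rightarrow> 'b::real_normed_vector"
  assumes U: "open U" "a0 \<in> U" and f: "\<And>n. Ck_on 2 U (f n)"
    and lim: "\<And>i j. ((\<lambda>x. frechet_derivative (\<lambda>b. frechet_derivative (f (fst x)) (at b) (axis i 1)) (at (snd x)) (axis j 1)) \<longlongrightarrow> H i j) F"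
  shows "(\<lambda>x. norm (f (fst x) (snd x) - f (fst x) (a (fst x)) - frechet_derivative (f (fst x)) (at (a (fst x))) (snd x - a (fst x))
     - (1/2) *\<^sub>R (\<Sum>i\<in>UNIV. \<Sum>j\<in>UNIV. ((snd x - a (fst x)) $ i * (snd x - a (fst x)) $ j) *\<^sub>R H i j))) \<in> o[F](\<lambda>x. (N x)\<^sup>2)"
proof (rule landau_o.smallI)
  fix c :: real assume c: "c > 0"
  \<comment> \<open>The tolerance is divided by the number of index pairs over which it is summed
    below.\<close>
  define e where "e = c / (CARD('d) * CARD('d))"
  have e: "e > 0" using c by (simp add: e_def)
  let ?D = "\<lambda>n i j b. frechet_derivative (\<lambda>b. frechet_derivative (f n) (at b) (axis i 1)) (at b) (axis j 1)"
  have "\<forall>\<^sub>F x in F. \<forall>i j. dist (?D (fst x) i j (snd x)) (H i j) < e"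
    by (intro eventually_all_finite tendstoD[OF lim e])
  moreover have "\<forall>\<^sub>F x in F. snd x \<in> U"
    by (rule eventually_snd_F[OF eventually_nhds_in_open[OF U]])
  ultimately have "\<forall>\<^sub>F x in F. (\<forall>i j. dist (?D (fst x) i j (snd x)) (H i j) < e) \<and> snd x \<in> U"
    by (rule eventually_conj)
  then obtain n0 d where d: "d > 0" "\<And>n b. n \<ge> n0 \<Longrightarrow> norm (b - a n) < d \<Longrightarrow> (\<forall>i j. dist (?D n i j b) (H i j) < e) \<and> b \<in> U"
    by (rule eventually_F_D) fastforce
  have main: "norm (f n b - f n (a n) - frechet_derivative (f n) (at (a n)) (b - a n)
      - (1/2) *\<^sub>R (\<Sum>i\<in>UNIV. \<Sum>j\<in>UNIV. ((b - a n) $ i * (b - a n) $ j) *\<^sub>R H i j)) \<le> c * (norm (b - a n))\<^sup>2"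
    if n: "n \<ge> n0" and b: "norm (b - a n) < d" for n b
  proof (rule taylor2_bound[OF f[of n], of "ball (a n) d"])
    show "ball (a n) d \<subseteq> U" using d(2)[OF n] by (auto simp: dist_norm norm_minus_commute)
    fix x assume x: "x \<in> ball (a n) d"
    then have xd: "norm (x - a n) < d" by (simp add: dist_norm norm_minus_commute)
    have "frechet_derivative (\<lambda>y. frechet_derivative (f n) (at y) (b - a n)) (at x) (b - a n) - (\<Sum>i\<in>UNIV. \<Sum>j\<in>UNIV. ((b - a n) $ i * (b - a n) $ j) *\<^sub>R H i j)
      = (\<Sum>i\<in>UNIV. \<Sum>j\<in>UNIV. ((b - a n) $ i * (b - a n) $ j) *\<^sub>R (?D n i j x - H i j))"
      using d(2)[OF n xd] by (subst frechet_derivative_second_expansion[OF U(1) _ f]) (auto simp: scaleR_diff_right sum_subtractf)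
    also have "norm \<dots> \<le> (\<Sum>i\<in>(UNIV::'d set). \<Sum>j\<in>(UNIV::'d set). (norm (b - a n) * norm (b - a n)) * e)"
    proof (intro sum_norm_le)
      fix i j
      have "norm (?D n i j x - H i j) \<le> e" using d(2)[OF n xd] by (auto simp: dist_norm less_imp_le)
      then show "norm (((b - a n) $ i * (b - a n) $ j) *\<^sub>R (?D n i j x - H i j)) \<le> norm (b - a n) * norm (b - a n) * e"
        unfolding norm_scaleR abs_mult by (intro mult_mono component_le_norm_cart) auto
    qed
    also have "\<dots> = c * (norm (b - a n))\<^sup>2" by (simp add: e_def power2_eq_square)
    finally show "norm (frechet_derivative (\<lambda>y. frechet_derivative (f n) (at y) (b - a n)) (at x) (b - a n) - (\<Sum>i\<in>UNIV. \<Sum>j\<in>UNIV. ((b - a n) $ i * (b - a n) $ j) *\<^sub>R H i j)) \<le> c * (norm (b - a n))\<^sup>2" .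
  qed (use d b in \<open>auto simp: dist_norm norm_minus_commute\<close>)
  have "\<forall>\<^sub>F x in F. N x < d" using order_tendstoD(2)[OF N_lim d(1)] .
  moreover have "\<forall>\<^sub>F x in F. fst x \<ge> n0" by (rule eventually_fst_F[OF eventually_ge_at_top])
  ultimately show "\<forall>\<^sub>F x in F. norm (norm (f (fst x) (snd x) - f (fst x) (a (fst x)) - frechet_derivative (f (fst x)) (at (a (fst x))) (snd x - a (fst x))
     - (1/2) *\<^sub>R (\<Sum>i\<in>UNIV. \<Sum>j\<in>UNIV. ((snd x - a (fst x)) $ i * (snd x - a (fst x)) $ j) *\<^sub>R H i j))) \<le> c * norm ((N x)\<^sup>2)"
  proof eventually_elim
    case (elim x)
    then show ?case using main[of "fst x" "snd x"] by (simp add: N_def)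
  qed
qed

end

section \<open>Moments of the averaging kernels in a chart\<close>

text \<open>The usual power of \<open>2 \<pi> h\<close> is left out: the kernel is divided by its
  own integral over \<open>M\<close>, where this factor would cancel.\<close>

definition gauss_weight :: "real \<Rightarrow> 'a::euclidean_space \<Rightarrow> 'a \<Rightarrow> real" where
  "gauss_weight h c y = exp (- (norm (c - y))\<^sup>2 / (2 * h))"

text \<open>Isometric to first order at \<open>a0\<close> only. The constant 1/4 in
  \<open>near\<close> turns this into Lipschitz bounds 3/4 and 5/4 on the ball of radius
  \<open>2 * \<rho>\<close>, which contains the balls of radius \<open>\<rho>\<close> around all
  \<open>a n\<close>.\<close>

locale normal_chart = point_sequence a a0
  for a :: "nat \<Rightarrow> real ^ 'd::finite" and a0 :: "real ^ 'd" +
  fixes U :: "(real ^ 'd) set" and \<psi> :: "real ^ 'd \<Rightarrow> 'a::euclidean_space" and \<rho> :: real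
  assumes U: "open U" "cball a0 (2 * \<rho>) \<subseteq> U" and \<rho>: "\<rho> > 0"
    and a_mem: "\<And>n. a n \<in> cball a0 \<rho>"
    and \<psi>: "Ck_on 2 U \<psi>"
    and orth: "\<And>i j. frechet_derivative \<psi> (at a0) (axis i 1) \<bullet> frechet_derivative \<psi> (at a0) (axis j 1) = (if i = j then 1 else 0)"
    and near: "\<And>b v. b \<in> cball a0 (2 * \<rho>) \<Longrightarrow>
       norm (frechet_derivative \<psi> (at b) v - frechet_derivative \<psi> (at a0) v) \<le> norm v / 4"
begin

abbreviation "K \<equiv> cball a0 (2 * \<rho>)"
abbreviation "Kn n \<equiv> cball (a n) \<rho>"
abbreviation "D\<psi> b v \<equiv> frechet_derivative \<psi> (at b) v"
abbreviation "D2\<psi> i j \<equiv> frechet_derivative (\<lambda>b. frechet_derivative \<psi> (at b) (axis i 1)) (at a0) (axis j 1)"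

lemma Kn_sub: "Kn n \<subseteq> K"
proof
  fix x assume "x \<in> Kn n"
  then show "x \<in> K" using a_mem[of n] dist_triangle[of a0 x "a n"] by auto
qed

lemma Kn_U: "Kn n \<subseteq> U" using Kn_sub U(2) by blast

lemma a0_U: "a0 \<in> U" using \<rho> U(2) by auto

lemma a_Kn: "a n \<in> Kn n" and a_U: "a n \<in> U"
  using \<rho> Kn_U[of n] by auto

lemma \<psi>2: "Ck_on (Suc 1) U \<psi>" using \<psi> by (simp add: numeral_2_eq_2)

lemma \<psi>_C1: "Ck_on 1 U \<psi>" using Ck_on_SucD[OF \<psi>2] .

lemma D\<psi>_C1: "Ck_on 1 U (\<lambda>b. D\<psi> b v)" using \<psi>2 by simp

lemma lin: "b \<in> U \<Longrightarrow> linear (frechet_derivative \<psi> (at b))"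
  using Ck_on_has_derivative[OF \<psi>2] has_derivative_linear by blast

lemma isometry: "D\<psi> a0 v \<bullet> D\<psi> a0 u = v \<bullet> u"
  by (simp only: linear_axis_expansion[OF lin[OF a0_U], of v] linear_axis_expansion[OF lin[OF a0_U], of u]
        inner_sum_left inner_sum_right inner_scaleR_left inner_scaleR_right orth)
      (simp add: inner_vec_def if_distrib[where f = "\<lambda>x. _ * x"] mult_ac cong: if_cong)

lemma norm_D\<psi>_a0: "norm (D\<psi> a0 v) = norm v"
  using isometry[of v v] by (simp add: norm_eq_sqrt_inner)

lemma norm_D\<psi>: "b \<in> K \<Longrightarrow> norm (D\<psi> b v) \<le> 5/4 * norm v"
  using near[of b v] norm_D\<psi>_a0[of v] norm_triangle_ineq[of "D\<psi> b v - D\<psi> a0 v" "D\<psi> a0 v"] by simp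

lemma X_near: "b \<in> K \<Longrightarrow> b' \<in> K \<Longrightarrow> norm (\<psi> b - \<psi> b' - D\<psi> a0 (b - b')) \<le> norm (b - b') / 4"
proof -
  assume b: "b \<in> K" "b' \<in> K"
  have "norm ((\<lambda>b. \<psi> b - D\<psi> a0 b) b - (\<lambda>b. \<psi> b - D\<psi> a0 b) b') \<le> 1/4 * norm (b - b')"
  proof (rule differentiable_bound[where f' = "\<lambda>b v. D\<psi> b v - D\<psi> a0 v" and S = K])
    fix x assume x: "x \<in> K"
    then have "x \<in> U" using U(2) by blast
    have "((frechet_derivative \<psi> (at a0)) has_derivative (frechet_derivative \<psi> (at a0))) (at x)"
      using lin[OF a0_U] by (intro bounded_linear_imp_has_derivative) (simp add: linear_conv_bounded_linear)
    then show "((\<lambda>b. \<psi> b - D\<psi> a0 b) has_derivative (\<lambda>v. D\<psi> x v - D\<psi> a0 v)) (at x within K)"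
      by (rule has_derivative_diff[OF has_derivative_at_withinI[OF Ck_on_has_derivative[OF \<psi>2 \<open>x \<in> U\<close>]] has_derivative_at_withinI])
    show "onorm (\<lambda>v. D\<psi> x v - D\<psi> a0 v) \<le> 1/4"
      using near[OF x] by (intro onorm_le) auto
  qed (use b in auto)
  then show ?thesis unfolding linear_diff[OF lin[OF a0_U], of b b'] by (simp add: algebra_simps)
qed

lemma X_lower: "b \<in> K \<Longrightarrow> b' \<in> K \<Longrightarrow> 3/4 * norm (b - b') \<le> norm (\<psi> b - \<psi> b')"
  using X_near[of b b'] norm_D\<psi>_a0[of "b - b'"] norm_triangle_ineq2[of "D\<psi> a0 (b - b')" "\<psi> b - \<psi> b'"]
  by (simp add: norm_minus_commute)

lemma X_upper: "b \<in> K \<Longrightarrow> b' \<in> K \<Longrightarrow> norm (\<psi> b - \<psi> b') \<le> 5/4 * norm (b - b')"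
  using X_near[of b b'] norm_D\<psi>_a0[of "b - b'"] norm_triangle_ineq2[of "\<psi> b - \<psi> b'" "D\<psi> a0 (b - b')"]
  by simp

lemma abs_inner_le: "norm x \<le> A \<Longrightarrow> norm y \<le> B \<Longrightarrow> \<bar>x \<bullet> (y::'a)\<bar> \<le> A * B"
  by (rule order_trans[OF Cauchy_Schwarz_ineq2]) (auto intro!: mult_mono order_trans[OF norm_ge_zero])

text \<open>Both factors are the isometric image of \<open>b - b'\<close> plus an error of at most a
  quarter of its norm, and 1 - 1/4 - 1/4 - 1/16 = 7/16. This coercivity is what turns an integration
  by parts into a bound for second moments.\<close>

lemma X_inner_lower:
  assumes "b \<in> K" "b' \<in> K"
  shows "7/16 * (norm (b - b'))\<^sup>2 \<le> (\<psi> b - \<psi> b') \<bullet> D\<psi> b (b - b')"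
proof -
  define v where "v = b - b'"
  define e1 where "e1 = \<psi> b - \<psi> b' - D\<psi> a0 v"
  define e2 where "e2 = D\<psi> b v - D\<psi> a0 v"
  have e: "norm e1 \<le> norm v / 4" "norm e2 \<le> norm v / 4"
    using X_near[OF assms] near[OF assms(1), of v] by (auto simp: e1_def e2_def v_def)
  have "(\<psi> b - \<psi> b') \<bullet> D\<psi> b v = (D\<psi> a0 v + e1) \<bullet> (D\<psi> a0 v + e2)" by (simp add: e1_def e2_def)
  also have "\<dots> = v \<bullet> v + D\<psi> a0 v \<bullet> e2 + e1 \<bullet> D\<psi> a0 v + e1 \<bullet> e2" by (simp add: inner_simps isometry)
  also have "v \<bullet> v = (norm v)\<^sup>2" by (simp add: power2_norm_eq_inner)
  finally have eq: "(\<psi> b - \<psi> b') \<bullet> D\<psi> b v = (norm v)\<^sup>2 + D\<psi> a0 v \<bullet> e2 + e1 \<bullet> D\<psi> a0 v + e1 \<bullet> e2" .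
  have "\<bar>D\<psi> a0 v \<bullet> e2\<bar> \<le> norm v * (norm v / 4)" "\<bar>e1 \<bullet> D\<psi> a0 v\<bar> \<le> norm v / 4 * norm v" "\<bar>e1 \<bullet> e2\<bar> \<le> norm v / 4 * (norm v / 4)"
    by (intro abs_inner_le e order_refl eq_refl norm_D\<psi>_a0)+
  then show ?thesis unfolding v_def[symmetric] eq by (simp add: power2_eq_square)
qed

end

text \<open>\<open>J n f\<close> is the integral of \<open>f\<close>, read in the chart, against the averaging kernel of the point \<open>\<psi> (a n)\<close>
  restricted to a ball around \<open>a n\<close>; \<open>Z n\<close> normalises the kernel on the whole manifold.\<close>

locale chart_kernels = normal_chart a a0 U \<psi> \<rho>
  for a :: "nat \<Rightarrow> real ^ 'd::finite" and a0 :: "real ^ 'd" and U and \<psi> :: "real ^ 'd \<Rightarrow> 'a::euclidean_space" and \<rho> +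
  fixes s :: "real ^ 'd \<Rightarrow> real" and h Z :: "nat \<Rightarrow> real" and \<alpha> :: "nat \<Rightarrow> 'a" and \<omega> :: 'a
    and J :: "nat \<Rightarrow> (real ^ 'd \<Rightarrow> real) \<Rightarrow> real"
  assumes s: "Ck_on 1 U s" "\<And>b. b \<in> U \<Longrightarrow> s b > 0"
    and h: "\<And>n. h n > 0" "h \<longlonglongrightarrow> 0" and Z: "\<And>n. Z n > 0"
    and \<alpha>: "(\<lambda>n. \<alpha> n /\<^sub>R h n) \<longlonglongrightarrow> \<omega>"
    and J_def: "\<And>n f. J n f =
       (\<integral>b. indicator (cball (a n) \<rho>) b * (f b * (gauss_weight (h n) (\<psi> (a n) - \<alpha> n) (\<psi> b) * s b)) \<partial>lborel) / Z n"
    and J_le_1: "\<And>n. J n (\<lambda>_. 1) \<le> 1" and J_total: "(\<lambda>n. J n (\<lambda>_. 1)) \<longlonglongrightarrow> 1"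
    and J_tail: "\<And>d. d > 0 \<Longrightarrow> (\<lambda>n. J n (indicator (- ball (a n) d)) / h n) \<longlonglongrightarrow> 0"
    and s_deriv: "\<And>k. frechet_derivative s (at a0) (axis k 1) / s a0 =
       (\<Sum>i\<in>UNIV. frechet_derivative \<psi> (at a0) (axis i 1) \<bullet>
          frechet_derivative (\<lambda>b. frechet_derivative \<psi> (at b) (axis i 1)) (at a0) (axis k 1))"
begin

section \<open>Linearity, monotonicity and limits of the localised averages\<close>

definition w :: "nat \<Rightarrow> real ^ 'd \<Rightarrow> real" where
  "w n b = gauss_weight (h n) (\<psi> (a n) - \<alpha> n) (\<psi> b) * s b"

lemma J_eq: "J n f = (\<integral>b. indicator (Kn n) b * (f b * w n b) \<partial>lborel) / Z n"
  unfolding J_def w_def ..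

lemma s1: "Ck_on (Suc 0) U s" using s(1) by simp

lemma cont_U: "continuous_on U \<psi>" "continuous_on U s" "continuous_on U (\<lambda>b. D\<psi> b v)"
    "continuous_on U (\<lambda>b. frechet_derivative s (at b) v)"
  using Ck_on_continuous_on[OF \<psi>] Ck_on_continuous_on[OF s(1)] Ck_on_continuous_on[OF D\<psi>_C1] s1 by auto

lemmas cont_K = cont_U[THEN continuous_on_subset, OF U(2)]

lemma cont_w: "continuous_on K (w n)"
  unfolding w_def[abs_def] gauss_weight_def using h(1)[of n]
  by (intro continuous_intros cont_K) auto

lemma w_pos: "b \<in> K \<Longrightarrow> w n b > 0"
  unfolding w_def gauss_weight_def using s(2) U(2) by auto

text \<open>The Bochner integral of a nonintegrable function is 0, so sums and comparisons of
  averages \<open>J\<close> carry this side condition. Continuous functions and indicators of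
  complements of balls satisfy it.\<close>

definition ok :: "nat \<Rightarrow> (real ^ 'd \<Rightarrow> real) \<Rightarrow> bool" where
  "ok n f \<longleftrightarrow> integrable lborel (\<lambda>b. indicator (Kn n) b * (f b * w n b))"

lemma ok_cont: "continuous_on K f \<Longrightarrow> ok n f"
  unfolding ok_def
  using borel_integrable_compact[of "Kn n" "\<lambda>b. f b * w n b"] Kn_sub[of n]
    continuous_on_subset[OF continuous_on_mult[OF _ cont_w[of n]]] by auto

lemma ok_ind: "ok n (indicator (- ball (a n) d))"
proof -
  have "integrable lborel (\<lambda>b. indicator (Kn n - ball (a n) d) b *\<^sub>R w n b)"
    using Kn_sub[of n] by (intro borel_integrable_compact compact_diff continuous_on_subset[OF cont_w]) auto
  moreover have "indicator (Kn n - ball (a n) d) b *\<^sub>R w n b = indicator (Kn n) b * (indicator (- ball (a n) d) b * w n b)" for b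
    by (auto simp: indicator_def)
  ultimately show ?thesis unfolding ok_def by (simp only:)
qed

lemma ok_add: "ok n f \<Longrightarrow> ok n g \<Longrightarrow> ok n (\<lambda>b. f b + g b)"
  and J_add: "ok n f \<Longrightarrow> ok n g \<Longrightarrow> J n (\<lambda>b. f b + g b) = J n f + J n g"
  unfolding ok_def J_eq by (simp_all add: distrib_left distrib_right add_divide_distrib)

lemma ok_cmult: "ok n f \<Longrightarrow> ok n (\<lambda>b. c * f b)"
  and J_cmult: "J n (\<lambda>b. c * f b) = c * J n f"
proof -
  have *: "indicator (Kn n) b * (c * f b * w n b) = c * (indicator (Kn n) b * (f b * w n b))" for b by simp
  show "ok n f \<Longrightarrow> ok n (\<lambda>b. c * f b)" unfolding ok_def * by (rule integrable_mult_right)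
  show "J n (\<lambda>b. c * f b) = c * J n f" unfolding J_eq * by simp
qed

lemma ok_diff: "ok n f \<Longrightarrow> ok n g \<Longrightarrow> ok n (\<lambda>b. f b - g b)"
  and J_diff: "ok n f \<Longrightarrow> ok n g \<Longrightarrow> J n (\<lambda>b. f b - g b) = J n f - J n g"
  using ok_add[of n f "\<lambda>b. (-1) * g b"] J_add[of n f "\<lambda>b. (-1) * g b"] ok_cmult[of n g "-1"] J_cmult[of n "-1" g]
  by simp_all

lemma ok_sum: "(\<And>i. i \<in> I \<Longrightarrow> ok n (f i)) \<Longrightarrow> ok n (\<lambda>b. \<Sum>i\<in>I. f i b)"
  and J_sum: "(\<And>i. i \<in> I \<Longrightarrow> ok n (f i)) \<Longrightarrow> J n (\<lambda>b. \<Sum>i\<in>I. f i b) = (\<Sum>i\<in>I. J n (f i))"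
proof -
  have z: "ok n (\<lambda>_. 0)" "J n (\<lambda>_. 0) = 0" unfolding ok_def J_eq by auto
  have "(\<forall>i\<in>I. ok n (f i)) \<longrightarrow> ok n (\<lambda>b. \<Sum>i\<in>I. f i b) \<and> J n (\<lambda>b. \<Sum>i\<in>I. f i b) = (\<Sum>i\<in>I. J n (f i))"
    by (induction I rule: infinite_finite_induct) (auto simp: z J_add ok_add)
  then show "(\<And>i. i \<in> I \<Longrightarrow> ok n (f i)) \<Longrightarrow> ok n (\<lambda>b. \<Sum>i\<in>I. f i b)"
    "(\<And>i. i \<in> I \<Longrightarrow> ok n (f i)) \<Longrightarrow> J n (\<lambda>b. \<Sum>i\<in>I. f i b) = (\<Sum>i\<in>I. J n (f i))" by auto
qed

lemma J_mono:
  assumes "ok n f" "ok n g" "\<And>b. b \<in> Kn n \<Longrightarrow> f b \<le> g b"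
  shows "J n f \<le> J n g"
  unfolding J_eq
proof (intro divide_right_mono integral_mono)
  fix b
  show "indicator (Kn n) b * (f b * w n b) \<le> indicator (Kn n) b * (g b * w n b)"
    using assms(3)[of b] less_imp_le[OF w_pos[of b n]] subsetD[OF Kn_sub[of n]]
    by (cases "b \<in> Kn n") (simp_all add: mult_right_mono)
qed (use assms Z[of n] in \<open>auto simp: ok_def intro: less_imp_le\<close>)

lemma J_cong: "(\<And>b. b \<in> Kn n \<Longrightarrow> f b = g b) \<Longrightarrow> J n f = J n g"
  unfolding J_eq by (intro arg_cong2[where f = "(/)"] Bochner_Integration.integral_cong refl) (auto simp: indicator_def)

lemma J_abs:
  assumes "ok n f" "ok n g" "\<And>b. b \<in> Kn n \<Longrightarrow> \<bar>f b\<bar> \<le> g b"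
  shows "\<bar>J n f\<bar> \<le> J n g"
proof -
  have "J n f \<le> J n g" using assms(3) by (intro J_mono assms) fastforce
  moreover have "J n (\<lambda>b. (-1) * f b) \<le> J n g" using assms(3) by (intro J_mono assms ok_cmult) fastforce
  ultimately show ?thesis unfolding J_cmult by simp
qed

lemma ok_const: "ok n (\<lambda>_. c)" by (rule ok_cont) auto

lemma J_const: "J n (\<lambda>_. c) = c * J n (\<lambda>_. 1)"
  using J_cmult[of n c "\<lambda>_. 1"] by simp

lemma J_bound:
  assumes "ok n f" "\<And>b. b \<in> Kn n \<Longrightarrow> \<bar>f b\<bar> \<le> C" "0 \<le> C"
  shows "\<bar>J n f\<bar> \<le> C"
  using J_abs[OF assms(1) ok_const assms(2)] mult_left_mono[OF J_le_1[of n] assms(3)] by (simp add: J_const[of n C])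

lemma tail0: "d > 0 \<Longrightarrow> (\<lambda>n. J n (indicator (- ball (a n) d))) \<longlonglongrightarrow> 0"
proof -
  assume "d > 0"
  from tendsto_mult[OF J_tail[OF this] h(2)]
  have "(\<lambda>n. J n (indicator (- ball (a n) d)) / h n * h n) \<longlonglongrightarrow> 0" by simp
  then show ?thesis using h(1) by (simp add: less_imp_neq[symmetric])
qed

text \<open>The kernels concentrate at \<open>a n\<close>: on a fixed small ball around it
  \<open>f n\<close> is close to \<open>L\<close>, and off this ball it is bounded while the kernel
  mass vanishes. The localised kernel has lost the mass outside the chart ball, so
  \<open>J_total\<close> enters to recover the constant \<open>L\<close>.\<close>

lemma J_tendsto:
  assumes f: "\<And>n. continuous_on K (f n)" and C: "\<And>n b. b \<in> Kn n \<Longrightarrow> \<bar>f n b\<bar> \<le> C"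
    and lim: "((\<lambda>x. f (fst x) (snd x)) \<longlongrightarrow> L) F"
  shows "(\<lambda>n. J n (f n)) \<longlonglongrightarrow> L"
proof -
  have C0: "0 \<le> C" using C[OF a_Kn[of 0]] by linarith
  have main: "\<forall>\<^sub>F n in sequentially. \<bar>J n (\<lambda>b. f n b - L)\<bar> < e" if e: "e > 0" for e
  proof -
    have "\<forall>\<^sub>F x in F. dist (f (fst x) (snd x)) L < e / 2" using tendstoD[OF lim, of "e / 2"] e by auto
    then obtain n0 d where d: "d > 0" "\<And>n b. n \<ge> n0 \<Longrightarrow> norm (b - a n) < d \<Longrightarrow> dist (f n b) L < e / 2"
      by (rule eventually_F_D) auto
    have "\<forall>\<^sub>F n in sequentially. (C + \<bar>L\<bar>) * J n (indicator (- ball (a n) d)) < e / 2"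
      using order_tendstoD(2)[OF tendsto_mult_left[OF tail0[OF d(1)], of "C + \<bar>L\<bar>"], of "e / 2"] e by simp
    then show ?thesis using eventually_ge_at_top[of n0]
    proof eventually_elim
      case (elim n)
      have "\<bar>J n (\<lambda>b. f n b - L)\<bar> \<le> J n (\<lambda>b. e / 2 + (C + \<bar>L\<bar>) * indicator (- ball (a n) d) b)"
      proof (rule J_abs)
        show "ok n (\<lambda>b. f n b - L)" by (intro ok_cont continuous_intros f)
        show "ok n (\<lambda>b. e / 2 + (C + \<bar>L\<bar>) * indicator (- ball (a n) d) b)" by (intro ok_add ok_const ok_cmult ok_ind)
        fix b assume b: "b \<in> Kn n"
        show "\<bar>f n b - L\<bar> \<le> e / 2 + (C + \<bar>L\<bar>) * indicator (- ball (a n) d) b"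
        proof (cases "norm (b - a n) < d")
          case True
          then show ?thesis using d(2)[OF elim(2) True] C0 by (simp add: dist_real_def dist_norm norm_minus_commute)
        next
          case False
          then show ?thesis using C[OF b] e by (auto simp: dist_norm norm_minus_commute)
        qed
      qed
      also have "\<dots> = e / 2 * J n (\<lambda>_. 1) + (C + \<bar>L\<bar>) * J n (indicator (- ball (a n) d))"
        by (subst J_add) (auto intro: ok_const ok_cmult ok_ind simp: J_cmult J_const[of n "e / 2"])
      also have "\<dots> \<le> e / 2 * 1 + (C + \<bar>L\<bar>) * J n (indicator (- ball (a n) d))"
        using J_le_1[of n] e by (intro add_right_mono mult_left_mono) auto
      finally show ?case using elim(1) by simp
    qed
  qed
  have "(\<lambda>n. J n (\<lambda>b. f n b - L)) \<longlonglongrightarrow> 0"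
    using main by (intro tendstoI) (simp add: dist_real_def)
  from tendsto_add[OF this tendsto_mult_left[OF J_total, of L]]
  have "(\<lambda>n. J n (\<lambda>b. f n b - L) + L * J n (\<lambda>_. 1)) \<longlonglongrightarrow> L" by simp
  moreover have "J n (\<lambda>b. f n b - L) + L * J n (\<lambda>_. 1) = J n (f n)" for n
    using J_diff[OF ok_cont[OF f[of n]] ok_const[of n L]] by (simp add: J_const[of n L])
  ultimately show ?thesis by simp
qed

text \<open>Near \<open>a n\<close> the integrand is at most \<open>c\<close> times the squared
  distance, whose average is at most \<open>B * h n\<close>; off a fixed ball it is bounded and the
  tail mass is \<open>o(h)\<close>.\<close>

lemma J_smallo:
  assumes B: "\<And>n. J n (\<lambda>b. (norm (b - a n))\<^sup>2) / h n \<le> B"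
    and f: "\<And>n. continuous_on K (f n)" and C: "\<And>n b. b \<in> Kn n \<Longrightarrow> \<bar>f n b\<bar> \<le> C"
    and o: "(\<lambda>x. f (fst x) (snd x)) \<in> o[F](\<lambda>x. (N x)\<^sup>2)"
  shows "(\<lambda>n. J n (f n) / h n) \<longlonglongrightarrow> 0"
proof (rule tendstoI)
  fix e :: real assume e: "e > 0"
  have C0: "0 \<le> C" using C[OF a_Kn[of 0]] by linarith
  define c where "c = e / (2 * (\<bar>B\<bar> + 1))"
  have c: "c > 0" using e by (simp add: c_def)
  have "c * (\<bar>B\<bar> + 1) = e / 2" using e by (simp add: c_def field_simps add_pos_nonneg)
  then have cB: "c * B \<le> e / 2" using c mult_left_mono[of B "\<bar>B\<bar> + 1" c] by linarith
  have "\<forall>\<^sub>F x in F. norm (f (fst x) (snd x)) \<le> c * norm ((N x)\<^sup>2)" using landau_o.smallD[OF o c] .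
  then obtain n0 d where d: "d > 0" "\<And>n b. n \<ge> n0 \<Longrightarrow> norm (b - a n) < d \<Longrightarrow> \<bar>f n b\<bar> \<le> c * (norm (b - a n))\<^sup>2"
    by (rule eventually_F_D) (auto simp: N_def)
  have "\<forall>\<^sub>F n in sequentially. C * (J n (indicator (- ball (a n) d)) / h n) < e / 2"
    using order_tendstoD(2)[OF tendsto_mult_left[OF J_tail[OF d(1)], of C], of "e / 2"] e by simp
  then show "\<forall>\<^sub>F n in sequentially. dist (J n (f n) / h n) 0 < e" using eventually_ge_at_top[of n0]
  proof eventually_elim
    case (elim n)
    have okN: "ok n (\<lambda>b. (norm (b - a n))\<^sup>2)" by (intro ok_cont continuous_intros)
    have "\<bar>J n (f n)\<bar> \<le> J n (\<lambda>b. c * (norm (b - a n))\<^sup>2 + C * indicator (- ball (a n) d) b)"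
    proof (rule J_abs)
      show "ok n (f n)" by (intro ok_cont f)
      show "ok n (\<lambda>b. c * (norm (b - a n))\<^sup>2 + C * indicator (- ball (a n) d) b)" by (intro ok_add okN ok_cmult ok_ind)
      fix b assume b: "b \<in> Kn n"
      show "\<bar>f n b\<bar> \<le> c * (norm (b - a n))\<^sup>2 + C * indicator (- ball (a n) d) b"
      proof (cases "norm (b - a n) < d")
        case True
        then show ?thesis using d(2)[OF elim(2) True] C0 by (simp add: dist_norm norm_minus_commute)
      next
        case False
        have "0 \<le> c * (norm (b - a n))\<^sup>2" using c by simp
        then have "\<bar>f n b\<bar> \<le> c * (norm (b - a n))\<^sup>2 + C" using C[OF b] by linarith
        then show ?thesis using False by (simp add: dist_norm norm_minus_commute)
      qed
    qed
    also have "\<dots> = c * J n (\<lambda>b. (norm (b - a n))\<^sup>2) + C * J n (indicator (- ball (a n) d))"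
      by (subst J_add) (auto intro: okN ok_cmult ok_ind simp: J_cmult)
    finally have "\<bar>J n (f n)\<bar> / h n \<le> (c * J n (\<lambda>b. (norm (b - a n))\<^sup>2) + C * J n (indicator (- ball (a n) d))) / h n"
      using h(1)[of n] by (intro divide_right_mono) auto
    also have "\<dots> = c * (J n (\<lambda>b. (norm (b - a n))\<^sup>2) / h n) + C * (J n (indicator (- ball (a n) d)) / h n)"
      by (simp add: add_divide_distrib)
    also have "\<dots> \<le> c * B + C * (J n (indicator (- ball (a n) d)) / h n)"
      using B[of n] c by (intro add_right_mono mult_left_mono) auto
    also have "\<dots> < e" using elim(1) cB by linarith
    finally show ?case using h(1)[of n] by (simp add: dist_real_def)
  qed
qed

end

text \<open>A linear system whose matrix tends to the identity, solved without inverting it: the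
  deviation of the matrix is absorbed to bound \<open>m\<close>, and times this bound it tends to 0.
  It serves for the first moments and for the coordinates of a gradient.\<close>

lemma near_identity_tendsto:
  fixes g :: "nat \<Rightarrow> 'd::finite \<Rightarrow> 'd \<Rightarrow> real"
  assumes g: "\<And>l k. (\<lambda>n. g n l k) \<longlonglongrightarrow> (if l = k then 1 else 0)"
    and y: "\<And>k. (\<lambda>n. \<Sum>l\<in>UNIV. g n l k * m n l) \<longlonglongrightarrow> \<mu> k"
  shows "(\<lambda>n. m n k) \<longlonglongrightarrow> \<mu> k"
proof -
  define e where "e n = (\<Sum>k\<in>UNIV. \<Sum>l\<in>UNIV. \<bar>(if l = k then 1 else 0) - g n l k\<bar>)" for n
  define S where "S n = (\<Sum>k\<in>UNIV. \<bar>m n k\<bar>)" for n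
  define y where "y n k = (\<Sum>l\<in>UNIV. g n l k * m n l)" for n k
  define Y where "Y n = (\<Sum>k\<in>UNIV. \<bar>y n k\<bar>)" for n
  have "e \<longlonglongrightarrow> (\<Sum>k\<in>(UNIV::'d set). \<Sum>l\<in>(UNIV::'d set). \<bar>(if l = k then 1 else 0) - (if l = k then 1 else 0)\<bar>)"
    unfolding e_def by (intro tendsto_intros g)
  then have e0: "e \<longlonglongrightarrow> 0" by simp
  have Yc: "Y \<longlonglongrightarrow> (\<Sum>k\<in>UNIV. \<bar>\<mu> k\<bar>)" unfolding Y_def y_def by (intro tendsto_intros assms(2))
  have S0: "0 \<le> S n" "0 \<le> e n" for n unfolding S_def e_def by (auto intro!: sum_nonneg)
  have diff: "\<bar>m n k - y n k\<bar> \<le> e n * S n" for n k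
  proof -
    have "m n k = (\<Sum>l\<in>UNIV. (if l = k then 1 else 0) * m n l)" by (simp add: if_distrib[of "\<lambda>x. x * _"] cong: if_cong)
    then have "m n k - y n k = (\<Sum>l\<in>UNIV. ((if l = k then 1 else 0) - g n l k) * m n l)"
      unfolding y_def by (simp only: left_diff_distrib sum_subtractf)
    also have "\<bar>\<dots>\<bar> \<le> (\<Sum>l\<in>UNIV. \<bar>(if l = k then 1 else 0) - g n l k\<bar> * \<bar>m n l\<bar>)"
      by (rule order_trans[OF sum_abs]) (simp add: abs_mult)
    also have "\<dots> \<le> (\<Sum>l\<in>UNIV. \<bar>(if l = k then 1 else 0) - g n l k\<bar> * S n)"
      unfolding S_def by (intro sum_mono mult_left_mono member_le_sum) auto
    also have "\<dots> = (\<Sum>l\<in>UNIV. \<bar>(if l = k then 1 else 0) - g n l k\<bar>) * S n" by (simp add: sum_distrib_right)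
    also have "\<dots> \<le> e n * S n"
      unfolding e_def by (intro mult_right_mono S0 member_le_sum[of k UNIV "\<lambda>k. \<Sum>l\<in>UNIV. \<bar>(if l = k then 1 else 0) - g n l k\<bar>"] sum_nonneg) auto
    finally show ?thesis .
  qed
  \<comment> \<open>Below 1/2 the deviation can be absorbed:
    \<open>S n \<le> Y n + 1 / 2 * S n\<close> gives the bound \<open>2 * Y n\<close> for
    \<open>S n\<close>, so boundedness of \<open>m\<close> is a conclusion.\<close>
  have "(\<lambda>n. CARD('d) * e n) \<longlonglongrightarrow> 0" using tendsto_mult_left[OF e0, of "real CARD('d)"] by simp
  then have "\<forall>\<^sub>F n in sequentially. CARD('d) * e n < 1 / 2" by (rule order_tendstoD(2)) simp
  then have bound: "\<forall>\<^sub>F n in sequentially. norm (m n k - y n k) \<le> e n * (2 * Y n)"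
  proof eventually_elim
    case (elim n)
    have "\<bar>m n k\<bar> \<le> \<bar>y n k\<bar> + e n * S n" for k using diff[of n k] by linarith
    from sum_mono[of UNIV "\<lambda>k. \<bar>m n k\<bar>" "\<lambda>k. \<bar>y n k\<bar> + e n * S n", OF this] have "S n \<le> (\<Sum>k\<in>(UNIV::'d set). \<bar>y n k\<bar> + e n * S n)"
      by (simp add: S_def[of n])
    also have "\<dots> = Y n + (CARD('d) * e n) * S n" by (simp add: Y_def sum.distrib)
    also have "\<dots> \<le> Y n + 1 / 2 * S n" using elim S0[of n] by (intro add_left_mono mult_right_mono) auto
    finally have "S n \<le> 2 * Y n" by simp
    then show ?case using diff[of n k] mult_left_mono[of "S n" "2 * Y n" "e n"] S0[of n] by simp
  qed
  have "(\<lambda>n. m n k - y n k) \<longlonglongrightarrow> 0"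
    by (rule Lim_null_comparison[OF bound]) (auto intro!: tendsto_eq_intros e0 Yc)
  from tendsto_add[OF this assms(2)[of k]] show ?thesis by (simp add: y_def)
qed

context chart_kernels
begin

section \<open>Integration by parts against the weighted kernel\<close>

abbreviation "\<sigma> k b \<equiv> frechet_derivative s (at b) (axis k 1) / s b"
abbreviation "X n b \<equiv> \<psi> b - \<psi> (a n)"
abbreviation "\<kappa> n b \<equiv> cutoff \<rho> (a n) b"

text \<open>Writing the derivative as \<open>w\<close> times a logarithmic derivative makes both
  resulting terms averages of the same kind; the one from the exponent carries the factor
  \<open>1 / h n\<close>.\<close>

lemma has_derivative_w:
  assumes b: "b \<in> U"
  shows "(w n has_derivative (\<lambda>v. w n b * (frechet_derivative s (at b) v / s b - ((X n b + \<alpha> n) \<bullet> D\<psi> b v) / h n))) (at b)"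
proof -
  note d\<psi> = Ck_on_has_derivative[OF \<psi>2 b] and ds = Ck_on_has_derivative[OF s1 b]
  let ?c = "\<psi> (a n) - \<alpha> n"
  have "((\<lambda>b. (norm (?c - \<psi> b))\<^sup>2) has_derivative (\<lambda>v. 2 * ((X n b + \<alpha> n) \<bullet> D\<psi> b v))) (at b)"
    unfolding power2_norm_eq_inner
    by (rule has_derivative_eq_rhs, (rule derivative_intros d\<psi>)+) (simp add: fun_eq_iff inner_commute inner_simps)
  then have "((\<lambda>b. - (norm (?c - \<psi> b))\<^sup>2 * inverse (2 * h n)) has_derivative (\<lambda>v. - (2 * ((X n b + \<alpha> n) \<bullet> D\<psi> b v)) * inverse (2 * h n))) (at b)"
    by (intro derivative_intros)
  note de = has_derivative_exp[OF this]
  have "(w n has_derivative (\<lambda>v. gauss_weight (h n) ?c (\<psi> b) * frechet_derivative s (at b) v +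
      (- (2 * ((X n b + \<alpha> n) \<bullet> D\<psi> b v)) * inverse (2 * h n)) * gauss_weight (h n) ?c (\<psi> b) * s b)) (at b)"
    using has_derivative_mult[OF de ds] unfolding w_def[abs_def] gauss_weight_def divide_inverse by (simp add: mult_ac)
  then show ?thesis
    by (rule has_derivative_eq_rhs) (use s(2)[OF b] h(1)[of n] in \<open>simp add: w_def fun_eq_iff field_simps\<close>)
qed

text \<open>The derivative of \<open>c\<close> times \<open>w\<close> integrates to 0, without
  boundary terms, because \<open>c\<close> vanishes off \<open>Kn n\<close>; the product is thereby
  also harmless at points outside the parameter domain.\<close>

lemma J_by_parts:
  assumes c: "\<And>b. (c has_derivative c' b) (at b)" and cont: "\<And>S. continuous_on S (\<lambda>b. c' b p)"
    and zero: "\<And>b. b \<notin> Kn n \<Longrightarrow> c b = 0"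
  shows "J n (\<lambda>b. c' b p + c b * (frechet_derivative s (at b) p / s b)) =
    J n (\<lambda>b. c b * ((X n b + \<alpha> n) \<bullet> D\<psi> b p)) / h n"
proof -
  have cc: "continuous_on S c" for S
    using c by (meson continuous_at_imp_continuous_on has_derivative_continuous)
  have c'0: "c' b v = 0" if "b \<notin> Kn n" for b v
  proof -
    have "(c has_derivative (\<lambda>h. 0)) (at b)"
      by (rule has_derivative_transform_within_open[where f = "\<lambda>_. 0" and s = "- Kn n"])
        (use that zero in auto)
    then show ?thesis using has_derivative_unique[OF c] by metis
  qed
  define g where "g b v = w n b * (frechet_derivative s (at b) v / s b - ((X n b + \<alpha> n) \<bullet> D\<psi> b v) / h n)" for b v
  define f' where "f' b v = (if b \<in> Kn n then c b * g b v + c' b v * w n b else 0)" for b v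
  have der: "((\<lambda>b. c b * w n b) has_derivative f' b) (at b)" for b
  proof (cases "b \<in> U")
    case True
    from has_derivative_mult[OF c[of b] has_derivative_w[OF True, of n]]
    have "((\<lambda>b. c b * w n b) has_derivative (\<lambda>v. c b * g b v + c' b v * w n b)) (at b)" by (simp add: g_def)
    moreover have "(\<lambda>v. c b * g b v + c' b v * w n b) = f' b" by (auto simp: f'_def c'0 zero fun_eq_iff)
    ultimately show ?thesis by simp
  next
    case False
    then have "b \<notin> Kn n" using Kn_U by blast
    then have "f' b = (\<lambda>v. 0)" by (simp add: f'_def fun_eq_iff)
    moreover have "((\<lambda>b. c b * w n b) has_derivative (\<lambda>v. 0)) (at b)"
      by (rule has_derivative_transform_within_open[where f = "\<lambda>_. 0" and s = "- Kn n"])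
        (use \<open>b \<notin> Kn n\<close> zero in auto)
    ultimately show ?thesis by simp
  qed
  have cw: "continuous_on U (w n)"
    using has_derivative_w by (meson U(1) continuous_at_imp_continuous_on has_derivative_continuous)
  have "continuous_on U (\<lambda>b. c b * g b p + c' b p * w n b)"
    unfolding g_def using s(2) h(1)[of n] by (intro continuous_intros cc cont cw cont_U) (auto simp: less_imp_neq[symmetric])
  then have "continuous_on U (\<lambda>b. f' b p)"
    by (rule continuous_on_eq) (auto simp: f'_def c'0 zero)
  moreover have "continuous_on (- Kn n) (\<lambda>b. f' b p)"
    by (rule continuous_on_eq[of _ "\<lambda>_. 0"]) (auto simp: f'_def)
  \<comment> \<open>The parameter domain and the complement of the closed ball are open and cover
    the space; on each of them the derivative has one continuous formula.\<close>
  ultimately have "continuous_on (U \<union> - Kn n) (\<lambda>b. f' b p)"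
    by (intro continuous_on_open_Un U(1)) auto
  moreover have "U \<union> - Kn n = UNIV" using Kn_U[of n] by blast
  ultimately have cont': "continuous_on UNIV (\<lambda>b. f' b p)" by (simp only:)
  have "(\<integral>b. f' b p \<partial>lborel) = 0"
    by (rule integral_derivative_compact_support[OF der cont', of "Kn n"]) (auto simp: zero)
  moreover have "(\<integral>b. f' b p \<partial>lborel) / Z n =
      J n (\<lambda>b. (c' b p + c b * (frechet_derivative s (at b) p / s b)) - (1 / h n) * (c b * ((X n b + \<alpha> n) \<bullet> D\<psi> b p)))"
  proof -
    have *: "c * (w * (s' - Q / h)) + c' * w = ((c' + c * s') - (1 / h) * (c * Q)) * w" for c w s' Q h c' :: real
      by (simp add: algebra_simps)
    show ?thesis unfolding J_eq
      by (intro arg_cong2[where f = "(/)"] Bochner_Integration.integral_cong refl) (simp add: f'_def g_def *)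
  qed
  moreover have "ok n (\<lambda>b. c' b p + c b * (frechet_derivative s (at b) p / s b))"
    using s(2) U(2) by (intro ok_cont continuous_intros cc cont cont_K) (auto simp: less_imp_neq[symmetric] subset_iff)
  moreover have "ok n (\<lambda>b. c b * ((X n b + \<alpha> n) \<bullet> D\<psi> b p))"
    by (intro ok_cont continuous_intros cc cont_K)
  ultimately show ?thesis using J_diff[OF _ ok_cmult] J_cmult by (simp only:) simp
qed

lemma by_parts_0:
  "J n (\<lambda>b. cutoff' \<rho> (a n) b (axis k 1) + \<kappa> n b * \<sigma> k b) =
   J n (\<lambda>b. \<kappa> n b * ((X n b + \<alpha> n) \<bullet> D\<psi> b (axis k 1))) / h n"
  by (rule J_by_parts) (use \<rho> in \<open>auto intro: has_derivative_cutoff continuous_on_cutoff' cutoff_eq_0\<close>)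

lemma by_parts_1:
  "J n (\<lambda>b. (\<kappa> n b * axis k 1 $ j + cutoff' \<rho> (a n) b (axis k 1) * (b - a n) $ j) + (\<kappa> n b * (b - a n) $ j) * \<sigma> k b) =
   J n (\<lambda>b. (\<kappa> n b * (b - a n) $ j) * ((X n b + \<alpha> n) \<bullet> D\<psi> b (axis k 1))) / h n"
proof (rule J_by_parts[where c' = "\<lambda>b v. \<kappa> n b * v $ j + cutoff' \<rho> (a n) b v * (b - a n) $ j"])
  fix b
  have "((\<lambda>b. (b - a n) $ j) has_derivative (\<lambda>v. v $ j)) (at b)"
    by (rule has_derivative_eq_rhs, (rule derivative_intros bounded_linear.has_derivative[OF bounded_linear_vec_nth])+) simp
  from has_derivative_mult[OF has_derivative_cutoff this]
  show "((\<lambda>b. \<kappa> n b * (b - a n) $ j) has_derivative (\<lambda>v. \<kappa> n b * v $ j + cutoff' \<rho> (a n) b v * (b - a n) $ j)) (at b)" .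
  show "b \<notin> Kn n \<Longrightarrow> \<kappa> n b * (b - a n) $ j = 0" using cutoff_eq_0[OF \<rho>, of b "a n"] by simp
  show "continuous_on S (\<lambda>b. \<kappa> n b * axis k 1 $ j + cutoff' \<rho> (a n) b (axis k 1) * (b - a n) $ j)" for S
    by (intro continuous_intros continuous_on_cutoff continuous_on_cutoff' continuous_on_component)
qed

lemma \<sigma>_bound: obtains C where "0 \<le> C" "\<And>k b. b \<in> K \<Longrightarrow> \<bar>\<sigma> k b\<bar> \<le> C"
proof -
  have "\<exists>C. \<forall>b\<in>K. \<bar>\<sigma> k b\<bar> \<le> C" for k
  proof -
    have "continuous_on K (\<sigma> k)" using s(2) U(2) by (intro continuous_intros cont_K) (auto simp: less_imp_neq[symmetric] subset_iff)
    then have "bounded (\<sigma> k ` K)" by (intro compact_imp_bounded compact_continuous_image) auto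
    then show ?thesis by (auto simp: bounded_iff)
  qed
  then obtain C where C: "\<And>k b. b \<in> K \<Longrightarrow> \<bar>\<sigma> k b\<bar> \<le> C k" by metis
  have "\<bar>\<sigma> k b\<bar> \<le> (\<Sum>k\<in>UNIV. \<bar>C k\<bar>)" if "b \<in> K" for k b
    using order_trans[OF C[OF that, of k] order_trans[OF abs_ge_self member_le_sum[of k UNIV "\<lambda>k. \<bar>C k\<bar>"]]] by simp
  then show thesis by (intro that[of "\<Sum>k\<in>UNIV. \<bar>C k\<bar>"]) (auto intro: sum_nonneg)
qed

lemma Kn_norm: "b \<in> Kn n \<Longrightarrow> norm (b - a n) \<le> \<rho>"
  by (simp add: dist_norm norm_minus_commute)

lemma Kn_comp: "b \<in> Kn n \<Longrightarrow> \<bar>(b - a n) $ j\<bar> \<le> \<rho>"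
  using Kn_norm component_le_norm_cart order_trans by blast

lemma cutoff'_bound: "b \<in> Kn n \<Longrightarrow> \<bar>cutoff' \<rho> (a n) b (axis k 1)\<bar> \<le> 4 / \<rho>"
proof -
  assume b: "b \<in> Kn n"
  let ?m = "max 0 (1 - (norm (b - a n))\<^sup>2 / \<rho>\<^sup>2)"
  have "\<bar>cutoff' \<rho> (a n) b (axis k 1)\<bar> = 4 / \<rho>\<^sup>2 * (?m * \<bar>(b - a n) $ k\<bar>)"
    by (simp add: cutoff'_def inner_axis abs_mult)
  also have "\<dots> \<le> 4 / \<rho>\<^sup>2 * (1 * \<rho>)"
    using Kn_comp[OF b, of k] by (intro mult_left_mono mult_mono) auto
  also have "\<dots> = 4 / \<rho>" using \<rho> by (simp add: power2_eq_square)
  finally show ?thesis .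
qed

lemma \<alpha>_bound: obtains C where "0 \<le> C" "\<And>n. norm (\<alpha> n /\<^sub>R h n) \<le> C"
  using convergent_imp_Bseq[OF convergentI[OF \<alpha>]] unfolding Bseq_def by (meson less_imp_le)

lemma cont_comp: "continuous_on S (\<lambda>b. (b - a n) $ j)"
  by (intro continuous_intros continuous_on_component)

lemma cont_\<sigma>: "continuous_on K (\<sigma> k)"
  using s(2) U(2) by (intro continuous_intros cont_K) (auto simp: less_imp_neq[symmetric] subset_iff)

lemmas cont_rules = continuous_intros cont_K cont_comp cont_\<sigma> continuous_on_cutoff continuous_on_cutoff'

text \<open>The shift is of order \<open>h\<close>, so its contribution stays bounded when the
  identities from integration by parts are divided by \<open>h\<close>.\<close>

lemma split_\<alpha>: "(X n b + \<alpha> n) \<bullet> y = X n b \<bullet> y + h n * ((\<alpha> n /\<^sub>R h n) \<bullet> y)"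
  using h(1)[of n] by (simp add: inner_simps)

lemma by_parts_1_bounded:
  obtains C where "0 \<le> C" "\<And>n b k j. b \<in> Kn n \<Longrightarrow>
    \<bar>(\<kappa> n b * axis k 1 $ j + cutoff' \<rho> (a n) b (axis k 1) * (b - a n) $ j) + (\<kappa> n b * (b - a n) $ j) * \<sigma> k b\<bar> \<le> C"
proof -
  obtain Cs where Cs: "0 \<le> Cs" "\<And>k b. b \<in> K \<Longrightarrow> \<bar>\<sigma> k b\<bar> \<le> Cs" using \<sigma>_bound by blast
  have "\<bar>(\<kappa> n b * axis k 1 $ j + cutoff' \<rho> (a n) b (axis k 1) * (b - a n) $ j) + (\<kappa> n b * (b - a n) $ j) * \<sigma> k b\<bar> \<le> 5 + \<rho> * Cs"
    if b: "b \<in> Kn n" for n b k j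
  proof -
    have "\<bar>\<kappa> n b * axis k 1 $ j\<bar> \<le> 1" using cutoff_bounds[of \<rho> "a n" b] by (simp add: axis_def)
    moreover
    have "\<bar>cutoff' \<rho> (a n) b (axis k 1)\<bar> * \<bar>(b - a n) $ j\<bar> \<le> 4 / \<rho> * \<rho>"
      using \<rho> by (intro mult_mono cutoff'_bound Kn_comp b) auto
    then have "\<bar>cutoff' \<rho> (a n) b (axis k 1) * (b - a n) $ j\<bar> \<le> 4" using \<rho> by (simp add: abs_mult)
    moreover
    have "\<bar>(\<kappa> n b * (b - a n) $ j) * \<sigma> k b\<bar> \<le> (1 * \<rho>) * Cs"
      unfolding abs_mult using cutoff_bounds[of \<rho> "a n" b] \<rho>
      by (intro mult_mono Kn_comp b Cs(2) subsetD[OF Kn_sub b]) auto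
    then have "\<bar>(\<kappa> n b * (b - a n) $ j) * \<sigma> k b\<bar> \<le> \<rho> * Cs" by (simp only: mult_1)
    ultimately show ?thesis by linarith
  qed
  then show thesis using that[of "5 + \<rho> * Cs"] \<rho> Cs(1) by auto
qed

text \<open>Summing \<open>by_parts_1\<close> over \<open>j = k\<close> shows that the cut-off
  average of \<open>X n b \<bullet> D\<psi> b (b - a n)\<close>, divided by \<open>h n\<close>, is
  bounded. By \<open>X_inner_lower\<close> this controls the squared distance where the cutoff is at
  least 1/2; elsewhere the squared distance is at most \<open>\<rho>\<^sup>2\<close> and the tail
  condition applies.\<close>

lemma second_moment_bounded: obtains B where "\<And>n. J n (\<lambda>b. (norm (b - a n))\<^sup>2) / h n \<le> B"
proof -
  obtain Ca where Ca: "0 \<le> Ca" "\<And>n. norm (\<alpha> n /\<^sub>R h n) \<le> Ca" using \<alpha>_bound by blast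
  have "Bseq (\<lambda>n. J n (indicator (- ball (a n) (\<rho>/2))) / h n)"
    using J_tail[of "\<rho>/2"] \<rho> convergentI convergent_imp_Bseq half_gt_zero by blast
  then obtain T where T: "\<And>n. J n (indicator (- ball (a n) (\<rho>/2))) / h n \<le> T"
    unfolding Bseq_def by (metis abs_ge_self order_trans real_norm_def)
  obtain C1 where C1: "0 \<le> C1" "\<And>n b k j. b \<in> Kn n \<Longrightarrow> \<bar>(\<kappa> n b * axis k 1 $ j + cutoff' \<rho> (a n) b (axis k 1) * (b - a n) $ j) + (\<kappa> n b * (b - a n) $ j) * \<sigma> k b\<bar> \<le> C1"
    using by_parts_1_bounded by blast
  define C2 where "C2 = CARD('d) * C1 + Ca * (5/4 * \<rho>)"
  have main: "J n (\<lambda>b. (norm (b - a n))\<^sup>2) / h n \<le> 5 * C2 + \<rho>\<^sup>2 * T" for n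
  proof -
    let ?l = "\<lambda>k b. (\<kappa> n b * axis k 1 $ k + cutoff' \<rho> (a n) b (axis k 1) * (b - a n) $ k) + (\<kappa> n b * (b - a n) $ k) * \<sigma> k b"
    let ?r = "\<lambda>k b. (\<kappa> n b * (b - a n) $ k) * ((X n b + \<alpha> n) \<bullet> D\<psi> b (axis k 1))"
    have okl: "ok n (?l k)" and okr: "ok n (?r k)" for k
      by (intro ok_cont cont_rules)+
    have l: "J n (?l k) \<le> C1" for k
    proof -
      have "\<bar>J n (?l k)\<bar> \<le> C1" by (intro J_bound[OF okl] C1)
      then show ?thesis by simp
    qed
    let ?main = "\<lambda>b. \<kappa> n b * (X n b \<bullet> D\<psi> b (b - a n))"
    let ?err = "\<lambda>b. \<kappa> n b * ((\<alpha> n /\<^sub>R h n) \<bullet> D\<psi> b (b - a n))"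
    \<comment> \<open>Continuity of the differential is known for fixed directions; the direction
      \<open>b - a n\<close> varies with \<open>b\<close>, hence the expansion in
      coordinates.\<close>
    have cD: "continuous_on K (\<lambda>b. D\<psi> b (b - a n))"
    proof -
      have "continuous_on K (\<lambda>b. \<Sum>i\<in>UNIV. (b - a n) $ i *\<^sub>R D\<psi> b (axis i 1))" by (intro cont_rules)
      then show ?thesis
        by (rule continuous_on_eq) (use U(2) lin linear_axis_expansion[of "frechet_derivative \<psi> (at b)" "b - a n" for b] in \<open>auto simp: subset_iff\<close>)
    qed
    have okm: "ok n ?main" and oke: "ok n ?err" by (intro ok_cont cont_rules cD)+
    have "(\<Sum>k\<in>UNIV. J n (?l k)) = J n (\<lambda>b. \<Sum>k\<in>UNIV. ?r k b) / h n"
      by (simp only: by_parts_1 J_sum okr sum_divide_distrib)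
    also have "J n (\<lambda>b. \<Sum>k\<in>UNIV. ?r k b) = J n (\<lambda>b. ?main b + h n * ?err b)"
    proof (rule J_cong)
      fix b assume "b \<in> Kn n"
      then have bU: "b \<in> U" using Kn_U by blast
      have "(\<Sum>k\<in>UNIV. ?r k b) = \<kappa> n b * ((X n b + \<alpha> n) \<bullet> D\<psi> b (b - a n))"
        by (subst linear_axis_expansion[OF lin[OF bU], of "b - a n"]) (simp add: inner_sum_right sum_distrib_left mult_ac)
      then show "(\<Sum>k\<in>UNIV. ?r k b) = ?main b + h n * ?err b" unfolding split_\<alpha> by (simp add: algebra_simps)
    qed
    also have "J n (\<lambda>b. ?main b + h n * ?err b) = J n ?main + h n * J n ?err"
      by (simp only: J_add okm oke ok_cmult J_cmult)
    finally have "(\<Sum>k\<in>UNIV. J n (?l k)) = J n ?main / h n + J n ?err" using h(1)[of n] by (simp add: add_divide_distrib)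
    moreover have "(\<Sum>k\<in>UNIV. J n (?l k)) \<le> CARD('d) * C1" using sum_mono[of UNIV "\<lambda>k. J n (?l k)" "\<lambda>_. C1"] l by simp
    moreover have "\<bar>J n ?err\<bar> \<le> Ca * (5/4 * \<rho>)"
    proof (rule J_bound[OF oke])
      fix b assume b: "b \<in> Kn n"
      have "\<bar>(\<alpha> n /\<^sub>R h n) \<bullet> D\<psi> b (b - a n)\<bar> \<le> Ca * (5/4 * \<rho>)"
        using norm_D\<psi>[of b "b - a n"] Kn_norm[OF b] Kn_sub[of n] b by (intro abs_inner_le Ca(2)) auto
      then show "\<bar>?err b\<bar> \<le> Ca * (5/4 * \<rho>)"
        unfolding abs_mult using cutoff_bounds[of \<rho> "a n" b] by (intro order_trans[OF mult_left_le_one_le]) auto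
    qed (use Ca \<rho> in auto)
    ultimately have mb: "J n ?main / h n \<le> C2" unfolding C2_def by linarith
    \<comment> \<open>The factor 5 works because 5 * 1/2 * 7/16 = 35/32 exceeds 1, where 1/2 bounds
      the cutoff from below inside the smaller ball.\<close>
    have "J n (\<lambda>b. (norm (b - a n))\<^sup>2) \<le> J n (\<lambda>b. 5 * ?main b + \<rho>\<^sup>2 * indicator (- ball (a n) (\<rho>/2)) b)"
    proof (rule J_mono)
      show "ok n (\<lambda>b. (norm (b - a n))\<^sup>2)" by (intro ok_cont continuous_intros)
      show "ok n (\<lambda>b. 5 * ?main b + \<rho>\<^sup>2 * indicator (- ball (a n) (\<rho>/2)) b)" by (intro ok_add ok_cmult okm ok_ind)
      fix b assume b: "b \<in> Kn n"
      have X: "7/16 * (norm (b - a n))\<^sup>2 \<le> X n b \<bullet> D\<psi> b (b - a n)"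
        by (intro X_inner_lower subsetD[OF Kn_sub b] subsetD[OF Kn_sub a_Kn])
      show "(norm (b - a n))\<^sup>2 \<le> 5 * ?main b + \<rho>\<^sup>2 * indicator (- ball (a n) (\<rho>/2)) b"
      proof (cases "norm (b - a n) < \<rho> / 2")
        case True
        then have "(norm (b - a n))\<^sup>2 \<le> (\<rho> / 2)\<^sup>2" by (intro power_mono) auto
        then have "2 * (norm (b - a n))\<^sup>2 / \<rho>\<^sup>2 \<le> 1/2" using \<rho> by (simp add: divide_le_eq power_divide)
        then have "\<kappa> n b \<ge> 1/2" using cutoff_lower[of \<rho> "a n" b] by linarith
        then have "1/2 * (7/16 * (norm (b - a n))\<^sup>2) \<le> ?main b" using X by (intro mult_mono) auto
        moreover have "0 \<le> (norm (b - a n))\<^sup>2" by simp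
        moreover have I: "indicator (- ball (a n) (\<rho>/2)) b = (0::real)" using True by (simp add: dist_norm norm_minus_commute)
        ultimately show ?thesis unfolding I by linarith
      next
        case False
        have "0 \<le> X n b \<bullet> D\<psi> b (b - a n)" using order_trans[OF _ X, of 0] by simp
        then have "0 \<le> ?main b" using cutoff_bounds(1)[of \<rho> "a n" b] by simp
        moreover have "(norm (b - a n))\<^sup>2 \<le> \<rho>\<^sup>2" using Kn_norm[OF b] by (intro power_mono) auto
        ultimately show ?thesis using False by (simp add: dist_norm norm_minus_commute)
      qed
    qed
    also have "\<dots> = 5 * J n ?main + \<rho>\<^sup>2 * J n (indicator (- ball (a n) (\<rho>/2)))"
      by (simp only: J_add J_cmult ok_cmult okm ok_ind)
    finally have "J n (\<lambda>b. (norm (b - a n))\<^sup>2) / h n \<le> (5 * J n ?main + \<rho>\<^sup>2 * J n (indicator (- ball (a n) (\<rho>/2)))) / h n"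
      using h(1)[of n] by (intro divide_right_mono) auto
    also have "\<dots> = 5 * (J n ?main / h n) + \<rho>\<^sup>2 * (J n (indicator (- ball (a n) (\<rho>/2))) / h n)"
      by (simp add: add_divide_distrib)
    also have "\<dots> \<le> 5 * C2 + \<rho>\<^sup>2 * T" using mb T[of n] by (intro add_mono mult_left_mono) auto
    finally show ?thesis .
  qed
  then show thesis by (rule that)
qed

lemma J_smallo':
  assumes "\<And>n. continuous_on K (f n)" "\<And>n b. b \<in> Kn n \<Longrightarrow> \<bar>f n b\<bar> \<le> C"
    and "(\<lambda>x. f (fst x) (snd x)) \<in> o[F](\<lambda>x. (N x)\<^sup>2)"
  shows "(\<lambda>n. J n (f n) / h n) \<longlonglongrightarrow> 0"
  using second_moment_bounded J_smallo[OF _ assms] by metis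

lemma snd_tendsto:
  assumes "continuous_on U f"
  shows "((\<lambda>x. f (snd x)) \<longlongrightarrow> f a0) F"
  unfolding F_def
  by (rule filterlim_compose[OF continuous_on_open_tendsto_nhds[OF U(1) a0_U assms] filterlim_snd])

lemma a_tendsto:
  assumes "continuous_on U f"
  shows "(\<lambda>n. f (a n)) \<longlonglongrightarrow> f a0"
  by (rule filterlim_compose[OF continuous_on_open_tendsto_nhds[OF U(1) a0_U assms] a_lim])

lemma cutoff_tendsto: "((\<lambda>x. \<kappa> (fst x) (snd x)) \<longlongrightarrow> 1) F"
  unfolding cutoff_def using \<rho> by (auto intro!: tendsto_eq_intros)

lemma comp_tendsto: "((\<lambda>x. (snd x - a (fst x)) $ j) \<longlongrightarrow> 0) F"
  using tendsto_vec_nth[OF tendsto_diff[OF snd_lim a_fst_lim], of j] by simp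

lemma cutoff'_tendsto: "((\<lambda>x. cutoff' \<rho> (a (fst x)) (snd x) v) \<longlongrightarrow> 0) F"
  unfolding cutoff'_def using \<rho> by (auto intro!: tendsto_eq_intros)

lemma cont_\<sigma>U: "continuous_on U (\<sigma> k)"
  using s(2) by (intro continuous_intros cont_U) (auto simp: less_imp_neq[symmetric])

lemma X_smallo: "(\<lambda>x. norm (X (fst x) (snd x) - D\<psi> a0 (snd x - a (fst x)))) \<in> o[F](N)"
  using strict_derivative_smallo[OF U(1) a0_U \<psi>_C1] by simp

lemma eventually_K: "\<forall>\<^sub>F x in F. snd x \<in> K"
proof -
  have "\<forall>\<^sub>F b in nhds a0. b \<in> ball a0 (2 * \<rho>)" using \<rho> by (intro eventually_nhds_in_open) auto
  from eventually_snd_F[OF this] show ?thesis by eventually_elim auto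
qed

lemma a_K: "a n \<in> K" using Kn_sub a_Kn by blast

lemma X_bigo: "(\<lambda>x. norm (X (fst x) (snd x))) \<in> O[F](N)"
proof (rule bigoI[of _ "5/4"])
  show "\<forall>\<^sub>F x in F. norm (norm (X (fst x) (snd x))) \<le> 5/4 * norm (N x)"
    using eventually_K
  proof eventually_elim
    case (elim x)
    then show ?case using X_upper[OF elim a_K[of "fst x"]] by (simp add: N_def)
  qed
qed

lemma D\<psi>_snd: "((\<lambda>x. D\<psi> (snd x) v) \<longlongrightarrow> D\<psi> a0 v) F" by (rule snd_tendsto[OF cont_U(3)])
lemma D\<psi>_a: "(\<lambda>n. D\<psi> (a n) v) \<longlonglongrightarrow> D\<psi> a0 v" by (rule a_tendsto[OF cont_U(3)])

lemma cutoff_bigo: "(\<lambda>x. \<kappa> (fst x) (snd x) - 1) \<in> O[F](\<lambda>x. (N x)\<^sup>2)"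
proof (rule bigoI[of _ "2 / \<rho>\<^sup>2"], rule always_eventually, rule allI)
  fix x :: "nat \<times> (real ^ 'd)"
  show "norm (\<kappa> (fst x) (snd x) - 1) \<le> 2 / \<rho>\<^sup>2 * norm ((N x)\<^sup>2)"
    using cutoff_lower[of \<rho> "a (fst x)" "snd x"] cutoff_bounds(2)[of \<rho> "a (fst x)" "snd x"] by (simp add: N_def)
qed

lemma alpha_part_bounded:
  obtains C where "\<And>n b k. b \<in> Kn n \<Longrightarrow> \<bar>(\<alpha> n /\<^sub>R h n) \<bullet> D\<psi> b (axis k 1)\<bar> \<le> C"
proof -
  obtain Ca where Ca: "0 \<le> Ca" "\<And>n. norm (\<alpha> n /\<^sub>R h n) \<le> Ca" using \<alpha>_bound by blast
  have "\<bar>(\<alpha> n /\<^sub>R h n) \<bullet> D\<psi> b (axis k 1)\<bar> \<le> Ca * (5/4 * 1)" if "b \<in> Kn n" for n b k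
    using norm_D\<psi>[OF subsetD[OF Kn_sub that], of "axis k 1"] by (intro abs_inner_le Ca(2)) simp
  then show thesis by (rule that)
qed

lemma X_D\<psi>_bounded: "b \<in> Kn n \<Longrightarrow> \<bar>X n b \<bullet> D\<psi> b (axis k 1)\<bar> \<le> 25/16 * \<rho>"
  using abs_inner_le[of "X n b" "5/4 * \<rho>" "D\<psi> b (axis k 1)" "5/4"]
    norm_D\<psi>[of b "axis k 1"] X_upper[of b "a n"] Kn_norm[of b n] a_K[of n] subsetD[OF Kn_sub[of n], of b] by simp

text \<open>In \<open>by_parts_1\<close> the left integrand tends to 1 or 0 according to
  \<open>j = k\<close>, since the cutoff tends to 1 while its derivative and the components of
  \<open>b - a n\<close> tend to 0. On the right the factor \<open>(b - a n) $ j\<close> kills the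
  drift, and the inner product of \<open>X n b\<close> with the \<open>k\<close>-th coordinate field
  differs from \<open>(b - a n) $ k\<close> by \<open>o(N)\<close>.\<close>

lemma second_moments:
  "(\<lambda>n. J n (\<lambda>b. (b - a n) $ j * (b - a n) $ k) / h n) \<longlonglongrightarrow> (if j = k then 1 else 0)"
proof -
  let ?l = "\<lambda>n b. (\<kappa> n b * axis k 1 $ j + cutoff' \<rho> (a n) b (axis k 1) * (b - a n) $ j) + (\<kappa> n b * (b - a n) $ j) * \<sigma> k b"
  let ?c = "\<lambda>n b. (\<kappa> n b * (b - a n) $ j) * ((\<alpha> n /\<^sub>R h n) \<bullet> D\<psi> b (axis k 1))"
  let ?r = "\<lambda>n b. (\<kappa> n b * (b - a n) $ j) * (X n b \<bullet> D\<psi> b (axis k 1)) - (b - a n) $ j * (b - a n) $ k"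
  obtain C1 where C1: "0 \<le> C1" "\<And>n b k j. b \<in> Kn n \<Longrightarrow> \<bar>(\<kappa> n b * axis k 1 $ j + cutoff' \<rho> (a n) b (axis k 1) * (b - a n) $ j) + (\<kappa> n b * (b - a n) $ j) * \<sigma> k b\<bar> \<le> C1"
    using by_parts_1_bounded by blast
  obtain Ca where Ca: "\<And>n b k. b \<in> Kn n \<Longrightarrow> \<bar>(\<alpha> n /\<^sub>R h n) \<bullet> D\<psi> b (axis k 1)\<bar> \<le> Ca" using alpha_part_bounded by blast
  have kb: "\<bar>\<kappa> n b * (b - a n) $ j\<bar> \<le> \<rho>" if "b \<in> Kn n" for n b
    unfolding abs_mult using cutoff_bounds[of \<rho> "a n" b] Kn_comp[OF that, of j] by (intro order_trans[OF mult_left_le_one_le]) auto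
  have L: "(\<lambda>n. J n (?l n)) \<longlonglongrightarrow> (if j = k then 1 else 0)"
  proof (rule J_tendsto[OF _ C1(2)])
    show "continuous_on K (?l n)" for n by (intro cont_rules)
    show "((\<lambda>x. ?l (fst x) (snd x)) \<longlongrightarrow> (if j = k then 1 else 0)) F"
      by (rule tendsto_eq_intros cutoff_tendsto cutoff'_tendsto comp_tendsto snd_tendsto[OF cont_\<sigma>U] refl)+ (auto simp: axis_def)
  qed
  have Cc: "(\<lambda>n. J n (?c n)) \<longlonglongrightarrow> 0"
  proof (rule J_tendsto)
    show "continuous_on K (?c n)" for n by (intro cont_rules)
    show "\<bar>?c n b\<bar> \<le> \<rho> * Ca" if "b \<in> Kn n" for n b
      unfolding abs_mult[of "\<kappa> n b * _"] using \<rho> by (intro mult_mono kb Ca that) auto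
    show "((\<lambda>x. ?c (fst x) (snd x)) \<longlongrightarrow> 0) F"
      by (rule tendsto_eq_intros cutoff_tendsto comp_tendsto D\<psi>_snd tendsto_fst_F[OF \<alpha>] refl)+ simp
  qed
  have R: "(\<lambda>n. J n (?r n) / h n) \<longlonglongrightarrow> 0"
  proof (rule J_smallo')
    show "continuous_on K (?r n)" for n by (intro cont_rules)
    show "\<bar>?r n b\<bar> \<le> \<rho> * (25/16 * \<rho>) + \<rho> * \<rho>" if "b \<in> Kn n" for n b
    proof -
      have "\<bar>(\<kappa> n b * (b - a n) $ j) * (X n b \<bullet> D\<psi> b (axis k 1))\<bar> \<le> \<rho> * (25/16 * \<rho>)"
        unfolding abs_mult[of "\<kappa> n b * _"] using \<rho> by (intro mult_mono kb X_D\<psi>_bounded that) auto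
      moreover have "\<bar>(b - a n) $ j * (b - a n) $ k\<bar> \<le> \<rho> * \<rho>"
        unfolding abs_mult using \<rho> by (intro mult_mono Kn_comp that) auto
      ultimately show ?thesis by linarith
    qed
    have 1: "(\<lambda>x. (X (fst x) (snd x) - D\<psi> a0 (snd x - a (fst x))) \<bullet> D\<psi> (snd x) (axis k 1)) \<in> o[F](\<lambda>x. N x * 1)"
      by (rule smallo_inner(1)[OF X_smallo bigo_norm_tendsto[OF D\<psi>_snd]])
    have 2: "(\<lambda>x. D\<psi> a0 (snd x - a (fst x)) \<bullet> (D\<psi> (snd x) (axis k 1) - D\<psi> a0 (axis k 1))) \<in> o[F](\<lambda>x. N x * 1)"
      by (rule smallo_inner(2)[OF smallo_norm_tendsto[OF D\<psi>_snd] linear_bigo[OF lin[OF a0_U]]])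
    \<comment> \<open>Inserting the differential at \<open>a0\<close> into both factors isolates the
      main term, which \<open>isometry\<close> identifies with the \<open>k\<close>-th
      coordinate.\<close>
    have eq: "X (fst x) (snd x) \<bullet> D\<psi> (snd x) (axis k 1) - (snd x - a (fst x)) $ k =
       (X (fst x) (snd x) - D\<psi> a0 (snd x - a (fst x))) \<bullet> D\<psi> (snd x) (axis k 1) +
       D\<psi> a0 (snd x - a (fst x)) \<bullet> (D\<psi> (snd x) (axis k 1) - D\<psi> a0 (axis k 1))" for x
      by (simp add: inner_diff_left inner_diff_right isometry inner_axis)
    have 3: "(\<lambda>x. X (fst x) (snd x) \<bullet> D\<psi> (snd x) (axis k 1) - (snd x - a (fst x)) $ k) \<in> o[F](N)"
      unfolding eq using sum_in_smallo(1)[OF 1 2] by simp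
    have 4: "(\<lambda>x. (\<kappa> (fst x) (snd x) - 1) * (X (fst x) (snd x) \<bullet> D\<psi> (snd x) (axis k 1))) \<in> o[F](\<lambda>x. N x)"
    proof -
      have "(\<lambda>x. \<kappa> (fst x) (snd x) - 1) \<in> o[F](\<lambda>_. 1)"
        using tendsto_diff[OF cutoff_tendsto tendsto_const[of 1]] by (intro smalloI_tendsto) auto
      moreover have "(\<lambda>x. X (fst x) (snd x) \<bullet> D\<psi> (snd x) (axis k 1)) \<in> O[F](\<lambda>x. N x * 1)"
        by (rule bigo_inner[OF X_bigo bigo_norm_tendsto[OF D\<psi>_snd]])
      ultimately show ?thesis using landau_o.small_big_mult by fastforce
    qed
    have "(\<lambda>x. (snd x - a (fst x)) $ j * ((\<kappa> (fst x) (snd x) - 1) * (X (fst x) (snd x) \<bullet> D\<psi> (snd x) (axis k 1)) +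
        (X (fst x) (snd x) \<bullet> D\<psi> (snd x) (axis k 1) - (snd x - a (fst x)) $ k))) \<in> o[F](\<lambda>x. N x * N x)"
      by (intro landau_o.big_small_mult comp_bigo sum_in_smallo 3 4)
    then show "(\<lambda>x. ?r (fst x) (snd x)) \<in> o[F](\<lambda>x. (N x)\<^sup>2)"
      by (simp add: algebra_simps power2_eq_square)
  qed
  have "J n (\<lambda>b. (b - a n) $ j * (b - a n) $ k) / h n = J n (?l n) - J n (?c n) - J n (?r n) / h n" for n
  proof -
    have okc: "ok n (?c n)" and okr: "ok n (?r n)" and okb: "ok n (\<lambda>b. (b - a n) $ j * (b - a n) $ k)"
      by (intro ok_cont cont_rules)+
    have "J n (?l n) = J n (\<lambda>b. ((b - a n) $ j * (b - a n) $ k + ?r n b) + h n * ?c n b) / h n"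
      unfolding by_parts_1 split_\<alpha> by (simp only: algebra_simps) (simp add: algebra_simps)
    also have "\<dots> = (J n (\<lambda>b. (b - a n) $ j * (b - a n) $ k) + J n (?r n) + h n * J n (?c n)) / h n"
      by (simp only: J_add ok_add okc okr okb ok_cmult J_cmult)
    finally show ?thesis using h(1)[of n] by (simp add: field_simps)
  qed
  then show ?thesis using tendsto_diff[OF tendsto_diff[OF L Cc] R] by simp
qed

text \<open>The limits of the first moments divided by \<open>h\<close>; \<open>\<omega>\<close> will be \<open>- \<phi>'\<close>.\<close>

definition \<mu> :: "'d \<Rightarrow> real" where
  "\<mu> k = - (\<omega> \<bullet> D\<psi> a0 (axis k 1)) - (1/2) * (\<Sum>i\<in>UNIV. D2\<psi> i i \<bullet> D\<psi> a0 (axis k 1))"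

lemma D2\<psi>_symmetric: "D2\<psi> i j = D2\<psi> j i"
  by (rule frechet_derivative_second_symmetric[OF U(1) a0_U \<psi>])

lemma D2\<psi>_cont: "continuous_on U (\<lambda>b. frechet_derivative (\<lambda>b. D\<psi> b (axis i 1)) (at b) (axis j 1))"
  using \<psi> by (simp add: numeral_2_eq_2)

definition H\<psi> :: "real ^ 'd \<Rightarrow> 'a" where
  "H\<psi> v = (\<Sum>i\<in>UNIV. \<Sum>j\<in>UNIV. (v $ i * v $ j) *\<^sub>R D2\<psi> i j)"

lemma H\<psi>_bigo: "(\<lambda>x. norm ((1/2) *\<^sub>R H\<psi> (snd x - a (fst x)))) \<in> O[F](\<lambda>x. (N x)\<^sup>2)"
proof -
  define B where "B = (\<Sum>i\<in>UNIV. \<Sum>j\<in>UNIV. norm (D2\<psi> i j))"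
  have "norm (H\<psi> v) \<le> B * (norm v)\<^sup>2" for v
  proof -
    have "norm (H\<psi> v) \<le> (\<Sum>i\<in>UNIV. \<Sum>j\<in>UNIV. (norm v * norm v) * norm (D2\<psi> i j))"
      unfolding H\<psi>_def
    proof (intro sum_norm_le)
      fix i j
      show "norm ((v $ i * v $ j) *\<^sub>R D2\<psi> i j) \<le> (norm v * norm v) * norm (D2\<psi> i j)"
        unfolding norm_scaleR abs_mult by (intro mult_right_mono mult_mono component_le_norm_cart) auto
    qed
    also have "\<dots> = B * (norm v)\<^sup>2" by (simp add: B_def sum_distrib_left sum_distrib_right power2_eq_square mult_ac)
    finally show ?thesis .
  qed
  then show ?thesis by (intro bigoI[of _ "B/2"] always_eventually) (simp add: N_def)
qed

lemma X_second_order: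
  "(\<lambda>x. norm (X (fst x) (snd x) - D\<psi> (a (fst x)) (snd x - a (fst x)) - (1/2) *\<^sub>R H\<psi> (snd x - a (fst x)))) \<in> o[F](\<lambda>x. (N x)\<^sup>2)"
  unfolding H\<psi>_def
  by (rule second_order_smallo[OF U(1) a0_U, of "\<lambda>_. \<psi>"]) (intro \<psi> snd_tendsto[OF D2\<psi>_cont])+

lemma D\<psi>_expand_a: "D\<psi> (a n) v = (\<Sum>l\<in>UNIV. v $ l *\<^sub>R D\<psi> (a n) (axis l 1))"
  by (rule linear_axis_expansion[OF lin[OF a_U]])

lemma D\<psi>_a_smallo: "(\<lambda>x. norm (D\<psi> (a (fst x)) (snd x - a (fst x)) - D\<psi> a0 (snd x - a (fst x)))) \<in> o[F](N)"
proof -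
  have 1: "(\<lambda>x. \<Sum>l\<in>UNIV. \<bar>(snd x - a (fst x)) $ l * norm (D\<psi> (a (fst x)) (axis l 1) - D\<psi> a0 (axis l 1))\<bar>) \<in> o[F](\<lambda>x. N x * 1)"
  proof (intro big_sum_in_smallo)
    fix l
    have "(\<lambda>x. (snd x - a (fst x)) $ l * norm (D\<psi> (a (fst x)) (axis l 1) - D\<psi> a0 (axis l 1))) \<in> o[F](\<lambda>x. N x * 1)"
      by (intro landau_o.big_small_mult comp_bigo smallo_norm_tendsto tendsto_fst_F D\<psi>_a)
    then show "(\<lambda>x. \<bar>(snd x - a (fst x)) $ l * norm (D\<psi> (a (fst x)) (axis l 1) - D\<psi> a0 (axis l 1))\<bar>) \<in> o[F](\<lambda>x. N x * 1)"
      by (simp only: landau_o.small.abs_in_iff)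
  qed
  have 2: "norm (D\<psi> (a n) v - D\<psi> a0 v) \<le> (\<Sum>l\<in>UNIV. \<bar>v $ l * norm (D\<psi> (a n) (axis l 1) - D\<psi> a0 (axis l 1))\<bar>)" for n v
  proof -
    have "D\<psi> (a n) v - D\<psi> a0 v = (\<Sum>l\<in>UNIV. v $ l *\<^sub>R (D\<psi> (a n) (axis l 1) - D\<psi> a0 (axis l 1)))"
      unfolding D\<psi>_expand_a[of n v] linear_axis_expansion[OF lin[OF a0_U], of v] by (simp add: scaleR_diff_right sum_subtractf)
    also have "norm \<dots> \<le> (\<Sum>l\<in>UNIV. norm (v $ l *\<^sub>R (D\<psi> (a n) (axis l 1) - D\<psi> a0 (axis l 1))))" by (rule norm_sum)
    finally show ?thesis by (simp add: abs_mult)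
  qed
  have "(\<lambda>x. norm (D\<psi> (a (fst x)) (snd x - a (fst x)) - D\<psi> a0 (snd x - a (fst x)))) \<in> O[F](\<lambda>x. \<Sum>l\<in>UNIV. \<bar>(snd x - a (fst x)) $ l * norm (D\<psi> (a (fst x)) (axis l 1) - D\<psi> a0 (axis l 1))\<bar>)"
  proof (intro bigoI[of _ 1] always_eventually allI)
    fix x :: "nat \<times> (real ^ 'd)"
    show "norm (norm (D\<psi> (a (fst x)) (snd x - a (fst x)) - D\<psi> a0 (snd x - a (fst x)))) \<le> 1 * norm (\<Sum>l\<in>UNIV. \<bar>(snd x - a (fst x)) $ l * norm (D\<psi> (a (fst x)) (axis l 1) - D\<psi> a0 (axis l 1))\<bar>)"
      unfolding real_norm_def abs_norm_cancel mult_1 by (rule order_trans[OF 2 abs_ge_self])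
  qed
  from landau_o.big_small_trans[OF this 1] show ?thesis by simp
qed

text \<open>The inner product of \<open>X n b\<close> with the \<open>k\<close>-th coordinate field
  is now expanded up to \<open>o\<close> of the squared distance. Moving the differentials of its
  linear part from \<open>a n\<close> to \<open>a0\<close> would cost \<open>o(N)\<close>, which
  need not be \<open>o(h)\<close> on average; so the Gram matrix at \<open>a n\<close> stays, and
  \<open>near_identity_tendsto\<close> extracts the moments. The quadratic part is evaluated by
  \<open>second_moments\<close>.\<close>

lemma first_moments: "(\<lambda>n. J n (\<lambda>b. (b - a n) $ k) / h n) \<longlonglongrightarrow> \<mu> k"
proof (rule near_identity_tendsto)
  show "(\<lambda>n. D\<psi> (a n) (axis l 1) \<bullet> D\<psi> (a n) (axis k 1)) \<longlonglongrightarrow> (if l = k then 1 else 0)" for l k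
    using tendsto_inner[OF D\<psi>_a[of "axis l 1"] D\<psi>_a[of "axis k 1"]] by (simp add: orth)
next
  fix k
  let ?e = "axis k 1 :: real ^ 'd"
  \<comment> \<open>Second-order terms have two sources: the second derivative of
    \<open>\<psi>\<close> inside \<open>X\<close>, with the factor 1/2 of Taylor's formula, and the
    variation of the \<open>k\<close>-th coordinate field along the linear part of
    \<open>X\<close>.\<close>
  define q where "q i j = (1/2) * (D2\<psi> i j \<bullet> D\<psi> a0 ?e) + D\<psi> a0 (axis i 1) \<bullet> D2\<psi> k j" for i j
  define Q where "Q v = (\<Sum>i\<in>UNIV. \<Sum>j\<in>UNIV. q i j * (v $ i * v $ j))" for v :: "real ^ 'd"
  let ?D2 = "frechet_derivative (\<lambda>b. D\<psi> b ?e) (at a0)"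
  have lin2: "linear ?D2"
    using frechet_derivative_second_linear(2)[OF U(1) a0_U \<psi>] .
  have Q_eq: "Q v = (1/2) *\<^sub>R H\<psi> v \<bullet> D\<psi> a0 ?e + D\<psi> a0 v \<bullet> ?D2 v" for v
  proof -
    have "D\<psi> a0 v \<bullet> ?D2 v = (\<Sum>i\<in>UNIV. \<Sum>j\<in>UNIV. (D\<psi> a0 (axis i 1) \<bullet> D2\<psi> k j) * (v $ i * v $ j))"
      by (simp only: linear_axis_expansion[OF lin[OF a0_U], of v] linear_axis_expansion[OF lin2, of v]
          inner_sum_left inner_sum_right inner_scaleR_left inner_scaleR_right) (subst sum.swap, simp add: mult_ac sum_distrib_left)
    moreover have "(1/2) *\<^sub>R H\<psi> v \<bullet> D\<psi> a0 ?e = (\<Sum>i\<in>UNIV. \<Sum>j\<in>UNIV. ((1/2) * (D2\<psi> i j \<bullet> D\<psi> a0 ?e)) * (v $ i * v $ j))"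
      unfolding H\<psi>_def by (simp add: inner_sum_left sum_distrib_left mult_ac)
    ultimately show ?thesis unfolding Q_def q_def by (simp only: sum.distrib distrib_right)
  qed
  let ?l = "\<lambda>n b. cutoff' \<rho> (a n) b ?e + \<kappa> n b * \<sigma> k b"
  let ?c = "\<lambda>n b. \<kappa> n b * ((\<alpha> n /\<^sub>R h n) \<bullet> D\<psi> b ?e)"
  let ?r = "\<lambda>n b. \<kappa> n b * (X n b \<bullet> D\<psi> b ?e) - D\<psi> (a n) (b - a n) \<bullet> D\<psi> (a n) ?e - Q (b - a n)"
  obtain Cs where Cs: "0 \<le> Cs" "\<And>k b. b \<in> K \<Longrightarrow> \<bar>\<sigma> k b\<bar> \<le> Cs" using \<sigma>_bound by blast
  obtain Ca where Ca: "\<And>n b k. b \<in> Kn n \<Longrightarrow> \<bar>(\<alpha> n /\<^sub>R h n) \<bullet> D\<psi> b (axis k 1)\<bar> \<le> Ca" using alpha_part_bounded by blast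
  have kb: "\<bar>\<kappa> n b\<bar> \<le> 1" for n b using cutoff_bounds[of \<rho> "a n" b] by simp
  have contQ: "continuous_on K (\<lambda>b. Q (b - a n))" for n unfolding Q_def by (intro cont_rules)
  have contDa: "continuous_on K (\<lambda>b. D\<psi> (a n) (b - a n))" for n
    using lin[OF a_U] by (intro bounded_linear.continuous_on[of "frechet_derivative \<psi> (at (a n))"] cont_rules) (simp add: linear_conv_bounded_linear)
  have L: "(\<lambda>n. J n (?l n)) \<longlonglongrightarrow> \<sigma> k a0"
  proof (rule J_tendsto)
    show "continuous_on K (?l n)" for n by (intro cont_rules)
    show "\<bar>?l n b\<bar> \<le> 4 / \<rho> + 1 * Cs" if "b \<in> Kn n" for n b
    proof -
      have "\<bar>\<kappa> n b * \<sigma> k b\<bar> \<le> 1 * Cs"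
        unfolding abs_mult[of "\<kappa> n b"] by (intro mult_mono kb Cs subsetD[OF Kn_sub that]) auto
      then show ?thesis using cutoff'_bound[OF that, of k] by linarith
    qed
    show "((\<lambda>x. ?l (fst x) (snd x)) \<longlongrightarrow> \<sigma> k a0) F"
      by (rule tendsto_eq_intros cutoff_tendsto cutoff'_tendsto snd_tendsto[OF cont_\<sigma>U] refl)+ simp
  qed
  have Cc: "(\<lambda>n. J n (?c n)) \<longlonglongrightarrow> \<omega> \<bullet> D\<psi> a0 ?e"
  proof (rule J_tendsto)
    show "continuous_on K (?c n)" for n by (intro cont_rules)
    show "\<bar>?c n b\<bar> \<le> 1 * Ca" if "b \<in> Kn n" for n b
      unfolding abs_mult[of "\<kappa> n b"] by (intro mult_mono kb Ca that) auto
    show "((\<lambda>x. ?c (fst x) (snd x)) \<longlongrightarrow> \<omega> \<bullet> D\<psi> a0 ?e) F"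
      by (rule tendsto_eq_intros cutoff_tendsto D\<psi>_snd tendsto_fst_F[OF \<alpha>] refl)+ simp
  qed
  define B where "B = (\<Sum>i\<in>UNIV. \<Sum>j\<in>UNIV. \<bar>q i j\<bar> * (\<rho> * \<rho>))"
  have R: "(\<lambda>n. J n (?r n) / h n) \<longlonglongrightarrow> 0"
  proof (rule J_smallo')
    show "continuous_on K (?r n)" for n by (intro cont_rules contQ contDa)
    show "\<bar>?r n b\<bar> \<le> 1 * (25/16 * \<rho>) + (5/4 * \<rho>) * (5/4) + B" if b: "b \<in> Kn n" for n b
    proof -
      have "\<bar>\<kappa> n b * (X n b \<bullet> D\<psi> b ?e)\<bar> \<le> 1 * (25/16 * \<rho>)"
        unfolding abs_mult[of "\<kappa> n b"] by (intro mult_mono kb X_D\<psi>_bounded b) auto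
      moreover have "\<bar>D\<psi> (a n) (b - a n) \<bullet> D\<psi> (a n) ?e\<bar> \<le> (5/4 * \<rho>) * (5/4)"
        using norm_D\<psi>[OF a_K, of n "b - a n"] norm_D\<psi>[OF a_K, of n ?e] Kn_norm[OF b] by (intro abs_inner_le) auto
      moreover have "\<bar>Q (b - a n)\<bar> \<le> B"
        unfolding Q_def B_def
      proof (intro order_trans[OF sum_abs] sum_mono)
        fix i j
        show "\<bar>q i j * ((b - a n) $ i * (b - a n) $ j)\<bar> \<le> \<bar>q i j\<bar> * (\<rho> * \<rho>)"
          unfolding abs_mult using \<rho> by (intro mult_left_mono mult_mono Kn_comp b) auto
      qed
      ultimately show ?thesis by linarith
    qed
    define \<beta> where "\<beta> x = snd x - a (fst x)" for x :: "nat \<times> (real ^ 'd)"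
    let ?X = "\<lambda>x. X (fst x) (snd x)" and ?Y = "\<lambda>x. D\<psi> (snd x) ?e"
    let ?X1 = "\<lambda>x. D\<psi> (a (fst x)) (\<beta> x)" and ?Y1 = "\<lambda>x. D\<psi> (a (fst x)) ?e"
    let ?r1 = "\<lambda>x. ?X x - ?X1 x - (1/2) *\<^sub>R H\<psi> (\<beta> x)"
    let ?r2 = "\<lambda>x. ?Y x - ?Y1 x - ?D2 (\<beta> x)"
    have Y: "(\<lambda>x. norm (?Y x)) \<in> O[F](\<lambda>_. 1)" by (rule bigo_norm_tendsto[OF D\<psi>_snd])
    have r1: "(\<lambda>x. norm (?r1 x)) \<in> o[F](\<lambda>x. (N x)\<^sup>2)" using X_second_order unfolding \<beta>_def .
    have r2: "(\<lambda>x. norm (?r2 x)) \<in> o[F](N)"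
      unfolding \<beta>_def by (rule strict_derivative_smallo[OF U(1) a0_U D\<psi>_C1])
    have H: "(\<lambda>x. norm ((1/2) *\<^sub>R H\<psi> (\<beta> x))) \<in> O[F](\<lambda>x. (N x)\<^sup>2)" using H\<psi>_bigo unfolding \<beta>_def .
    have dY: "(\<lambda>x. norm (?Y x - D\<psi> a0 ?e)) \<in> o[F](\<lambda>_. 1)" by (rule smallo_norm_tendsto[OF D\<psi>_snd])
    have X1a: "(\<lambda>x. norm (?X1 x - D\<psi> a0 (\<beta> x))) \<in> o[F](N)" using D\<psi>_a_smallo unfolding \<beta>_def .
    have X1: "(\<lambda>x. norm (?X1 x)) \<in> O[F](N)"
      using norm_D\<psi>[OF a_K] by (intro bigoI[of _ "5/4"] always_eventually) (auto simp: N_def \<beta>_def)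
    have D2: "(\<lambda>x. norm (?D2 (\<beta> x))) \<in> O[F](N)" using linear_bigo[OF lin2] unfolding \<beta>_def .
    have t1: "(\<lambda>x. (\<kappa> (fst x) (snd x) - 1) * (?X x \<bullet> ?Y x)) \<in> o[F](\<lambda>x. (N x)\<^sup>2 * 1)"
    proof (rule landau_o.big_small_mult[OF cutoff_bigo])
      have 1: "(\<lambda>x. ?X x \<bullet> ?Y x) \<in> O[F](\<lambda>x. N x * 1)" by (rule bigo_inner[OF X_bigo Y])
      have 2: "(\<lambda>x. N x * 1) \<in> o[F](\<lambda>_. 1)" using N_lim by (intro smalloI_tendsto) auto
      show "(\<lambda>x. ?X x \<bullet> ?Y x) \<in> o[F](\<lambda>_. 1)" by (rule landau_o.big_small_trans[OF 1 2])
    qed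
    have t2: "(\<lambda>x. ?r1 x \<bullet> ?Y x) \<in> o[F](\<lambda>x. (N x)\<^sup>2 * 1)" by (rule smallo_inner(1)[OF r1 Y])
    have t3: "(\<lambda>x. ((1/2) *\<^sub>R H\<psi> (\<beta> x)) \<bullet> (?Y x - D\<psi> a0 ?e)) \<in> o[F](\<lambda>x. (N x)\<^sup>2 * 1)" by (rule smallo_inner(2)[OF dY H])
    have t4: "(\<lambda>x. ?X1 x \<bullet> ?r2 x) \<in> o[F](\<lambda>x. N x * N x)" by (rule smallo_inner(2)[OF r2 X1])
    have t5: "(\<lambda>x. (?X1 x - D\<psi> a0 (\<beta> x)) \<bullet> ?D2 (\<beta> x)) \<in> o[F](\<lambda>x. N x * N x)" by (rule smallo_inner(1)[OF X1a D2])
    \<comment> \<open>Each summand accounts for one replacement: the cutoff by 1, \<open>?X\<close>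
      by its second-order expansion, \<open>?Y\<close> by its first-order expansion, and the
      differentials inside the quadratic terms by their values at \<open>a0\<close>.\<close>
    have eq: "?r (fst x) (snd x) = (\<kappa> (fst x) (snd x) - 1) * (?X x \<bullet> ?Y x) + ?r1 x \<bullet> ?Y x +
        ((1/2) *\<^sub>R H\<psi> (\<beta> x)) \<bullet> (?Y x - D\<psi> a0 ?e) + ?X1 x \<bullet> ?r2 x + (?X1 x - D\<psi> a0 (\<beta> x)) \<bullet> ?D2 (\<beta> x)" for x
      unfolding Q_eq \<beta>_def[symmetric] by (simp only: inner_diff_left inner_diff_right left_diff_distrib) simp
    show "(\<lambda>x. ?r (fst x) (snd x)) \<in> o[F](\<lambda>x. (N x)\<^sup>2)"
      unfolding eq using t1 t2 t3 t4 t5 by (intro sum_in_smallo) (simp_all add: power2_eq_square)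
  qed
  have okc: "ok n (?c n)" and okr: "ok n (?r n)" and okQ: "ok n (\<lambda>b. Q (b - a n))" and okD: "ok n (\<lambda>b. D\<psi> (a n) (b - a n) \<bullet> D\<psi> (a n) ?e)"
    and okb: "ok n (\<lambda>b. (b - a n) $ i)" and okbb: "ok n (\<lambda>b. (b - a n) $ i * (b - a n) $ j)" for n i j
    by (intro ok_cont cont_rules contQ contDa)+
  have JQ: "J n (\<lambda>b. Q (b - a n)) / h n = (\<Sum>i\<in>UNIV. \<Sum>j\<in>UNIV. q i j * (J n (\<lambda>b. (b - a n) $ i * (b - a n) $ j) / h n))" for n
    unfolding Q_def by (simp only: J_sum ok_sum ok_cmult okbb J_cmult sum_divide_distrib times_divide_eq_right)
  have JD: "J n (\<lambda>b. D\<psi> (a n) (b - a n) \<bullet> D\<psi> (a n) ?e) / h n =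
      (\<Sum>l\<in>UNIV. D\<psi> (a n) (axis l 1) \<bullet> D\<psi> (a n) ?e * (J n (\<lambda>b. (b - a n) $ l) / h n))" for n
  proof -
    have "D\<psi> (a n) (b - a n) \<bullet> D\<psi> (a n) ?e = (\<Sum>l\<in>UNIV. D\<psi> (a n) (axis l 1) \<bullet> D\<psi> (a n) ?e * (b - a n) $ l)" for b
      by (simp only: D\<psi>_expand_a[of n "b - a n"] inner_sum_left inner_scaleR_left mult.commute)
    then show ?thesis by (simp only: J_sum ok_cmult okb J_cmult sum_divide_distrib times_divide_eq_right)
  qed
  have Qlim: "(\<lambda>n. J n (\<lambda>b. Q (b - a n)) / h n) \<longlonglongrightarrow> (\<Sum>i\<in>UNIV. \<Sum>j\<in>UNIV. q i j * (if i = j then 1 else 0))"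
    unfolding JQ by (intro tendsto_intros second_moments)
  have "J n (\<lambda>b. D\<psi> (a n) (b - a n) \<bullet> D\<psi> (a n) ?e) / h n = J n (?l n) - J n (?c n) - J n (?r n) / h n - J n (\<lambda>b. Q (b - a n)) / h n" for n
  proof -
    have "J n (?l n) = J n (\<lambda>b. ((D\<psi> (a n) (b - a n) \<bullet> D\<psi> (a n) ?e + ?r n b) + Q (b - a n)) + h n * ?c n b) / h n"
      unfolding by_parts_0 split_\<alpha> by (simp add: distrib_left mult_ac)
    also have "\<dots> = (J n (\<lambda>b. D\<psi> (a n) (b - a n) \<bullet> D\<psi> (a n) ?e) + J n (?r n) + J n (\<lambda>b. Q (b - a n)) + h n * J n (?c n)) / h n"
      by (simp only: J_add ok_add okc okr okQ okD ok_cmult J_cmult)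
    finally show ?thesis using h(1)[of n] by (simp add: field_simps)
  qed
  moreover have "(\<lambda>n. J n (?l n) - J n (?c n) - J n (?r n) / h n - J n (\<lambda>b. Q (b - a n)) / h n) \<longlonglongrightarrow>
      \<sigma> k a0 - \<omega> \<bullet> D\<psi> a0 ?e - 0 - (\<Sum>i\<in>UNIV. \<Sum>j\<in>UNIV. q i j * (if i = j then 1 else 0))"
    by (intro tendsto_diff L Cc R Qlim)
  \<comment> \<open>Only the trace of \<open>q\<close> survives. Its second part equals
    \<open>\<sigma> k a0\<close> once the indices of \<open>D2\<psi>\<close> are exchanged by
    symmetry.\<close>
  moreover have "\<sigma> k a0 - \<omega> \<bullet> D\<psi> a0 ?e - 0 - (\<Sum>i\<in>UNIV. \<Sum>j\<in>UNIV. q i j * (if i = j then 1 else 0)) = \<mu> k"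
    unfolding s_deriv \<mu>_def q_def
    by (simp add: if_distrib[where f = "\<lambda>x. _ * x"] sum.distrib sum_distrib_left D2\<psi>_symmetric[of k] cong: if_cong)
  ultimately show "(\<lambda>n. \<Sum>l\<in>UNIV. D\<psi> (a n) (axis l 1) \<bullet> D\<psi> (a n) ?e * (J n (\<lambda>b. (b - a n) $ l) / h n)) \<longlonglongrightarrow> \<mu> k"
    unfolding JD by simp
qed

lemma generator_limit:
  fixes f :: "nat \<Rightarrow> real ^ 'd \<Rightarrow> real"
  assumes f: "\<And>n. Ck_on 2 U (f n)" and C: "\<And>n b. b \<in> Kn n \<Longrightarrow> \<bar>f n b\<bar> \<le> C"
    and D: "\<And>k. (\<lambda>n. frechet_derivative (f n) (at (a n)) (axis k 1)) \<longlonglongrightarrow> v k"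
    and D2: "\<And>i j. ((\<lambda>x. frechet_derivative (\<lambda>b. frechet_derivative (f (fst x)) (at b) (axis i 1)) (at (snd x)) (axis j 1)) \<longlongrightarrow> H i j) F"
  shows "(\<lambda>n. J n (\<lambda>b. f n b - f n (a n)) / h n) \<longlonglongrightarrow> (\<Sum>k\<in>UNIV. v k * \<mu> k) + (1/2) * (\<Sum>i\<in>UNIV. H i i)"
proof -
  have f1: "Ck_on (Suc 1) U (f n)" for n using f by (simp add: numeral_2_eq_2)
  define g where "g n k = frechet_derivative (f n) (at (a n)) (axis k 1)" for n k
  have g: "frechet_derivative (f n) (at (a n)) u = (\<Sum>k\<in>UNIV. g n k * u $ k)" for n u
    unfolding g_def
    by (subst linear_axis_expansion[OF has_derivative_linear[OF Ck_on_has_derivative[OF f1 a_U]]]) (simp add: mult.commute)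
  have "\<exists>G. \<forall>n. \<bar>g n k\<bar> \<le> G" for k
    using convergent_imp_Bseq[OF convergentI[OF D[of k]]] unfolding Bseq_def g_def by auto
  then obtain G where G: "\<And>n k. \<bar>g n k\<bar> \<le> G k" by metis
  have gD: "(\<lambda>n. g n k) \<longlonglongrightarrow> v k" for k using D unfolding g_def .
  define Q where "Q u = (\<Sum>i\<in>UNIV. \<Sum>j\<in>UNIV. H i j * (u $ i * u $ j))" for u :: "real ^ 'd"
  let ?lin = "\<lambda>n b. \<Sum>k\<in>UNIV. g n k * (b - a n) $ k"
  let ?r = "\<lambda>n b. f n b - f n (a n) - ?lin n b - (1/2) * Q (b - a n)"
  have cf: "continuous_on K (f n)" for n
    using Ck_on_continuous_on[OF f] U(2) continuous_on_subset by blast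
  have contQ: "continuous_on K (\<lambda>b. Q (b - a n))" for n unfolding Q_def by (intro cont_rules)
  define B where "B = (\<Sum>i\<in>UNIV. \<Sum>j\<in>UNIV. \<bar>H i j\<bar> * (\<rho> * \<rho>))"
  have R: "(\<lambda>n. J n (?r n) / h n) \<longlonglongrightarrow> 0"
  proof (rule J_smallo')
    show "continuous_on K (?r n)" for n by (intro cont_rules contQ cf)
    show "\<bar>?r n b\<bar> \<le> C + C + (\<Sum>k\<in>UNIV. G k * \<rho>) + (1/2) * B" if b: "b \<in> Kn n" for n b
    proof -
      have "\<bar>?lin n b\<bar> \<le> (\<Sum>k\<in>UNIV. G k * \<rho>)"
      proof (intro order_trans[OF sum_abs] sum_mono)
        fix k
        show "\<bar>g n k * (b - a n) $ k\<bar> \<le> G k * \<rho>"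
          unfolding abs_mult using order_trans[OF abs_ge_zero G[of 0 k]] by (intro mult_mono G Kn_comp b) auto
      qed
      moreover have "\<bar>Q (b - a n)\<bar> \<le> B"
        unfolding Q_def B_def
      proof (intro order_trans[OF sum_abs] sum_mono)
        fix i j
        show "\<bar>H i j * ((b - a n) $ i * (b - a n) $ j)\<bar> \<le> \<bar>H i j\<bar> * (\<rho> * \<rho>)"
          unfolding abs_mult using \<rho> by (intro mult_left_mono mult_mono Kn_comp b) auto
      qed
      moreover have "\<bar>f n b\<bar> \<le> C" "\<bar>f n (a n)\<bar> \<le> C" using C b a_Kn by auto
      ultimately show ?thesis by linarith
    qed
    have "(\<lambda>x. norm (?r (fst x) (snd x))) \<in> o[F](\<lambda>x. (N x)\<^sup>2)"
      using second_order_smallo[OF U(1) a0_U f D2] unfolding g Q_def by (simp add: mult_ac)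
    then show "(\<lambda>x. ?r (fst x) (snd x)) \<in> o[F](\<lambda>x. (N x)\<^sup>2)" by simp
  qed
  have okr: "ok n (?r n)" and okb: "ok n (\<lambda>b. (b - a n) $ i)" and okbb: "ok n (\<lambda>b. (b - a n) $ i * (b - a n) $ j)"
    and okQ: "ok n (\<lambda>b. Q (b - a n))" and okl: "ok n (?lin n)" for n i j
    by (intro ok_cont cont_rules contQ cf)+
  have "J n (\<lambda>b. f n b - f n (a n)) / h n = J n (?r n) / h n + (\<Sum>k\<in>UNIV. g n k * (J n (\<lambda>b. (b - a n) $ k) / h n)) +
      (1/2) * (\<Sum>i\<in>UNIV. \<Sum>j\<in>UNIV. H i j * (J n (\<lambda>b. (b - a n) $ i * (b - a n) $ j) / h n))" for n
  proof -
    have "J n (\<lambda>b. f n b - f n (a n)) = J n (\<lambda>b. ?r n b + ?lin n b + (1/2) * Q (b - a n))" by simp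
    also have "\<dots> = J n (?r n) + J n (?lin n) + (1/2) * J n (\<lambda>b. Q (b - a n))"
      by (simp only: J_add ok_add okr okl okQ ok_cmult J_cmult)
    also have "J n (?lin n) = (\<Sum>k\<in>UNIV. g n k * J n (\<lambda>b. (b - a n) $ k))"
      by (simp only: J_sum ok_cmult okb J_cmult)
    also have "J n (\<lambda>b. Q (b - a n)) = (\<Sum>i\<in>UNIV. \<Sum>j\<in>UNIV. H i j * J n (\<lambda>b. (b - a n) $ i * (b - a n) $ j))"
      unfolding Q_def by (simp only: J_sum ok_sum ok_cmult okbb J_cmult)
    finally show ?thesis by (simp add: add_divide_distrib sum_divide_distrib mult.commute[of "h n"])
  qed
  moreover have "(\<lambda>n. J n (?r n) / h n + (\<Sum>k\<in>UNIV. g n k * (J n (\<lambda>b. (b - a n) $ k) / h n)) +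
      (1/2) * (\<Sum>i\<in>UNIV. \<Sum>j\<in>UNIV. H i j * (J n (\<lambda>b. (b - a n) $ i * (b - a n) $ j) / h n))) \<longlonglongrightarrow>
      0 + (\<Sum>k\<in>UNIV. v k * \<mu> k) + (1/2) * (\<Sum>i\<in>UNIV. \<Sum>j\<in>UNIV. H i j * (if i = j then 1 else 0))"
    by (intro tendsto_intros R gD first_moments second_moments)
  ultimately show ?thesis by (simp add: if_distrib[where f = "\<lambda>x. _ * x"] cong: if_cong)
qed

end

section \<open>Gradient and Laplacian in charts\<close>

lemma local_param_smooth: "local_param M U \<psi> \<Longrightarrow> Ck_on k U \<psi>"
  by (simp add: local_param_def smooth_on_def)

lemma local_param_open: "local_param M U \<psi> \<Longrightarrow> open U"
  by (simp add: local_param_def)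

lemma local_param_has_derivative:
  "local_param M U \<psi> \<Longrightarrow> a \<in> U \<Longrightarrow> (\<psi> has_derivative frechet_derivative \<psi> (at a)) (at a)"
  using Ck_on_has_derivative[OF local_param_smooth] .

lemma local_param_linear: "local_param M U \<psi> \<Longrightarrow> a \<in> U \<Longrightarrow> linear (frechet_derivative \<psi> (at a))"
  using local_param_has_derivative has_derivative_linear by blast

lemma local_param_inj: "local_param M U \<psi> \<Longrightarrow> a \<in> U \<Longrightarrow> inj (frechet_derivative \<psi> (at a))"
  by (simp add: local_param_def)

lemma local_param_subset: "local_param M U \<psi> \<Longrightarrow> \<psi> ` U \<subseteq> M"
  by (simp add: local_param_def openin_subset[of "top_of_set M", simplified])

lemma local_param_inj_on: "local_param M U \<psi> \<Longrightarrow> inj_on \<psi> U"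
  unfolding local_param_def homeomorphism_def by (metis inj_on_inverseI)

text \<open>A chart is a homeomorphism onto a relatively open set, so points of \<open>M\<close>
  near \<open>\<psi> a\<close> are \<open>\<psi> b\<close> with \<open>b\<close> near
  \<open>a\<close>; injectivity of the differential bounds \<open>b - a\<close> by
  \<open>\<psi> b - \<psi> a\<close>. Estimates in the parameter thus become estimates on
  \<open>M\<close>. Only the values of \<open>L\<close> on tangent vectors are prescribed.\<close>

lemma has_derivative_within_submanifold:
  fixes g :: "'a::euclidean_space \<Rightarrow> 'b::real_normed_vector" and \<psi> :: "real ^ 'd::finite \<Rightarrow> 'a"
  assumes lp: "local_param M U \<psi>" and a: "a \<in> U"
    and g: "((g \<circ> \<psi>) has_derivative D) (at a)"
    and L: "bounded_linear L" "\<And>v. L (frechet_derivative \<psi> (at a) v) = D v"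
  shows "(g has_derivative L) (at (\<psi> a) within M)"
  unfolding has_derivative_within_alt
proof (intro conjI L(1) allI impI)
  fix e :: real assume e: "e > 0"
  let ?J = "frechet_derivative \<psi> (at a)"
  obtain B where B: "B > 0" "\<And>v. B * norm v \<le> norm (?J v)"
    using linear_inj_bounded_below_pos[OF local_param_linear[OF lp a] local_param_inj[OF lp a]] by blast
  obtain C where C: "C > 0" "\<And>v. norm (L v) \<le> norm v * C"
    using bounded_linear.pos_bounded[OF L(1)] by blast
  \<comment> \<open>The bound \<open>B / 2\<close> leaves half of the lower bound of the
    differential for \<open>\<psi>\<close> itself; the other bound makes the image of the remainder
    under \<open>L\<close> at most \<open>e * B / 4\<close> per unit of parameter length.\<close>
  define e1 where "e1 = min (B / 2) (e * B / (4 * C))"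
  have e1: "e1 > 0" "e1 \<le> B / 2" "C * e1 \<le> e * B / 4" using B(1) C(1) e by (auto simp: e1_def min_def field_simps)
  obtain d1 where d1: "d1 > 0" "\<And>b. norm (b - a) < d1 \<Longrightarrow> norm (\<psi> b - \<psi> a - ?J (b - a)) \<le> e1 * norm (b - a)"
    using local_param_has_derivative[OF lp a] e1(1) unfolding has_derivative_at_alt by blast
  have "e * B / 4 > 0" using e B by simp
  then obtain d2 where d2: "d2 > 0" "\<And>b. norm (b - a) < d2 \<Longrightarrow> norm (g (\<psi> b) - g (\<psi> a) - D (b - a)) \<le> (e * B / 4) * norm (b - a)"
    using g unfolding has_derivative_at_alt o_def by blast
  obtain \<xi> where \<xi>: "homeomorphism U (\<psi> ` U) \<psi> \<xi>" using lp by (auto simp: local_param_def)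
  obtain T where T: "open T" "\<psi> ` U = M \<inter> T" using lp unfolding local_param_def openin_open by blast
  have "continuous_on (\<psi> ` U) \<xi>" using \<xi> by (simp add: homeomorphism_def)
  then obtain d3 where d3: "d3 > 0" "\<And>y. y \<in> \<psi> ` U \<Longrightarrow> dist y (\<psi> a) < d3 \<Longrightarrow> dist (\<xi> y) (\<xi> (\<psi> a)) < min d1 d2"
    using a d1(1) d2(1) unfolding continuous_on_iff by (metis imageI min_less_iff_conj)
  have \<xi>a: "\<xi> (\<psi> b) = b" if "b \<in> U" for b using \<xi> that by (simp add: homeomorphism_def)
  obtain d4 where d4: "d4 > 0" "ball (\<psi> a) d4 \<subseteq> T" using T a by (metis IntD2 imageI openE)
  show "\<exists>d>0. \<forall>y\<in>M. norm (y - \<psi> a) < d \<longrightarrow> norm (g y - g (\<psi> a) - L (y - \<psi> a)) \<le> e * norm (y - \<psi> a)"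
  proof (intro exI[of _ "min d3 d4"] conjI ballI impI)
    fix y assume y: "y \<in> M" "norm (y - \<psi> a) < min d3 d4"
    then have "y \<in> T" using d4 by (auto simp: dist_norm norm_minus_commute)
    then have yU: "y \<in> \<psi> ` U" using T y by blast
    then obtain b where b: "b \<in> U" "y = \<psi> b" by blast
    have "dist (\<xi> y) (\<xi> (\<psi> a)) < min d1 d2" using d3(2)[OF yU] y by (simp add: dist_norm)
    then have ba: "norm (b - a) < d1" "norm (b - a) < d2" using b a by (simp_all add: \<xi>a dist_norm)
    let ?r = "\<psi> b - \<psi> a - ?J (b - a)"
    have r: "norm ?r \<le> e1 * norm (b - a)" using d1(2)[OF ba(1)] .
    have "B * norm (b - a) \<le> norm (?J (b - a))" by (rule B)
    also have "\<dots> = norm ((\<psi> b - \<psi> a) - ?r)" by simp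
    also have "\<dots> \<le> norm (\<psi> b - \<psi> a) + norm ?r" by (rule norm_triangle_ineq4)
    also have "\<dots> \<le> norm (\<psi> b - \<psi> a) + B / 2 * norm (b - a)"
      using r mult_right_mono[OF e1(2), of "norm (b - a)"] by simp
    finally have low: "B / 2 * norm (b - a) \<le> norm (\<psi> b - \<psi> a)" by simp
    have "g y - g (\<psi> a) - L (y - \<psi> a) = (g (\<psi> b) - g (\<psi> a) - D (b - a)) - L ?r"
      using b by (simp add: linear_diff[OF bounded_linear.linear[OF L(1)]] L(2))
    also have "norm \<dots> \<le> (e * B / 4) * norm (b - a) + norm ?r * C"
      by (rule order_trans[OF norm_triangle_ineq4 add_mono[OF d2(2)[OF ba(2)] C(2)]])
    also have "\<dots> \<le> (e * B / 4) * norm (b - a) + e1 * norm (b - a) * C"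
      using r C(1) by (intro add_left_mono mult_right_mono) auto
    also have "\<dots> = (e * B / 4) * norm (b - a) + (C * e1) * norm (b - a)" by simp
    also have "\<dots> \<le> (e * B / 4) * norm (b - a) + (e * B / 4) * norm (b - a)"
      using e1(3) by (intro add_left_mono mult_right_mono) auto
    also have "\<dots> = e * (B / 2 * norm (b - a))" by simp
    also have "\<dots> \<le> e * norm (y - \<psi> a)" using low e b by (intro mult_left_mono) auto
    finally show "norm (g y - g (\<psi> a) - L (y - \<psi> a)) \<le> e * norm (y - \<psi> a)" .
  qed (use d3 d4 in auto)
qed

lemma has_derivative_chart:
  fixes \<psi> :: "real ^ 'd::finite \<Rightarrow> 'a::euclidean_space"
  assumes lp: "local_param M U \<psi>" and a: "a \<in> U" and g: "(g has_derivative L) (at (\<psi> a) within M)"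
  shows "((g \<circ> \<psi>) has_derivative (\<lambda>v. L (frechet_derivative \<psi> (at a) v))) (at a)"
proof -
  have "(g has_derivative L) (at (\<psi> a) within \<psi> ` U)"
    using has_derivative_subset[OF g local_param_subset[OF lp]] .
  from diff_chain_within[OF has_derivative_at_withinI[OF local_param_has_derivative[OF lp a]] this]
  have "((g \<circ> \<psi>) has_derivative (L \<circ> frechet_derivative \<psi> (at a))) (at a within U)" .
  then show ?thesis using at_within_open[OF a local_param_open[OF lp]] by (simp add: o_def)
qed

text \<open>Vectors in the range are velocities of images of straight lines. Conversely, a curve in
  \<open>M\<close> is pulled back by the inverse chart, whose derivative within \<open>M\<close> is
  provided by \<open>has_derivative_within_submanifold\<close>.\<close>

lemma tangent_space_chart:
  fixes \<psi> :: "real ^ 'd::finite \<Rightarrow> 'a::euclidean_space"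
  assumes lp: "local_param M U \<psi>" and a: "a \<in> U"
  shows "tangent_space M (\<psi> a) = range (frechet_derivative \<psi> (at a))" (is "?T = range ?J")
proof
  note lin = local_param_linear[OF lp a]
  show "range ?J \<subseteq> ?T"
  proof
    fix w assume "w \<in> range ?J"
    then obtain v where v: "w = ?J v" by blast
    obtain r where r: "r > 0" "ball a r \<subseteq> U" using local_param_open[OF lp] a openE by blast
    define e where "e = r / (norm v + 1)"
    have e: "e > 0" using r by (simp add: e_def add_nonneg_pos)
    have inU: "a + \<tau> *\<^sub>R v \<in> U" if "\<tau> \<in> {-e<..<e}" for \<tau>
    proof -
      have "\<bar>\<tau>\<bar> * norm v \<le> e * norm v" using that by (intro mult_right_mono) auto
      also have "\<dots> < e * (norm v + 1)" using e by simp
      also have "\<dots> = r" unfolding e_def using add_nonneg_pos[of "norm v" 1] by simp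
      finally show ?thesis using r(2) by (auto simp: dist_norm)
    qed
    have "smooth_on {-e<..<e} (\<lambda>\<tau>. \<psi> (a + \<tau> *\<^sub>R v))"
      unfolding smooth_on_def
      by (intro allI Ck_on_compose_affine[OF local_param_smooth[OF lp]] inU) (auto intro: linearI simp: algebra_simps)
    moreover have "((\<lambda>\<tau>. \<psi> (a + \<tau> *\<^sub>R v)) has_vector_derivative w) (at 0)"
    proof -
      have "((\<lambda>\<tau>. a + \<tau> *\<^sub>R v) has_derivative (\<lambda>h. h *\<^sub>R v)) (at 0)" by (auto intro!: derivative_eq_intros)
      from has_derivative_compose[OF this, of \<psi> ?J] local_param_has_derivative[OF lp a]
      show ?thesis unfolding has_vector_derivative_def by (simp add: v linear_scale[OF lin])
    qed
    ultimately show "w \<in> ?T" unfolding tangent_space_def using e local_param_subset[OF lp] inU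
      by (intro CollectI exI[of _ "\<lambda>\<tau>. \<psi> (a + \<tau> *\<^sub>R v)"] exI[of _ e]) auto
  qed
  show "?T \<subseteq> range ?J"
  proof
    fix w assume "w \<in> ?T"
    then obtain \<gamma> e where \<gamma>: "0 < e" "\<gamma> ` {-e<..<e} \<subseteq> M" "\<gamma> 0 = \<psi> a" "(\<gamma> has_vector_derivative w) (at (0::real))"
      unfolding tangent_space_def by blast
    \<comment> \<open>Any linear left inverse of the differential has the values on tangent vectors
      that a derivative of the inverse chart within \<open>M\<close> must have.\<close>
    obtain \<eta> where \<eta>: "linear \<eta>" "\<eta> \<circ> ?J = id" using linear_injective_left_inverse[OF lin local_param_inj[OF lp a]] by blast
    obtain \<xi> where \<xi>: "homeomorphism U (\<psi> ` U) \<psi> \<xi>" using lp by (auto simp: local_param_def)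
    obtain T where T: "open T" "\<psi> ` U = M \<inter> T" using lp unfolding local_param_def openin_open by blast
    have \<xi>1: "\<xi> (\<psi> b) = b" if "b \<in> U" for b using \<xi> that by (simp add: homeomorphism_def)
    have \<xi>2: "\<psi> (\<xi> y) = y" if "y \<in> \<psi> ` U" for y using homeomorphism_apply2[OF \<xi> that] .
    have "((\<xi> \<circ> \<psi>) has_derivative (\<lambda>v. v)) (at a)"
      by (rule has_derivative_transform_within_open[OF has_derivative_ident local_param_open[OF lp] a]) (simp add: \<xi>1)
    then have d\<xi>: "(\<xi> has_derivative \<eta>) (at (\<psi> a) within M)"
      using \<eta> by (intro has_derivative_within_submanifold[OF lp a]) (auto simp: linear_conv_bounded_linear fun_eq_iff)
    have d\<gamma>: "(\<gamma> has_derivative (\<lambda>h. h *\<^sub>R w)) (at 0 within {-e<..<e})"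
      using \<gamma>(4) unfolding has_vector_derivative_def by (rule has_derivative_at_withinI)
    have "(\<xi> has_derivative \<eta>) (at (\<gamma> 0) within \<gamma> ` {-e<..<e})"
      unfolding \<gamma>(3) by (rule has_derivative_subset[OF d\<xi> \<gamma>(2)])
    from diff_chain_within[OF d\<gamma> this]
    have d1: "((\<xi> \<circ> \<gamma>) has_derivative (\<lambda>h. \<eta> (h *\<^sub>R w))) (at 0)"
      using \<gamma>(1) by (simp add: at_within_open[of 0 "{-e<..<e}"] o_def)
    have "(\<psi> has_derivative ?J) (at ((\<xi> \<circ> \<gamma>) 0))" using local_param_has_derivative[OF lp a] by (simp add: \<gamma>(3) \<xi>1 a)
    from has_derivative_compose[OF d1 this]
    have d2: "((\<lambda>\<tau>. \<psi> (\<xi> (\<gamma> \<tau>))) has_derivative (\<lambda>h. ?J (\<eta> (h *\<^sub>R w)))) (at 0)" by simp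
    have "isCont \<gamma> 0" using \<gamma>(4) by (rule has_vector_derivative_continuous)
    then have "(\<gamma> \<longlongrightarrow> \<gamma> 0) (nhds 0)" by (simp add: isCont_def tendsto_at_iff_tendsto_nhds)
    then have "\<forall>\<^sub>F \<tau> in nhds 0. \<gamma> \<tau> \<in> T" using T a \<gamma>(3) by (intro topological_tendstoD) auto
    moreover have "\<forall>\<^sub>F \<tau> in nhds 0. \<tau> \<in> {-e<..<e}" using \<gamma>(1) by (intro eventually_nhds_in_open) auto
    ultimately have "\<forall>\<^sub>F \<tau> in nhds 0. \<gamma> \<tau> = \<psi> (\<xi> (\<gamma> \<tau>))"
    proof eventually_elim
      case (elim \<tau>)
      then have "\<gamma> \<tau> \<in> \<psi> ` U" using T(2) \<gamma>(2) by blast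
      then show ?case by (simp add: \<xi>2)
    qed
    then obtain S where S: "open S" "0 \<in> S" "\<And>\<tau>. \<tau> \<in> S \<Longrightarrow> \<gamma> \<tau> = \<psi> (\<xi> (\<gamma> \<tau>))"
      unfolding eventually_nhds by blast
    have "(\<gamma> has_derivative (\<lambda>h. ?J (\<eta> (h *\<^sub>R w)))) (at 0)"
      by (rule has_derivative_transform_within_open[OF d2 S(1,2)]) (use S(3) in metis)
    with \<gamma>(4) have "(\<lambda>h. h *\<^sub>R w) = (\<lambda>h. ?J (\<eta> (h *\<^sub>R w)))"
      unfolding has_vector_derivative_def by (rule has_derivative_unique)
    from fun_cong[OF this, of 1] show "w \<in> range ?J" by auto
  qed
qed

text \<open>The map taking \<open>p\<close> to the inner products of \<open>J p\<close> with the
  images of the axes is injective, since \<open>J p\<close> orthogonal to the range of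
  \<open>J\<close> forces \<open>J p = 0\<close>; in finite dimension it is therefore onto.\<close>

lemma riesz_injective:
  fixes J :: "real ^ 'd::finite \<Rightarrow> 'a::euclidean_space"
  assumes J: "linear J" "inj J" and D: "linear (D :: real ^ 'd \<Rightarrow> real)"
  obtains p where "\<And>v. J p \<bullet> J v = D v"
proof -
  define T where "T p = (\<chi> i. J p \<bullet> J (axis i 1))" for p
  have lT: "linear T"
    by (intro linearI) (simp_all add: T_def vec_eq_iff linear_add[OF J(1)] linear_scale[OF J(1)] inner_add_left)
  have exp: "J p \<bullet> J v = (\<Sum>i\<in>UNIV. v $ i * T p $ i)" for p v
    by (subst linear_axis_expansion[OF J(1), of v]) (simp add: T_def inner_sum_right)
  have "inj T"
  proof (rule linear_injective_0[OF lT, THEN iffD2], intro allI impI)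
    fix p assume "T p = 0"
    then have "J p \<bullet> J p = 0" using exp[of p p] by simp
    then show "p = 0" using J linear_injective_0 by auto
  qed
  then have "surj T" using linear_injective_imp_surjective[OF lT] by simp
  then obtain p where p: "T p = (\<chi> i. D (axis i 1))" by (metis surjD)
  have "J p \<bullet> J v = D v" for v
    unfolding exp p by (subst linear_axis_expansion[OF D]) simp
  then show thesis by (rule that)
qed

text \<open>Evaluates the definite description in \<open>mgrad\<close>: a representing tangent
  vector exists by \<open>riesz_injective\<close>, and two of them differ by a tangent vector
  orthogonal to every tangent vector.\<close>

lemma mgrad_chart:
  fixes \<psi> :: "real ^ 'd::finite \<Rightarrow> 'a::euclidean_space"
  assumes lp: "local_param M U \<psi>" and a: "a \<in> U" and g: "((g \<circ> \<psi>) has_derivative D) (at a)"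
  shows "mgrad M g (\<psi> a) \<in> range (frechet_derivative \<psi> (at a))"
    and "mgrad M g (\<psi> a) \<bullet> frechet_derivative \<psi> (at a) v = D v"
proof -
  let ?J = "frechet_derivative \<psi> (at a)"
  note lin = local_param_linear[OF lp a] and inj = local_param_inj[OF lp a]
  obtain p where p: "\<And>v. ?J p \<bullet> ?J v = D v" using riesz_injective[OF lin inj has_derivative_linear[OF g]] by blast
  have "mgrad M g (\<psi> a) = ?J p"
    unfolding mgrad_def tangent_space_chart[OF lp a]
  proof (rule the_equality)
    show "?J p \<in> range ?J \<and> (g has_derivative (\<bullet>) (?J p)) (at (\<psi> a) within M)"
      using has_derivative_within_submanifold[OF lp a g bounded_linear_inner_right[of "?J p"] p] by blast
    fix u assume u: "u \<in> range ?J \<and> (g has_derivative (\<bullet>) u) (at (\<psi> a) within M)"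
    then have "((g \<circ> \<psi>) has_derivative (\<lambda>v. u \<bullet> ?J v)) (at a)" using has_derivative_chart[OF lp a] by blast
    then have "(\<lambda>v. u \<bullet> ?J v) = D" using g has_derivative_unique by blast
    then have eq: "(u - ?J p) \<bullet> ?J v = 0" for v using p[of v] by (auto simp: inner_diff_left fun_eq_iff)
    obtain q where "u = ?J q" using u by blast
    then have "u - ?J p = ?J (q - p)" by (simp add: linear_diff[OF lin])
    then show "u = ?J p" using eq[of "q - p"] by simp
  qed
  then show "mgrad M g (\<psi> a) \<in> range ?J" "mgrad M g (\<psi> a) \<bullet> ?J v = D v" using p by auto
qed

section \<open>Traces over orthonormal bases\<close>

lemma orthonormal_expansion:
  fixes C :: "'a::euclidean_space set"
  assumes "finite C" "pairwise orthogonal C" "\<forall>e\<in>C. norm e = 1" "x \<in> span C"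
  shows "x = (\<Sum>f\<in>C. (x \<bullet> f) *\<^sub>R f)"
proof -
  let ?z = "x - (\<Sum>f\<in>C. (x \<bullet> f) *\<^sub>R f)"
  have "orthogonal ?z f" if "f \<in> C" for f
  proof -
    have "(\<Sum>g\<in>C. (x \<bullet> g) *\<^sub>R g) \<bullet> f = (\<Sum>g\<in>C. if g = f then x \<bullet> f else 0)"
      unfolding inner_sum_left
      using assms(2,3) that by (intro sum.cong) (auto simp: pairwise_def orthogonal_def power2_norm_eq_inner[symmetric])
    then show ?thesis using assms(1) that by (simp add: orthogonal_def inner_diff_left)
  qed
  moreover have "?z \<in> span C" by (intro span_diff assms span_sum span_scale) (auto intro: span_base)
  ultimately have "orthogonal ?z ?z" using orthogonal_to_span by blast
  then show ?thesis by (simp add: orthogonal_self)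
qed

lemma orthonormal_finite: "pairwise orthogonal (B::'a::euclidean_space set) \<Longrightarrow> \<forall>e\<in>B. norm e = 1 \<Longrightarrow> finite B"
  by (metis finiteI_independent norm_zero pairwise_orthogonal_independent zero_neq_one)

text \<open>This independence of the basis makes the definite description in \<open>mdiv\<close>
  meaningful. Only the arguments of \<open>D\<close> are expanded, since its values may leave the
  span.\<close>

lemma trace_orthonormal:
  fixes B C :: "'a::euclidean_space set"
  assumes B: "pairwise orthogonal B" "\<forall>e\<in>B. norm e = 1" and C: "pairwise orthogonal C" "\<forall>e\<in>C. norm e = 1"
    and BC: "span B = span C" and D: "linear D"
  shows "(\<Sum>e\<in>B. D e \<bullet> e) = (\<Sum>f\<in>C. D f \<bullet> f)"
proof -
  note fin = orthonormal_finite[OF B] orthonormal_finite[OF C]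
  have "(\<Sum>e\<in>B. D e \<bullet> e) = (\<Sum>e\<in>B. \<Sum>f\<in>C. (e \<bullet> f) * (D f \<bullet> e))"
  proof (rule sum.cong[OF refl])
    fix e assume "e \<in> B"
    then have "D e = D (\<Sum>f\<in>C. (e \<bullet> f) *\<^sub>R f)" using orthonormal_expansion[OF fin(2) C, of e] BC span_base by fastforce
    then show "D e \<bullet> e = (\<Sum>f\<in>C. (e \<bullet> f) * (D f \<bullet> e))"
      by (simp add: linear_sum[OF D] linear_scale[OF D] inner_sum_left)
  qed
  also have "\<dots> = (\<Sum>f\<in>C. \<Sum>e\<in>B. (f \<bullet> e) * (D f \<bullet> e))" by (subst sum.swap) (simp add: inner_commute)
  also have "\<dots> = (\<Sum>f\<in>C. D f \<bullet> f)"
  proof (rule sum.cong[OF refl])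
    fix f assume "f \<in> C"
    then have "f = (\<Sum>e\<in>B. (f \<bullet> e) *\<^sub>R e)" using orthonormal_expansion[OF fin(1) B, of f] BC span_base by blast
    then have "D f \<bullet> f = D f \<bullet> (\<Sum>e\<in>B. (f \<bullet> e) *\<^sub>R e)" by simp
    then show "(\<Sum>e\<in>B. (f \<bullet> e) * (D f \<bullet> e)) = D f \<bullet> f" by (simp add: inner_sum_right)
  qed
  finally show ?thesis .
qed

text \<open>The increment of \<open>p\<close> is multiplied by a factor of first order, so its
  continuity at \<open>a\<close> is enough. The purpose is to differentiate the coordinates of a
  gradient before their differentiability is known.\<close>

lemma has_derivative_mult_vanishing:
  fixes f p :: "'a::real_normed_vector \<Rightarrow> real"
  assumes f: "(f has_derivative f') (at a)" "f a = 0" and p: "isCont p a"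
  shows "((\<lambda>b. f b * p b) has_derivative (\<lambda>h. f' h * p a)) (at a)"
  unfolding has_derivative_at_alt
proof (intro conjI allI impI)
  have lin: "bounded_linear f'" using f(1) has_derivative_bounded_linear by blast
  show "bounded_linear (\<lambda>h. f' h * p a)" by (rule bounded_linear_mult_const[OF lin])
  fix e :: real assume e: "e > 0"
  obtain C where C: "C > 0" "\<And>h. norm (f' h) \<le> norm h * C" using bounded_linear.pos_bounded[OF lin] by blast
  define q where "q = \<bar>p a\<bar> + 1"
  have q: "q > 0" by (simp add: q_def)
  have "e / (2 * q) > 0" using e q by simp
  then obtain d1 where d1: "d1 > 0" "\<And>b. norm (b - a) < d1 \<Longrightarrow> norm (f b - f a - f' (b - a)) \<le> e / (2 * q) * norm (b - a)"
    using f(1) unfolding has_derivative_at_alt by blast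
  have "min 1 (e / (2 * C)) > 0" using e C by simp
  then obtain d2 where d2: "d2 > 0" "\<And>b. dist b a < d2 \<Longrightarrow> dist (p b) (p a) < min 1 (e / (2 * C))"
    using p unfolding continuous_at_eps_delta dist_norm real_norm_def by (metis dist_real_def)
  show "\<exists>d>0. \<forall>b. norm (b - a) < d \<longrightarrow> norm (f b * p b - f a * p a - f' (b - a) * p a) \<le> e * norm (b - a)"
  proof (intro exI[of _ "min d1 d2"] conjI allI impI)
    fix b assume b: "norm (b - a) < min d1 d2"
    have pb: "\<bar>p b - p a\<bar> < 1" "\<bar>p b - p a\<bar> \<le> e / (2 * C)" using d2(2)[of b] b by (auto simp: dist_norm)
    then have "\<bar>p b\<bar> \<le> q" by (auto simp: q_def)
    have "f b * p b - f a * p a - f' (b - a) * p a = (f b - f a - f' (b - a)) * p b + f' (b - a) * (p b - p a)"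
      by (simp add: f(2) algebra_simps)
    also have "\<bar>\<dots>\<bar> \<le> (e / (2 * q) * norm (b - a)) * q + (norm (b - a) * C) * (e / (2 * C))"
    proof (intro order_trans[OF abs_triangle_ineq] add_mono)
      show "\<bar>(f b - f a - f' (b - a)) * p b\<bar> \<le> (e / (2 * q) * norm (b - a)) * q"
        unfolding abs_mult using d1(2)[of b] b \<open>\<bar>p b\<bar> \<le> q\<close> e q by (intro mult_mono) auto
      show "\<bar>f' (b - a) * (p b - p a)\<bar> \<le> (norm (b - a) * C) * (e / (2 * C))"
        unfolding abs_mult using C(2)[of "b - a"] pb C(1) by (intro mult_mono) auto
    qed
    also have "\<dots> = e * norm (b - a)" using q C(1) by (simp add: field_simps)
    finally show "norm (f b * p b - f a * p a - f' (b - a) * p a) \<le> e * norm (b - a)" by simp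
  qed (use d1 d2 in auto)
qed

text \<open>The coordinates \<open>p\<close> of the gradient solve a linear system with the Gram
  matrix, the identity at \<open>a0\<close>. Once they are differentiable there, differentiating
  \<open>V b \<bullet> E k b = r k b\<close> gives the components of the derivative of the gradient
  in the frame \<open>E\<close>, and their trace is the divergence. No Christoffel symbols or
  inverse metric appear.\<close>

lemma laplace_beltrami_chart:
  fixes \<psi> :: "real ^ 'd::finite \<Rightarrow> 'a::euclidean_space"
  assumes lp: "local_param M U \<psi>" and a0: "a0 \<in> U"
    and orth: "\<And>i j. frechet_derivative \<psi> (at a0) (axis i 1) \<bullet> frechet_derivative \<psi> (at a0) (axis j 1) = (if i = j then 1 else 0)"
    and g: "Ck_on 2 U (g \<circ> \<psi>)"
  shows "laplace_beltrami M g (\<psi> a0) =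
    - (\<Sum>i\<in>UNIV. frechet_derivative (\<lambda>b. frechet_derivative (g \<circ> \<psi>) (at b) (axis i 1)) (at a0) (axis i 1) -
       mgrad M g (\<psi> a0) \<bullet> frechet_derivative (\<lambda>b. frechet_derivative \<psi> (at b) (axis i 1)) (at a0) (axis i 1))"
proof -
  define V where "V b = mgrad M g (\<psi> b)" for b
  define r where "r k b = frechet_derivative (g \<circ> \<psi>) (at b) (axis k 1)" for k b
  define E where "E k b = frechet_derivative \<psi> (at b) (axis k 1)" for k b
  define G where "G l k b = E l b \<bullet> E k b" for l k b
  define \<delta> where "\<delta> l k = (if l = k then 1 else 0 :: real)" for l k :: 'd
  note U = local_param_open[OF lp]
  have g2: "Ck_on (Suc 1) U (g \<circ> \<psi>)" using g by (simp add: numeral_2_eq_2)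
  have \<psi>2: "Ck_on (Suc 1) U \<psi>" by (rule local_param_smooth[OF lp])
  have r1: "Ck_on 1 U (r k)" for k using g2 unfolding r_def[abs_def] by simp
  have E1: "Ck_on 1 U (E k)" for k using \<psi>2 unfolding E_def[abs_def] by simp
  have G1: "Ck_on 1 U (G l k)" for l k unfolding G_def[abs_def] by (rule Ck_on_inner[OF U E1 E1])
  have dr: "(r k has_derivative frechet_derivative (r k) (at a0)) (at a0)" for k
    using Ck_on_has_derivative[of 0 U "r k"] r1[of k] a0 by simp
  have dE: "(E k has_derivative frechet_derivative (E k) (at a0)) (at a0)" for k
    using Ck_on_has_derivative[of 0 U "E k"] E1[of k] a0 by simp
  have dG: "(G l k has_derivative frechet_derivative (G l k) (at a0)) (at a0)" for l k
    using Ck_on_has_derivative[of 0 U "G l k"] G1[of l k] a0 by simp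
  have dg: "((g \<circ> \<psi>) has_derivative frechet_derivative (g \<circ> \<psi>) (at b)) (at b)" if "b \<in> U" for b
    using Ck_on_has_derivative[OF g2 that] .
  have VE: "V b \<bullet> E k b = r k b" if "b \<in> U" for b k
    unfolding V_def E_def r_def by (rule mgrad_chart(2)[OF lp that dg[OF that]])
  have "\<exists>q. V b = frechet_derivative \<psi> (at b) q" if "b \<in> U" for b
    using mgrad_chart(1)[OF lp that dg[OF that]] unfolding V_def by blast
  then obtain p where p: "\<And>b. b \<in> U \<Longrightarrow> V b = frechet_derivative \<psi> (at b) (p b)" by metis
  have pE: "V b = (\<Sum>l\<in>UNIV. p b $ l *\<^sub>R E l b)" if "b \<in> U" for b
    unfolding E_def by (subst linear_axis_expansion[OF local_param_linear[OF lp that], symmetric]) (rule p[OF that])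
  have pG: "(\<Sum>l\<in>UNIV. G l k b * p b $ l) = r k b" if "b \<in> U" for b k
    unfolding VE[OF that, symmetric] pE[OF that] by (simp add: inner_sum_left G_def mult.commute)
  have G0: "G l k a0 = \<delta> l k" for l k unfolding G_def E_def \<delta>_def by (rule orth)
  have cont_p: "isCont (\<lambda>b. p b $ k) a0" for k
    unfolding continuous_at_sequentially
  proof (intro allI impI)
    fix x assume x: "x \<longlonglongrightarrow> a0"
    have ev: "\<forall>\<^sub>F n in sequentially. x n \<in> U" using topological_tendstoD[OF x U a0] .
    have "(\<lambda>n. p (x n) $ k) \<longlonglongrightarrow> p a0 $ k"
    proof (rule near_identity_tendsto[where g = "\<lambda>n l k. G l k (x n)"])
      show "(\<lambda>n. G l k (x n)) \<longlonglongrightarrow> (if l = k then 1 else 0)" for l k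
        using filterlim_compose[OF continuous_on_open_tendsto_nhds[OF U a0 Ck_on_continuous_on[OF G1]] x, of l k]
        by (simp add: G0 \<delta>_def)
      have "p a0 $ k = r k a0" for k
        unfolding pG[OF a0, symmetric] G0 \<delta>_def by (simp add: if_distrib[of "\<lambda>y. y * _"] cong: if_cong)
      then have "(\<lambda>n. r k (x n)) \<longlonglongrightarrow> p a0 $ k" for k
        using filterlim_compose[OF continuous_on_open_tendsto_nhds[OF U a0 Ck_on_continuous_on[OF r1]] x, of k] by simp
      then show "(\<lambda>n. \<Sum>l\<in>UNIV. G l k (x n) * p (x n) $ l) \<longlonglongrightarrow> p a0 $ k" for k
        by (rule Lim_transform_eventually) (use ev in \<open>eventually_elim, simp add: pG\<close>)
    qed
    then show "((\<lambda>b. p b $ k) \<circ> x) \<longlonglongrightarrow> p a0 $ k" by (simp add: o_def)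
  qed
  \<comment> \<open>Solving for \<open>p b $ k\<close> as \<open>r k b\<close> minus a sum of terms
    \<open>(G l k b - \<delta> l k) * p b $ l\<close>: the first factors vanish at
    \<open>a0\<close>, so continuity of \<open>p\<close> yields differentiability.\<close>
  have "\<exists>p'. ((\<lambda>b. p b $ k) has_derivative p') (at a0)" for k
  proof -
    have "((\<lambda>b. (G l k b - \<delta> l k) * p b $ l) has_derivative (\<lambda>h. (frechet_derivative (G l k) (at a0) h - 0) * p a0 $ l)) (at a0)" for l
      by (rule has_derivative_mult_vanishing[OF has_derivative_diff[OF dG has_derivative_const] _ cont_p]) (simp add: G0)
    note has_derivative_diff[OF dr[of k] has_derivative_sum[OF this]]
    then have "((\<lambda>b. p b $ k) has_derivative (\<lambda>h. frechet_derivative (r k) (at a0) h - (\<Sum>l\<in>UNIV. (frechet_derivative (G l k) (at a0) h - 0) * p a0 $ l))) (at a0)"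
    proof (rule has_derivative_transform_within_open[OF _ U a0])
      fix b assume b: "b \<in> U"
      have "(\<Sum>l\<in>UNIV. \<delta> l k * p b $ l) = p b $ k" unfolding \<delta>_def by (simp add: if_distrib[of "\<lambda>y. y * _"] cong: if_cong)
      then show "r k b - (\<Sum>l\<in>UNIV. (G l k b - \<delta> l k) * p b $ l) = p b $ k"
        by (simp add: left_diff_distrib sum_subtractf pG[OF b])
    qed
    then show ?thesis by blast
  qed
  then obtain p' where p': "\<And>k. ((\<lambda>b. p b $ k) has_derivative p' k) (at a0)" by metis
  define W' where "W' h = (\<Sum>l\<in>UNIV. p a0 $ l *\<^sub>R frechet_derivative (E l) (at a0) h + p' l h *\<^sub>R E l a0)" for h
  have dV: "((mgrad M g \<circ> \<psi>) has_derivative W') (at a0)"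
  proof -
    have "((\<lambda>b. \<Sum>l\<in>UNIV. p b $ l *\<^sub>R E l b) has_derivative W') (at a0)"
      unfolding W'_def by (intro has_derivative_sum has_derivative_scaleR p' dE)
    then show ?thesis
      by (rule has_derivative_transform_within_open[OF _ U a0]) (simp add: pE[symmetric] V_def)
  qed
  have key: "W' h \<bullet> E k a0 + V a0 \<bullet> frechet_derivative (E k) (at a0) h = frechet_derivative (r k) (at a0) h" for h k
  proof -
    have d1: "((\<lambda>b. V b \<bullet> E k b) has_derivative (\<lambda>h. V a0 \<bullet> frechet_derivative (E k) (at a0) h + W' h \<bullet> E k a0)) (at a0)"
      using has_derivative_inner[OF dV dE[of k]] by (simp add: V_def)
    have d2: "((\<lambda>b. V b \<bullet> E k b) has_derivative frechet_derivative (r k) (at a0)) (at a0)"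
      by (rule has_derivative_transform_within_open[OF dr U a0]) (simp add: VE)
    from fun_cong[OF has_derivative_unique[OF d2 d1], of h] show ?thesis by simp
  qed
  let ?J = "frechet_derivative \<psi> (at a0)"
  note lin = local_param_linear[OF lp a0]
  obtain \<eta> where \<eta>: "linear \<eta>" "\<eta> \<circ> ?J = id" using linear_injective_left_inverse[OF lin local_param_inj[OF lp a0]] by blast
  have linW: "linear W'" using dV has_derivative_linear by blast
  \<comment> \<open>The left inverse \<open>\<eta>\<close> merely extends the differential to the
    ambient space; the trace over \<open>B\<close> sees its values on tangent vectors.\<close>
  have L: "(mgrad M g has_derivative (W' \<circ> \<eta>)) (at (\<psi> a0) within M)"
    using \<eta> linear_compose[OF \<eta>(1) linW]
    by (intro has_derivative_within_submanifold[OF lp a0 dV]) (auto simp: linear_conv_bounded_linear fun_eq_iff)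
  define B where "B = range (\<lambda>i. E i a0)"
  have Einj: "inj (\<lambda>i. E i a0)"
    by (rule injI, rule ccontr) (use orth G0 in \<open>metis G_def \<delta>_def zero_neq_one\<close>)
  have B: "pairwise orthogonal B" "\<forall>e\<in>B. norm e = 1"
    using G0 unfolding B_def pairwise_def orthogonal_def G_def \<delta>_def by (auto simp: norm_eq_1)
  have "span B = range ?J"
  proof
    show "span B \<subseteq> range ?J"
      unfolding B_def E_def by (intro span_minimal linear_subspace_image[OF lin] subspace_UNIV) auto
    show "range ?J \<subseteq> span B"
    proof
      fix y assume "y \<in> range ?J"
      then obtain v where "y = ?J v" by blast
      then have "y = (\<Sum>i\<in>UNIV. v $ i *\<^sub>R E i a0)" unfolding E_def using linear_axis_expansion[OF lin] by blast
      then show "y \<in> span B" unfolding B_def by (simp only:) (intro span_sum span_scale span_base rangeI)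
    qed
  qed
  then have span: "span B = tangent_space M (\<psi> a0)" using tangent_space_chart[OF lp a0] by simp
  define c where "c = (\<Sum>i\<in>UNIV. W' (axis i 1) \<bullet> E i a0)"
  have trace: "(\<Sum>e\<in>B. D e \<bullet> e) = c" if "\<And>v. D (?J v) = W' v" for D
    unfolding B_def c_def using that by (subst sum.reindex[OF Einj]) (simp add: E_def o_def)
  have "mdiv M (mgrad M g) (\<psi> a0) = c"
    unfolding mdiv_def
  proof (rule the_equality)
    have "(W' \<circ> \<eta>) (?J v) = W' v" for v using \<eta>(2) by (auto simp: fun_eq_iff)
    then show "\<exists>D B. (mgrad M g has_derivative D) (at (\<psi> a0) within M) \<and> pairwise orthogonal B \<and> (\<forall>e\<in>B. norm e = 1) \<and>
        span B = tangent_space M (\<psi> a0) \<and> c = (\<Sum>e\<in>B. D e \<bullet> e)"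
      using L B span trace by metis
    fix c' assume "\<exists>D B. (mgrad M g has_derivative D) (at (\<psi> a0) within M) \<and> pairwise orthogonal B \<and> (\<forall>e\<in>B. norm e = 1) \<and>
        span B = tangent_space M (\<psi> a0) \<and> c' = (\<Sum>e\<in>B. D e \<bullet> e)"
    then obtain D B' where D: "(mgrad M g has_derivative D) (at (\<psi> a0) within M)" "pairwise orthogonal B'" "\<forall>e\<in>B'. norm e = 1"
        "span B' = tangent_space M (\<psi> a0)" "c' = (\<Sum>e\<in>B'. D e \<bullet> e)" by blast
    have "(\<lambda>v. D (?J v)) = W'" using has_derivative_unique[OF has_derivative_chart[OF lp a0 D(1)] dV] .
    then have "D (?J v) = W' v" for v by meson
    from trace[OF this] trace_orthonormal[OF D(2,3) B _ has_derivative_linear[OF D(1)]] D(4,5) span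
    show "c' = c" by simp
  qed
  also have "c = (\<Sum>i\<in>UNIV. frechet_derivative (r i) (at a0) (axis i 1) - V a0 \<bullet> frechet_derivative (E i) (at a0) (axis i 1))"
    unfolding c_def by (intro sum.cong refl) (simp add: key[symmetric])
  finally show ?thesis unfolding laplace_beltrami_def r_def[abs_def] V_def E_def[abs_def] by simp
qed

section \<open>Riemannian volume in charts\<close>

lemma det_nonzero_positive_definite:
  fixes A :: "real ^ 'd::finite ^ 'd"
  assumes "\<And>v. v \<noteq> 0 \<Longrightarrow> v \<bullet> (A *v v) > 0"
  shows "det A \<noteq> 0"
proof -
  have "inj ((*v) A)"
    using assms by (subst linear_injective_0) (auto, metis inner_zero_right less_irrefl)
  then have "det (matrix ((*v) A)) \<noteq> 0" by (subst det_nz_iff_inj) auto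
  then show ?thesis by simp
qed

text \<open>The segment from the identity to \<open>A\<close> consists of positive definite, hence
  invertible, matrices, whereas a nonpositive determinant of \<open>A\<close> would give a zero on
  it by the intermediate value theorem.\<close>

lemma det_positive_definite:
  fixes A :: "real ^ 'd::finite ^ 'd"
  assumes A: "\<And>v. v \<noteq> 0 \<Longrightarrow> v \<bullet> (A *v v) > 0"
  shows "det A > 0"
proof (rule ccontr)
  assume "\<not> det A > 0"
  define B where "B t = (\<chi> i j. (1 - t) * (mat 1 :: real ^ 'd ^ 'd) $ i $ j + t * A $ i $ j)" for t
  have "continuous_on {0..1} (\<lambda>t. det (B t))"
    unfolding det_def B_def by (simp, intro continuous_intros)
  moreover have "det (B 1) \<le> 0" "0 \<le> det (B 0)" using \<open>\<not> det A > 0\<close> by (simp_all add: B_def)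
  ultimately obtain t where t: "0 \<le> t" "t \<le> 1" "det (B t) = 0"
    using IVT2'[of "\<lambda>t. det (B t)" 1 0 0] by auto
  have "det (B t) \<noteq> 0"
  proof (rule det_nonzero_positive_definite)
    fix v :: "real ^ 'd" assume v: "v \<noteq> 0"
    have "B t = (1 - t) *\<^sub>R mat 1 + t *\<^sub>R A" by (simp add: B_def vec_eq_iff)
    then have "v \<bullet> (B t *v v) = (1 - t) * (v \<bullet> v) + t * (v \<bullet> (A *v v))"
      by (simp add: matrix_vector_mult_add_rdistrib scaleR_matrix_vector_assoc[symmetric] inner_add_right)
    moreover have "v \<bullet> v > 0" using v by simp
    ultimately show "v \<bullet> (B t *v v) > 0" using A[OF v] t(1,2)
      by (cases "t = 0") (auto intro!: add_nonneg_pos mult_nonneg_nonneg mult_pos_pos)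
  qed
  then show False using t by simp
qed

text \<open>Jacobi's formula at the identity. A permutation other than the identity moves at least
  two indices, so after differentiating one factor another off-diagonal entry remains, which is
  0.\<close>

lemma has_derivative_det_identity:
  fixes A :: "'a::real_normed_vector \<Rightarrow> real ^ 'd::finite ^ 'd"
  assumes A: "\<And>i j. ((\<lambda>x. A x $ i $ j) has_derivative A' i j) (at a)" and A1: "A a = mat 1"
  shows "((\<lambda>x. det (A x)) has_derivative (\<lambda>h. \<Sum>i\<in>UNIV. A' i i h)) (at a)"
proof -
  let ?P = "{p. p permutes (UNIV :: 'd set)}"
  have "((\<lambda>x. \<Sum>p\<in>?P. of_int (sign p) * (\<Prod>i\<in>UNIV. A x $ i $ p i)) has_derivative
      (\<lambda>h. \<Sum>p\<in>?P. of_int (sign p) * (\<Sum>i\<in>UNIV. A' i (p i) h * (\<Prod>j\<in>UNIV - {i}. A a $ j $ p j)))) (at a)"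
    by (intro has_derivative_sum has_derivative_mult_right has_derivative_prod A)
  moreover have "(\<Sum>p\<in>?P. of_int (sign p) * (\<Sum>i\<in>UNIV. A' i (p i) h * (\<Prod>j\<in>UNIV - {i}. A a $ j $ p j))) = (\<Sum>i\<in>UNIV. A' i i h)" for h
  proof -
    have zero: "(\<Prod>j\<in>UNIV - {i}. A a $ j $ p j) = 0" if p: "p \<in> ?P" "p \<noteq> id" for p i
    proof -
      obtain k where k: "p k \<noteq> k" using p(2) by (auto simp: fun_eq_iff)
      have "p (p k) \<noteq> p k" using k p(1) permutes_inj[of p UNIV] by (auto dest: injD)
      then obtain j where "j \<noteq> i" "p j \<noteq> j" using k by metis
      then show ?thesis using A1 by (intro prod_zero bexI[of _ j]) (auto simp: mat_def)
    qed
    have "(\<Sum>p\<in>?P. of_int (sign p) * (\<Sum>i\<in>UNIV. A' i (p i) h * (\<Prod>j\<in>UNIV - {i}. A a $ j $ p j))) =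
        (\<Sum>p\<in>{id}. of_int (sign p) * (\<Sum>i\<in>UNIV. A' i (p i) h * (\<Prod>j\<in>UNIV - {i}. A a $ j $ p j)))"
      by (intro sum.mono_neutral_right finite_permutations ballI) (auto simp: permutes_id zero)
    also have "\<dots> = (\<Sum>i\<in>UNIV. A' i i h)" by (simp add: A1 mat_def sign_id)
    finally show ?thesis .
  qed
  ultimately show ?thesis unfolding det_def by (simp only:)
qed

definition vol_density :: "(real ^ 'd \<Rightarrow> 'a::euclidean_space) \<Rightarrow> real ^ 'd::finite \<Rightarrow> real" where
  "vol_density \<psi> u = sqrt (det (gram \<psi> u))"

lemma det_gram_pos:
  fixes \<psi> :: "real ^ 'd::finite \<Rightarrow> 'a::euclidean_space"
  assumes "local_param M U \<psi>" "u \<in> U"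
  shows "det (gram \<psi> u) > 0"
proof (rule det_positive_definite)
  fix v :: "real ^ 'd" assume v: "v \<noteq> 0"
  let ?J = "frechet_derivative \<psi> (at u)"
  note lin = local_param_linear[OF assms] and inj = local_param_inj[OF assms]
  have "v \<bullet> (gram \<psi> u *v v) = ?J v \<bullet> ?J v"
    by (simp only: linear_axis_expansion[OF lin, of v] inner_sum_left inner_sum_right inner_scaleR_left inner_scaleR_right)
      (simp add: inner_vec_def matrix_vector_mult_def gram_def sum_distrib_left mult_ac, intro sum.cong refl, simp add: inner_commute)
  moreover have "?J v \<noteq> 0" using inj v linear_injective_0[OF lin] by blast
  ultimately show "v \<bullet> (gram \<psi> u *v v) > 0" by simp
qed

lemma vol_density_pos: "local_param M U \<psi> \<Longrightarrow> u \<in> U \<Longrightarrow> vol_density \<psi> u > 0"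
  unfolding vol_density_def using det_gram_pos by simp

lemma Ck_on_det_gram:
  assumes lp: "local_param M U \<psi>"
  shows "Ck_on k U (\<lambda>u. gram \<psi> u $ i $ j)" and "Ck_on k U (\<lambda>u. det (gram \<psi> u))"
proof -
  note U = local_param_open[OF lp]
  have E: "Ck_on k U (\<lambda>u. frechet_derivative \<psi> (at u) v)" for v
    using local_param_smooth[OF lp, of "Suc k"] by simp
  then show 1: "Ck_on k U (\<lambda>u. gram \<psi> u $ i $ j)" for i j
    unfolding gram_def by (simp add: Ck_on_inner[OF U])
  show "Ck_on k U (\<lambda>u. det (gram \<psi> u))"
    unfolding det_def by (intro Ck_on_sum Ck_on_mult Ck_on_prod Ck_on_const U 1)
qed

lemma vol_density_has_derivative:
  assumes lp: "local_param M U \<psi>" "u \<in> U"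
  shows "(vol_density \<psi> has_derivative (\<lambda>h. frechet_derivative (\<lambda>u. det (gram \<psi> u)) (at u) h * (inverse (sqrt (det (gram \<psi> u))) / 2))) (at u)"
proof -
  have "(sqrt has_derivative (\<lambda>h. h * (inverse (sqrt (det (gram \<psi> u))) / 2))) (at (det (gram \<psi> u)))"
  proof -
    have "(*) (inverse (sqrt (det (gram \<psi> u))) / 2) = (\<lambda>h. h * (inverse (sqrt (det (gram \<psi> u))) / 2))"
      by (simp add: fun_eq_iff)
    then show ?thesis
      using DERIV_real_sqrt[OF det_gram_pos[OF lp]] unfolding has_field_derivative_def by (simp only:)
  qed
  from has_derivative_compose[OF Ck_on_has_derivative[OF Ck_on_det_gram(2)[OF lp(1)] lp(2)] this]
  show ?thesis unfolding vol_density_def[abs_def] .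
qed

lemma Ck_on_vol_density:
  assumes lp: "local_param M U \<psi>"
  shows "Ck_on 1 U (vol_density \<psi>)"
proof -
  note d = Ck_on_det_gram(2)[OF lp, of "Suc 0"]
  have "Ck_on (Suc 0) U (vol_density \<psi>)"
  proof (rule Ck_on_has_derivativeI[OF local_param_open[OF lp] vol_density_has_derivative[OF lp]])
    fix v
    have "continuous_on U (\<lambda>u. frechet_derivative (\<lambda>u. det (gram \<psi> u)) (at u) v * (inverse (sqrt (det (gram \<psi> u))) / 2))"
      using d det_gram_pos[OF lp]
      by (intro continuous_intros Ck_on_continuous_on[OF d]) (auto simp: less_imp_neq[symmetric])
    then show "Ck_on 0 U (\<lambda>u. frechet_derivative (\<lambda>u. det (gram \<psi> u)) (at u) v * (inverse (sqrt (det (gram \<psi> u))) / 2))" by simp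
  qed
  then show ?thesis by simp
qed

text \<open>Where the Gram matrix is the identity, the logarithmic derivative of the density is half
  the trace of the derivative of the Gram matrix, and the derivative of each squared norm on the
  diagonal contributes a factor 2.\<close>

lemma vol_density_derivative_orthonormal:
  fixes \<psi> :: "real ^ 'd::finite \<Rightarrow> 'a::euclidean_space"
  assumes lp: "local_param M U \<psi>" and a0: "a0 \<in> U"
    and orth: "\<And>i j. frechet_derivative \<psi> (at a0) (axis i 1) \<bullet> frechet_derivative \<psi> (at a0) (axis j 1) = (if i = j then 1 else 0)"
  shows "frechet_derivative (vol_density \<psi>) (at a0) v / vol_density \<psi> a0 =
       (\<Sum>i\<in>UNIV. frechet_derivative \<psi> (at a0) (axis i 1) \<bullet>
          frechet_derivative (\<lambda>b. frechet_derivative \<psi> (at b) (axis i 1)) (at a0) v)"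
proof -
  let ?E = "\<lambda>i b. frechet_derivative \<psi> (at b) (axis i 1)"
  have G: "gram \<psi> a0 = mat 1" by (simp add: gram_def mat_def vec_eq_iff orth)
  have dE: "(?E i has_derivative frechet_derivative (?E i) (at a0)) (at a0)" for i
    using local_param_smooth[OF lp, of "Suc (Suc 0)"] a0 by (intro Ck_on_has_derivative[of 0 U]) auto
  have "((\<lambda>u. gram \<psi> u $ i $ j) has_derivative (\<lambda>h. ?E i a0 \<bullet> frechet_derivative (?E j) (at a0) h + frechet_derivative (?E i) (at a0) h \<bullet> ?E j a0)) (at a0)" for i j
    using has_derivative_inner[OF dE dE] by (simp add: gram_def)
  from has_derivative_det_identity[OF this G]
  have "((\<lambda>x. det (gram \<psi> x)) has_derivative (\<lambda>h. \<Sum>i\<in>UNIV. 2 * (?E i a0 \<bullet> frechet_derivative (?E i) (at a0) h))) (at a0)"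
    by (simp add: inner_commute)
  from frechet_derivative_at[OF this]
  have det': "frechet_derivative (\<lambda>x. det (gram \<psi> x)) (at a0) h = (\<Sum>i\<in>UNIV. 2 * (?E i a0 \<bullet> frechet_derivative (?E i) (at a0) h))" for h
    by (metis (no_types, lifting))
  from frechet_derivative_at[OF vol_density_has_derivative[OF lp a0]]
  have "frechet_derivative (vol_density \<psi>) (at a0) v = frechet_derivative (\<lambda>u. det (gram \<psi> u)) (at a0) v * (inverse (sqrt (det (gram \<psi> a0))) / 2)"
    by (metis (no_types, lifting))
  then show ?thesis unfolding det' by (simp add: vol_density_def G flip: sum_distrib_left)
qed

section \<open>Integration against the Riemannian volume\<close>

locale riemannian_volume =
  fixes d :: "'d::finite itself" and M :: "'a::euclidean_space set" and vol :: "'a measure"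
  assumes M_compact: "compact M" and M_submanifold: "embedded_submanifold d M"
    and vol: "volume_measure d M vol"
begin

lemma space_vol: "space vol = M" and sets_vol: "sets vol = sets (restrict_space borel M)"
  using vol by (simp_all add: volume_measure_def)

lemma measurable_vol: "measurable vol N = measurable (restrict_space borel M) N"
  by (rule measurable_cong_sets[OF sets_vol refl])

lemma continuous_measurable: "continuous_on M f \<Longrightarrow> f \<in> borel_measurable vol"
  unfolding measurable_vol by (rule borel_measurable_continuous_on_restrict)

lemma M_borel: "M \<in> sets borel"
  using M_compact by (simp add: borel_compact)

lemma sets_vol_iff: "A \<in> sets vol \<longleftrightarrow> A \<subseteq> M \<and> A \<in> sets borel"
  unfolding sets_vol using sets_restrict_space_iff[of M borel A] M_borel by simp

lemma sets_open: "open T \<Longrightarrow> M \<inter> T \<in> sets vol"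
  unfolding sets_vol_iff using M_borel by auto

lemma emeasure_param:
  fixes U :: "(real ^ 'd) set"
  assumes "local_param M U \<psi>" "B \<in> sets borel" "B \<subseteq> U"
  shows "emeasure vol (\<psi> ` B) = (\<integral>\<^sup>+u\<in>B. ennreal (vol_density \<psi> u) \<partial>lborel)"
  using vol assms unfolding volume_measure_def vol_density_def by blast

lemma param_image_borel:
  fixes U :: "(real ^ 'd) set"
  assumes "local_param M U \<psi>"
  shows "\<psi> ` U \<in> sets vol"
  using assms sets_open unfolding local_param_def openin_open by auto

lemma param_inverse:
  fixes U :: "(real ^ 'd) set"
  assumes lp: "local_param M U \<psi>"
  obtains \<xi> where "\<xi> \<in> borel_measurable (restrict_space vol (\<psi> ` U))" "\<And>u. u \<in> U \<Longrightarrow> \<xi> (\<psi> u) = u"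
    "continuous_on (\<psi> ` U) \<xi>"
proof -
  obtain \<xi> where \<xi>: "homeomorphism U (\<psi> ` U) \<psi> \<xi>" using lp by (auto simp: local_param_def)
  have c: "continuous_on (\<psi> ` U) \<xi>" using \<xi> by (simp add: homeomorphism_def)
  have "sets (restrict_space vol (\<psi> ` U)) = sets (restrict_space borel (\<psi> ` U))"
    using param_image_borel[OF lp] local_param_subset[OF lp] sets_vol_iff
    by (auto simp: sets_restrict_space_iff space_vol Int_absorb1 Int_absorb2 set_eq_iff subset_iff)
  then have "\<xi> \<in> borel_measurable (restrict_space vol (\<psi> ` U))"
    using borel_measurable_continuous_on_restrict[OF c] measurable_cong_sets by blast
  then show thesis using that c homeomorphism_apply1[OF \<xi>] by blast
qed

text \<open>The volume is specified on images of Borel sets. Restated for the image measure under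
  the inverse chart, this yields integrals through the rules for \<open>distr\<close> and
  \<open>density\<close>.\<close>

lemma distr_param:
  fixes U :: "(real ^ 'd) set"
  assumes lp: "local_param M U \<psi>" and \<xi>: "\<xi> \<in> borel_measurable (restrict_space vol (\<psi> ` U))" "\<And>u. u \<in> U \<Longrightarrow> \<xi> (\<psi> u) = u"
  shows "distr (restrict_space vol (\<psi> ` U)) borel \<xi> = density lborel (\<lambda>u. ennreal (indicator U u * vol_density \<psi> u))"
proof (rule measure_eqI)
  note Ub = borel_open[OF local_param_open[OF lp]]
  have m: "(\<lambda>u. indicator U u * vol_density \<psi> u) \<in> borel_measurable borel"
    using borel_measurable_continuous_on_indicator[OF Ub Ck_on_continuous_on[OF Ck_on_vol_density[OF lp]]] by simp
  fix B assume "B \<in> sets (distr (restrict_space vol (\<psi> ` U)) borel \<xi>)"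
  then have B: "B \<in> sets borel" by simp
  have im: "\<xi> -` B \<inter> \<psi> ` U = \<psi> ` (B \<inter> U)" using \<xi>(2) by auto
  have sp: "space (restrict_space vol (\<psi> ` U)) = \<psi> ` U"
    using local_param_subset[OF lp] by (auto simp: space_restrict_space space_vol)
  have "emeasure (distr (restrict_space vol (\<psi> ` U)) borel \<xi>) B = emeasure (restrict_space vol (\<psi> ` U)) (\<psi> ` (B \<inter> U))"
    using emeasure_distr[OF \<xi>(1) B] by (simp add: sp im)
  also have "\<dots> = emeasure vol (\<psi> ` (B \<inter> U))"
    using param_image_borel[OF lp] by (intro emeasure_restrict_space) auto
  also have "\<dots> = (\<integral>\<^sup>+u\<in>B \<inter> U. ennreal (vol_density \<psi> u) \<partial>lborel)"
    using B Ub by (intro emeasure_param[OF lp]) auto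
  also have "\<dots> = (\<integral>\<^sup>+u\<in>B. ennreal (indicator U u * vol_density \<psi> u) \<partial>lborel)"
    by (intro nn_integral_cong) (auto simp: indicator_def)
  also have "\<dots> = emeasure (density lborel (\<lambda>u. ennreal (indicator U u * vol_density \<psi> u))) B"
    using B m by (subst emeasure_density) auto
  finally show "emeasure (distr (restrict_space vol (\<psi> ` U)) borel \<xi>) B = emeasure (density lborel (\<lambda>u. ennreal (indicator U u * vol_density \<psi> u))) B" .
qed simp

lemma param_image_sets:
  fixes U :: "(real ^ 'd) set"
  assumes lp: "local_param M U \<psi>" and B: "B \<in> sets borel" "B \<subseteq> U"
  shows "\<psi> ` B \<in> sets vol"
proof -
  obtain \<xi> where \<xi>: "\<xi> \<in> borel_measurable (restrict_space vol (\<psi> ` U))" "\<And>u. u \<in> U \<Longrightarrow> \<xi> (\<psi> u) = u"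
    using param_inverse[OF lp] by blast
  have sp: "space (restrict_space vol (\<psi> ` U)) = \<psi> ` U"
    using local_param_subset[OF lp] by (auto simp: space_restrict_space space_vol)
  have "\<xi> -` B \<inter> space (restrict_space vol (\<psi> ` U)) = \<psi> ` B" unfolding sp using \<xi>(2) B(2) by force
  then have "\<psi> ` B \<in> sets (restrict_space vol (\<psi> ` U))" using measurable_sets[OF \<xi>(1) B(1)] by simp
  then show ?thesis using param_image_borel[OF lp] by (subst (asm) sets_restrict_space_iff) auto
qed

lemma integral_param:
  fixes U :: "(real ^ 'd) set" and g :: "'a \<Rightarrow> real"
  assumes lp: "local_param M U \<psi>" and C: "C \<in> sets borel" "C \<subseteq> U"
    and m: "(\<lambda>u. indicator C u * g (\<psi> u)) \<in> borel_measurable borel"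
  shows "(\<integral>y. indicator (\<psi> ` C) y * g y \<partial>vol) = (\<integral>u. indicator C u * (g (\<psi> u) * vol_density \<psi> u) \<partial>lborel)"
proof -
  obtain \<xi> where \<xi>: "\<xi> \<in> borel_measurable (restrict_space vol (\<psi> ` U))" "\<And>u. u \<in> U \<Longrightarrow> \<xi> (\<psi> u) = u"
    using param_inverse[OF lp] by blast
  note Ub = borel_open[OF local_param_open[OF lp]]
  have dm: "(\<lambda>u. indicator U u * vol_density \<psi> u) \<in> borel_measurable borel"
    using borel_measurable_continuous_on_indicator[OF Ub Ck_on_continuous_on[OF Ck_on_vol_density[OF lp]]] by simp
  have "(\<integral>y. indicator (\<psi> ` C) y * g y \<partial>vol) = (\<integral>y. indicator (\<psi> ` U) y *\<^sub>R (indicator C (\<xi> y) * g (\<psi> (\<xi> y))) \<partial>vol)"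
  proof (rule Bochner_Integration.integral_cong[OF refl])
    fix y
    show "indicator (\<psi> ` C) y * g y = indicator (\<psi> ` U) y *\<^sub>R (indicator C (\<xi> y) * g (\<psi> (\<xi> y)))"
      using \<xi>(2) C(2) local_param_inj_on[OF lp] by (auto simp: indicator_def subset_iff inj_on_def)
  qed
  also have "\<dots> = (\<integral>y. indicator C (\<xi> y) * g (\<psi> (\<xi> y)) \<partial>restrict_space vol (\<psi> ` U))"
    using param_image_borel[OF lp] by (intro integral_restrict_space[symmetric]) auto
  also have "\<dots> = (\<integral>u. indicator C u * g (\<psi> u) \<partial>distr (restrict_space vol (\<psi> ` U)) borel \<xi>)"
    by (rule integral_distr[OF \<xi>(1) m, symmetric])
  also have "\<dots> = (\<integral>u. (indicator U u * vol_density \<psi> u) *\<^sub>R (indicator C u * g (\<psi> u)) \<partial>lborel)"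
  proof -
    have eq: "distr (restrict_space vol (\<psi> ` U)) borel \<xi> = density lborel (\<lambda>u. ennreal (indicator U u * vol_density \<psi> u))"
      by (rule distr_param[OF lp \<xi>])
    show ?thesis unfolding eq using m dm vol_density_pos[OF lp]
      by (intro integral_density) (auto simp: indicator_def less_imp_le)
  qed
  also have "\<dots> = (\<integral>u. indicator C u * (g (\<psi> u) * vol_density \<psi> u) \<partial>lborel)"
    using C(2) by (intro Bochner_Integration.integral_cong refl) (auto simp: indicator_def)
  finally show ?thesis .
qed

lemma vol_density_bounds:
  fixes U :: "(real ^ 'd) set"
  assumes lp: "local_param M U \<psi>" and a: "a \<in> U"
  obtains r c C where "r > 0" "cball a r \<subseteq> U" "c > 0" "\<And>u. u \<in> cball a r \<Longrightarrow> c \<le> vol_density \<psi> u \<and> vol_density \<psi> u \<le> C"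
proof -
  obtain r where r: "r > 0" "cball a r \<subseteq> U" using local_param_open[OF lp] a open_contains_cball by blast
  have c: "continuous_on (cball a r) (vol_density \<psi>)"
    using Ck_on_continuous_on[OF Ck_on_vol_density[OF lp]] r(2) continuous_on_subset by blast
  have ne: "cball a r \<noteq> {}" using r by simp
  obtain x where x: "x \<in> cball a r" "\<And>u. u \<in> cball a r \<Longrightarrow> vol_density \<psi> x \<le> vol_density \<psi> u"
    using continuous_attains_inf[OF compact_cball ne c] by blast
  obtain y where y: "y \<in> cball a r" "\<And>u. u \<in> cball a r \<Longrightarrow> vol_density \<psi> u \<le> vol_density \<psi> y"
    using continuous_attains_sup[OF compact_cball ne c] by blast
  show thesis
    by (rule that[OF r, of "vol_density \<psi> x" "vol_density \<psi> y"]) (use x y r(2) vol_density_pos[OF lp] in auto)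
qed

text \<open>The density is bounded below on a small parameter ball whose image lies in the ball
  around \<open>z\<close>. This keeps the Gaussian normalisation positive and supplies its lower
  bound in tail estimates.\<close>

lemma emeasure_ball_pos:
  assumes z: "z \<in> M" and \<delta>: "\<delta> > 0"
  shows "emeasure vol (M \<inter> ball z \<delta>) > 0"
proof -
  obtain U :: "(real ^ 'd) set" and \<psi> where lp: "local_param M U \<psi>" "z \<in> \<psi> ` U"
    using M_submanifold z unfolding embedded_submanifold_def by blast
  then obtain a where a: "a \<in> U" "z = \<psi> a" by blast
  obtain r c C where r: "r > 0" "cball a r \<subseteq> U" "c > 0" "\<And>u. u \<in> cball a r \<Longrightarrow> c \<le> vol_density \<psi> u \<and> vol_density \<psi> u \<le> C"
    using vol_density_bounds[OF lp(1) a(1)] by blast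
  have "(\<psi> \<longlongrightarrow> \<psi> a) (nhds a)"
    by (rule continuous_on_open_tendsto_nhds[OF local_param_open[OF lp(1)] a(1) Ck_on_continuous_on[OF local_param_smooth[OF lp(1)]]])
  from tendstoD[OF this \<delta>] obtain r' where r': "r' > 0" "\<And>u. dist u a < r' \<Longrightarrow> dist (\<psi> u) z < \<delta>"
    unfolding eventually_nhds_metric a(2) by blast
  define q where "q = min r r'"
  have q: "q > 0" "ball a q \<subseteq> cball a r" "ball a q \<subseteq> U" using r r' by (auto simp: q_def)
  have sub: "\<psi> ` ball a q \<subseteq> M \<inter> ball z \<delta>"
    using local_param_subset[OF lp(1)] q(3) r'(2) by (auto simp: q_def dist_commute)
  have "emeasure lborel (ball a q) = ennreal (measure lborel (ball a q))"
    using emeasure_lborel_ball_finite[of a q] by (intro emeasure_eq_ennreal_measure) auto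
  then have "0 < ennreal c * emeasure lborel (ball a q)"
    using r(3) content_ball_pos[OF q(1), of a] by (simp add: ennreal_zero_less_mult_iff)
  also have "\<dots> = (\<integral>\<^sup>+u\<in>ball a q. ennreal c \<partial>lborel)" by (simp add: nn_integral_cmult_indicator)
  also have "\<dots> \<le> (\<integral>\<^sup>+u\<in>ball a q. ennreal (vol_density \<psi> u) \<partial>lborel)"
    using r(4) q(2) by (intro nn_integral_mono) (auto simp: indicator_def intro!: ennreal_leI)
  also have "\<dots> = emeasure vol (\<psi> ` ball a q)" using q(3) by (intro emeasure_param[OF lp(1), symmetric]) auto
  also have "\<dots> \<le> emeasure vol (M \<inter> ball z \<delta>)" by (intro emeasure_mono sub sets_open) auto
  finally show ?thesis .
qed

text \<open>The density is bounded on a closed parameter ball, and the image of the open ball is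
  relatively open; finitely many such pieces cover the compact manifold.\<close>

lemma emeasure_vol_finite: "emeasure vol M < \<infinity>"
proof -
  have "\<exists>V. open V \<and> z \<in> V \<and> emeasure vol (M \<inter> V) < \<infinity>" if z: "z \<in> M" for z
  proof -
    obtain U :: "(real ^ 'd) set" and \<psi> where lp: "local_param M U \<psi>" "z \<in> \<psi> ` U"
      using M_submanifold z unfolding embedded_submanifold_def by blast
    then obtain a where a: "a \<in> U" "z = \<psi> a" by blast
    obtain r c C where r: "r > 0" "cball a r \<subseteq> U" "c > 0" "\<And>u. u \<in> cball a r \<Longrightarrow> c \<le> vol_density \<psi> u \<and> vol_density \<psi> u \<le> C"
      using vol_density_bounds[OF lp(1) a(1)] by blast
    obtain \<xi> where \<xi>: "homeomorphism U (\<psi> ` U) \<psi> \<xi>" using lp by (auto simp: local_param_def)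
    have "ball a r \<subseteq> U" using r(2) by auto
    then have "openin (top_of_set U) (ball a r)" by (simp add: open_openin_trans local_param_open[OF lp(1)] openin_open_eq)
    then have "openin (top_of_set (\<psi> ` U)) (\<psi> ` ball a r)" using homeomorphism_imp_open_map[OF \<xi>] by blast
    then have "openin (top_of_set M) (\<psi> ` ball a r)" using lp(1) openin_trans unfolding local_param_def by blast
    then obtain V where V: "open V" "\<psi> ` ball a r = M \<inter> V" unfolding openin_open by blast
    have "emeasure vol (M \<inter> V) = (\<integral>\<^sup>+u\<in>ball a r. ennreal (vol_density \<psi> u) \<partial>lborel)"
      unfolding V(2)[symmetric] using \<open>ball a r \<subseteq> U\<close> by (intro emeasure_param[OF lp(1)]) auto
    also have "\<dots> \<le> (\<integral>\<^sup>+u\<in>ball a r. ennreal C \<partial>lborel)"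
      using r(4) by (intro nn_integral_mono) (auto simp: indicator_def intro!: ennreal_leI)
    also have "\<dots> = ennreal C * emeasure lborel (ball a r)" by (simp add: nn_integral_cmult_indicator)
    also have "\<dots> < \<infinity>" using emeasure_lborel_ball_finite[of a r] by (simp add: ennreal_mult_less_top)
    finally have "emeasure vol (M \<inter> V) < \<infinity>" .
    moreover have "z \<in> V" using V(2) a r(1) by auto
    ultimately show ?thesis using V(1) by blast
  qed
  then obtain V where V: "\<And>z. z \<in> M \<Longrightarrow> open (V z) \<and> z \<in> V z \<and> emeasure vol (M \<inter> V z) < \<infinity>" by metis
  obtain Z where Z: "Z \<subseteq> M" "finite Z" "M \<subseteq> (\<Union>z\<in>Z. V z)"
    using compactE_image[OF M_compact, of M V] V by blast
  have "emeasure vol M \<le> emeasure vol (\<Union>z\<in>Z. M \<inter> V z)"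
    using Z V by (intro emeasure_mono sets.finite_UN sets_open) auto
  also have "\<dots> \<le> (\<Sum>z\<in>Z. emeasure vol (M \<inter> V z))"
    using Z V by (intro emeasure_subadditive_finite) (auto intro!: sets_open)
  also have "\<dots> < \<infinity>" using Z V by (auto simp: less_top[symmetric] subset_iff)
  finally show ?thesis .
qed

sublocale finite_measure vol
  using emeasure_vol_finite by (intro finite_measureI) (simp add: space_vol)

lemma integrable_continuous:
  fixes f :: "'a \<Rightarrow> real"
  assumes "continuous_on M f" shows "integrable vol f"
proof -
  have "bounded (f ` M)" using compact_continuous_image[OF assms M_compact] compact_imp_bounded by blast
  then obtain B where "\<And>x. x \<in> M \<Longrightarrow> norm (f x) \<le> B" by (auto simp: bounded_iff)
  then show ?thesis
    by (intro integrable_const_bound[of _ B] continuous_measurable assms AE_I2) (simp add: space_vol)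
qed

lemma continuous_on_integral:
  fixes f :: "'c::metric_space \<Rightarrow> 'a \<Rightarrow> real"
  assumes cont: "continuous_on (S \<times> M) (\<lambda>(x, y). f x y)" and B: "\<And>x y. x \<in> S \<Longrightarrow> y \<in> M \<Longrightarrow> \<bar>f x y\<bar> \<le> B"
  shows "continuous_on S (\<lambda>x. \<integral>y. f x y \<partial>vol)"
  unfolding continuous_on_sequentially
proof (intro allI ballI impI)
  have sec: "continuous_on M (f x)" if "x \<in> S" for x
  proof -
    have "continuous_on M ((\<lambda>(x, y). f x y) \<circ> (\<lambda>y. (x, y)))"
      by (rule continuous_on_compose[OF _ continuous_on_subset[OF cont]]) (use that in \<open>auto intro!: continuous_intros\<close>)
    then show ?thesis by (simp add: o_def)
  qed
  have sec2: "continuous_on S (\<lambda>x. f x y)" if "y \<in> M" for y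
  proof -
    have "continuous_on S ((\<lambda>(x, y). f x y) \<circ> (\<lambda>x. (x, y)))"
      by (rule continuous_on_compose[OF _ continuous_on_subset[OF cont]]) (use that in \<open>auto intro!: continuous_intros\<close>)
    then show ?thesis by (simp add: o_def)
  qed
  fix x a assume x: "a \<in> S" "(\<forall>n. x n \<in> S) \<and> x \<longlonglongrightarrow> a"
  have "(\<lambda>n. \<integral>y. f (x n) y \<partial>vol) \<longlonglongrightarrow> (\<integral>y. f a y \<partial>vol)"
  proof (rule integral_dominated_convergence[where w = "\<lambda>_. B"])
    show "AE y in vol. (\<lambda>n. f (x n) y) \<longlonglongrightarrow> f a y"
      using x sec2 by (intro AE_I2) (auto simp: space_vol continuous_on_sequentially o_def)
    show "AE y in vol. norm (f (x n) y) \<le> B" for n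
      using x B by (intro AE_I2) (auto simp: space_vol)
  qed (use x sec in \<open>auto intro: continuous_measurable\<close>)
  then show "((\<lambda>x. \<integral>y. f x y \<partial>vol) \<circ> x) \<longlonglongrightarrow> (\<integral>y. f a y \<partial>vol)" by (simp add: o_def)
qed

end

section \<open>Normalised charts and Gaussian tails\<close>

lemma local_param_near:
  fixes \<psi> :: "real ^ 'd::finite \<Rightarrow> 'a::euclidean_space"
  assumes lp: "local_param M U \<psi>" and a0: "a0 \<in> U"
  obtains \<rho> where "\<rho> > 0" "cball a0 (2 * \<rho>) \<subseteq> U"
    "\<And>b v. b \<in> cball a0 (2 * \<rho>) \<Longrightarrow> norm (frechet_derivative \<psi> (at b) v - frechet_derivative \<psi> (at a0) v) \<le> norm v / 4"
proof -
  define e :: real where "e = 1 / (4 * CARD('d))"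
  have e: "e > 0" by (simp add: e_def)
  have "\<forall>\<^sub>F b in nhds a0. \<forall>i. dist (frechet_derivative \<psi> (at b) (axis i 1)) (frechet_derivative \<psi> (at a0) (axis i 1)) < e"
  proof (rule eventually_all_finite)
    fix i
    have "continuous_on U (\<lambda>b. frechet_derivative \<psi> (at b) (axis i 1))"
      using local_param_smooth[OF lp, of "Suc 0"] by simp
    from tendstoD[OF continuous_on_open_tendsto_nhds[OF local_param_open[OF lp] a0 this] e]
    show "\<forall>\<^sub>F b in nhds a0. dist (frechet_derivative \<psi> (at b) (axis i 1)) (frechet_derivative \<psi> (at a0) (axis i 1)) < e" .
  qed
  with eventually_nhds_in_open[OF local_param_open[OF lp] a0]
  have "\<forall>\<^sub>F b in nhds a0. b \<in> U \<and> (\<forall>i. dist (frechet_derivative \<psi> (at b) (axis i 1)) (frechet_derivative \<psi> (at a0) (axis i 1)) < e)"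
    by (rule eventually_conj)
  then obtain r where r: "r > 0" "\<And>b. dist b a0 < r \<Longrightarrow> b \<in> U \<and> (\<forall>i. dist (frechet_derivative \<psi> (at b) (axis i 1)) (frechet_derivative \<psi> (at a0) (axis i 1)) < e)"
    unfolding eventually_nhds_metric by blast
  have in_r: "dist b a0 < r" if "b \<in> cball a0 (2 * (r / 4))" for b using that r(1) by (simp add: dist_commute)
  show thesis
  proof (rule that[of "r / 4"])
    show "cball a0 (2 * (r / 4)) \<subseteq> U" using r(2) in_r by blast
    fix b v assume b: "b \<in> cball a0 (2 * (r / 4))"
    note rb = r(2)[OF in_r[OF b]]
    have "linear (\<lambda>v. frechet_derivative \<psi> (at b) v - frechet_derivative \<psi> (at a0) v)"
      using local_param_linear[OF lp] rb a0 by (intro linear_compose_sub) auto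
    from linear_axis_bound[OF this, of e v] rb
    show "norm (frechet_derivative \<psi> (at b) v - frechet_derivative \<psi> (at a0) v) \<le> norm v / 4"
      by (auto simp: dist_norm less_imp_le e_def)
  qed (use r in auto)
qed

lemma local_param_reparametrize:
  fixes \<psi> :: "real ^ 'd::finite \<Rightarrow> 'a::euclidean_space" and L :: "real ^ 'd \<Rightarrow> real ^ 'd"
  assumes lp: "local_param M U \<psi>" and L: "linear L" "inj L"
  shows "local_param M {v. a + L v \<in> U} (\<lambda>v. \<psi> (a + L v))"
    and "v \<in> {v. a + L v \<in> U} \<Longrightarrow> frechet_derivative (\<lambda>v. \<psi> (a + L v)) (at v) h = frechet_derivative \<psi> (at (a + L v)) (L h)"
proof -
  let ?V = "{v. a + L v \<in> U}" and ?\<psi> = "\<lambda>v. \<psi> (a + L v)"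
  have bl: "bounded_linear L" using L(1) by (simp add: linear_conv_bounded_linear)
  have cA: "continuous_on S (\<lambda>v. a + L v)" for S
    by (intro continuous_intros linear_continuous_on bl)
  have "open ((\<lambda>v. a + L v) -` U)"
    using continuous_open_vimage[OF local_param_open[OF lp]] cA continuous_on_eq_continuous_at[OF open_UNIV] by blast
  then have oV: "open ?V" by (simp add: vimage_def)
  have "surj L" using linear_injective_imp_surjective[OF L] by simp
  obtain L' where L': "linear L'" "L' \<circ> L = id" "L \<circ> L' = id"
    using linear_injective_isomorphism[OF L] by (auto simp: fun_eq_iff)
  have der: "(?\<psi> has_derivative (\<lambda>h. frechet_derivative \<psi> (at (a + L v)) (L h))) (at v)" if "v \<in> ?V" for v
  proof -
    have "((\<lambda>v. a + L v) has_derivative L) (at v)"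
      using bounded_linear_imp_has_derivative[OF bl] by (auto intro!: derivative_eq_intros)
    from has_derivative_compose[OF this local_param_has_derivative[OF lp]] that show ?thesis by simp
  qed
  show fd: "frechet_derivative ?\<psi> (at v) h = frechet_derivative \<psi> (at (a + L v)) (L h)" if "v \<in> ?V" for v h
    by (rule fun_cong[OF frechet_derivative_at[OF der[OF that]], symmetric])
  have im: "?\<psi> ` ?V = \<psi> ` U"
  proof
    show "\<psi> ` U \<subseteq> ?\<psi> ` ?V"
    proof
      fix y assume "y \<in> \<psi> ` U"
      then obtain u where u: "u \<in> U" "y = \<psi> u" by blast
      obtain v where "L v = u - a" using \<open>surj L\<close> by (metis surjD)
      then have "u = a + L v" by simp
      then show "y \<in> ?\<psi> ` ?V" using u by blast
    qed
  qed auto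
  obtain \<xi> where \<xi>: "homeomorphism U (\<psi> ` U) \<psi> \<xi>" using lp by (auto simp: local_param_def)
  show "local_param M ?V ?\<psi>"
    unfolding local_param_def im
  proof (intro conjI oV ballI exI)
    show "smooth_on ?V ?\<psi>"
      unfolding smooth_on_def by (intro allI Ck_on_compose_affine[OF local_param_smooth[OF lp] oV L(1)]) auto
    show "inj (frechet_derivative ?\<psi> (at v))" if "v \<in> ?V" for v
    proof -
      have "frechet_derivative ?\<psi> (at v) = frechet_derivative \<psi> (at (a + L v)) \<circ> L" using fd[OF that] by (simp add: fun_eq_iff)
      then show ?thesis using local_param_inj[OF lp, of "a + L v"] L(2) that by (auto intro: inj_compose)
    qed
    show "openin (top_of_set M) (\<psi> ` U)" using lp by (simp add: local_param_def)
    show "homeomorphism ?V (\<psi> ` U) ?\<psi> (\<lambda>y. L' (\<xi> y - a))"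
    proof (rule homeomorphismI)
      show "continuous_on ?V ?\<psi>"
        by (rule continuous_on_compose2[OF Ck_on_continuous_on[OF local_param_smooth[OF lp]] cA]) auto
      have "bounded_linear L'" using L'(1) by (simp add: linear_conv_bounded_linear)
      then show "continuous_on (\<psi> ` U) (\<lambda>y. L' (\<xi> y - a))"
        using \<xi> by (intro bounded_linear.continuous_on[OF \<open>bounded_linear L'\<close>] continuous_on_diff continuous_on_const) (simp add: homeomorphism_def)
      show "?\<psi> ` ?V \<subseteq> \<psi> ` U" by auto
      show "(\<lambda>y. L' (\<xi> y - a)) ` (\<psi> ` U) \<subseteq> ?V"
        using L'(3) homeomorphism_apply1[OF \<xi>] by (auto simp: fun_eq_iff)
      show "L' (\<xi> (?\<psi> v) - a) = v" if "v \<in> ?V" for v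
        using that L'(2) homeomorphism_apply1[OF \<xi>] by (auto simp: fun_eq_iff)
      show "?\<psi> (L' (\<xi> y - a)) = y" if "y \<in> \<psi> ` U" for y
        using that L'(3) homeomorphism_apply1[OF \<xi>] by (auto simp: fun_eq_iff)
    qed
  qed
qed

text \<open>\<open>L\<close> sends the axes to preimages of an orthonormal basis of the tangent
  space, and a translation moves the base point to 0. The metric is normalised at this point only,
  and its first derivatives there are arbitrary.\<close>

lemma orthonormal_chart:
  fixes \<psi> :: "real ^ 'd::finite \<Rightarrow> 'a::euclidean_space"
  assumes lp: "local_param M U \<psi>" and a: "a \<in> U"
  obtains V \<psi>' where "local_param M V \<psi>'" "0 \<in> V" "\<psi>' (0 :: real ^ 'd) = \<psi> a"
    "\<And>i j. frechet_derivative \<psi>' (at 0) (axis i 1) \<bullet> frechet_derivative \<psi>' (at 0) (axis j 1) = (if i = j then 1 else 0)"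
proof -
  let ?J = "frechet_derivative \<psi> (at a)"
  note lin = local_param_linear[OF lp a] and inj = local_param_inj[OF lp a]
  have "subspace (range ?J)" using linear_subspace_image[OF lin subspace_UNIV] .
  obtain B where B: "B \<subseteq> range ?J" "pairwise orthogonal B" "\<And>x. x \<in> B \<Longrightarrow> norm x = 1" "independent B" "card B = dim (range ?J)"
    by (rule orthonormal_basis_subspace[OF \<open>subspace (range ?J)\<close>]) (rule that)
  have "dim (range ?J) = CARD('d)"
    using dim_image_eq[OF lin, of UNIV] inj by (simp add: dim_UNIV)
  then have "card (UNIV :: 'd set) = card B" using B by simp
  moreover have "finite B" using B(4) by (rule finiteI_independent)
  ultimately obtain e where e: "bij_betw e (UNIV :: 'd set) B" using finite_same_card_bij[OF finite_class.finite_UNIV] by blast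
  have "\<forall>i. \<exists>q. e i = ?J q" using e B(1) unfolding bij_betw_def by blast
  then obtain q where q: "\<And>i. e i = ?J (q i)" by metis
  define L where "L v = (\<Sum>i\<in>UNIV. v $ i *\<^sub>R q i)" for v :: "real ^ 'd"
  have lL: "linear L"
    by (rule linearI) (simp_all add: L_def scaleR_add_left sum.distrib scaleR_sum_right)
  have L_axis: "L (axis i 1) = q i" for i
    unfolding L_def by (simp add: axis_def if_distrib[of "\<lambda>x. x *\<^sub>R _"] cong: if_cong)
  have ee: "e i \<bullet> e j = (if i = j then 1 else 0)" for i j
  proof (cases "i = j")
    case True
    have "norm (e j) = 1" using B(3) e unfolding bij_betw_def by blast
    then show ?thesis using True by (simp add: norm_eq_1)
  next
    case False
    then have "e i \<noteq> e j" using e unfolding bij_betw_def inj_on_def by blast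
    moreover have "e i \<in> B" "e j \<in> B" using e unfolding bij_betw_def by blast+
    ultimately show ?thesis using B(2) False by (auto simp: pairwise_def orthogonal_def)
  qed
  have "inj L"
  proof (rule linear_injective_0[OF lL, THEN iffD2], intro allI impI)
    fix v assume "L v = 0"
    then have "0 = ?J (L v)" using linear_0[OF lin] by simp
    also have "\<dots> = (\<Sum>i\<in>UNIV. v $ i *\<^sub>R e i)" unfolding L_def q by (simp add: linear_sum[OF lin] linear_scale[OF lin])
    finally have "(\<Sum>i\<in>UNIV. v $ i *\<^sub>R e i) \<bullet> e j = 0" for j by simp
    then show "v = 0"
      by (simp add: inner_sum_left ee if_distrib[where f = "\<lambda>x. _ * x"] vec_eq_iff cong: if_cong)
  qed
  note R = local_param_reparametrize[OF lp lL this, where a = a]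
  have 0: "0 \<in> {v. a + L v \<in> U}" using a linear_0[OF lL] by simp
  show thesis
  proof (rule that[OF R(1) 0])
    show "\<psi> (a + L 0) = \<psi> a" using linear_0[OF lL] by simp
    show "frechet_derivative (\<lambda>v. \<psi> (a + L v)) (at 0) (axis i 1) \<bullet> frechet_derivative (\<lambda>v. \<psi> (a + L v)) (at 0) (axis j 1) = (if i = j then 1 else 0)" for i j
      unfolding R(2)[OF 0] L_axis linear_0[OF lL] by (simp add: q[symmetric] ee)
  qed
qed

section \<open>Gaussian weights, their normalisation and tails\<close>

lemma gauss_weight_pos: "gauss_weight h c y > 0"
  by (simp add: gauss_weight_def)

lemma continuous_on_gauss_weight: "continuous_on S (gauss_weight h c)"
  unfolding gauss_weight_def[abs_def] divide_inverse by (intro continuous_intros)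

lemma gauss_weight_mono:
  assumes "h > 0" "norm (c - y) \<le> R"
  shows "exp (- R\<^sup>2 / (2 * h)) \<le> gauss_weight h c y"
  unfolding gauss_weight_def using assms by (auto intro!: divide_right_mono power_mono)

lemma gauss_weight_antimono:
  assumes "h > 0" "0 \<le> R" "R \<le> norm (c - y)"
  shows "gauss_weight h c y \<le> exp (- R\<^sup>2 / (2 * h))"
  unfolding gauss_weight_def using assms by (auto intro!: divide_right_mono power_mono)

lemma exp_inverse_tendsto:
  fixes h :: "nat \<Rightarrow> real"
  assumes h: "\<And>n. h n > 0" "h \<longlonglongrightarrow> 0" and k: "k > 0"
  shows "(\<lambda>n. exp (- k / h n) / h n) \<longlonglongrightarrow> 0"
proof -
  have "filterlim (\<lambda>n. inverse (h n)) at_top sequentially"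
    using h by (intro filterlim_inverse_at_top) (auto intro: always_eventually)
  then have top: "filterlim (\<lambda>n. k * inverse (h n)) at_top sequentially"
    by (rule filterlim_tendsto_pos_mult_at_top[OF tendsto_const k])
  from filterlim_compose[OF tendsto_power_div_exp_0[of 1] top]
  have "(\<lambda>n. k * inverse (h n) / exp (k * inverse (h n))) \<longlonglongrightarrow> 0" by simp
  from tendsto_mult_left[OF this, of "1 / k"]
  show ?thesis using k by (simp add: exp_minus field_simps)
qed

context riemannian_volume
begin

definition gauss_norm :: "real \<Rightarrow> 'a \<Rightarrow> real" where
  "gauss_norm h c = (\<integral>y. gauss_weight h c y \<partial>vol)"

lemma measure_ball_pos: "z \<in> M \<Longrightarrow> \<delta> > 0 \<Longrightarrow> measure vol (M \<inter> ball z \<delta>) > 0"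
  using emeasure_ball_pos[of z \<delta>] emeasure_eq_measure[of "M \<inter> ball z \<delta>"] by simp

lemma integrable_gauss: "continuous_on M f \<Longrightarrow> integrable vol (\<lambda>y. gauss_weight h c y * f y)"
  by (intro integrable_continuous continuous_intros continuous_on_gauss_weight)

lemma integrable_gauss': "integrable vol (gauss_weight h c)"
  by (intro integrable_continuous continuous_on_gauss_weight)

lemma gauss_norm_lower:
  assumes h: "h > 0" and R: "\<And>y. y \<in> M \<Longrightarrow> norm (y - z) < \<delta> \<Longrightarrow> norm (c - y) \<le> R"
  shows "exp (- R\<^sup>2 / (2 * h)) * measure vol (M \<inter> ball z \<delta>) \<le> gauss_norm h c"
proof -
  have "exp (- R\<^sup>2 / (2 * h)) * measure vol (M \<inter> ball z \<delta>) = (\<integral>y. exp (- R\<^sup>2 / (2 * h)) * indicator (M \<inter> ball z \<delta>) y \<partial>vol)"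
    by (simp add: space_vol Int_commute Int_left_commute)
  also have "\<dots> \<le> (\<integral>y. gauss_weight h c y \<partial>vol)"
  proof (rule integral_mono)
    show "integrable vol (\<lambda>y. exp (- R\<^sup>2 / (2 * h)) * indicator (M \<inter> ball z \<delta>) y :: real)"
      by (intro integrable_mult_right integrable_real_indicator sets_open) (auto simp: emeasure_eq_measure)
    show "exp (- R\<^sup>2 / (2 * h)) * indicator (M \<inter> ball z \<delta>) y \<le> gauss_weight h c y" if "y \<in> space vol" for y
      using gauss_weight_mono[OF h R, of y] gauss_weight_pos[of h c y] that
      by (auto simp: indicator_def space_vol dist_norm norm_minus_commute less_imp_le)
  qed (rule integrable_gauss')
  finally show ?thesis by (simp add: gauss_norm_def)
qed

lemma gauss_norm_pos:
  assumes "h > 0" "z \<in> M"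
  shows "gauss_norm h c > 0"
proof -
  have "norm (c - y) \<le> norm (c - z) + 1" if "norm (y - z) < 1" for y
    using norm_triangle_ineq4[of "c - z" "y - z"] that by simp
  from gauss_norm_lower[OF assms(1) this]
  have "exp (- (norm (c - z) + 1)\<^sup>2 / (2 * h)) * measure vol (M \<inter> ball z 1) \<le> gauss_norm h c" by blast
  moreover have "0 < exp (- (norm (c - z) + 1)\<^sup>2 / (2 * h)) * measure vol (M \<inter> ball z 1)"
    using measure_ball_pos[OF assms(2), of 1] by (intro mult_pos_pos) auto
  ultimately show ?thesis by linarith
qed

lemma gauss_tail_integrable: "integrable vol (\<lambda>y. indicator {y. \<delta> \<le> norm (y - z)} y * gauss_weight h c y)"
proof -
  have "{y \<in> space vol. \<delta> \<le> norm (y - z)} \<in> sets vol"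
  proof -
    have "{y \<in> space vol. \<delta> \<le> norm (y - z)} = M - (M \<inter> ball z \<delta>)"
      by (auto simp: space_vol dist_norm norm_minus_commute)
    also have "\<dots> \<in> sets vol" using sets.compl_sets[OF sets_open[of "ball z \<delta>"]] by (simp add: space_vol)
    finally show ?thesis .
  qed
  then have "integrable vol (\<lambda>y. indicator {y \<in> space vol. \<delta> \<le> norm (y - z)} y *\<^sub>R gauss_weight h c y)"
    by (rule integrable_mult_indicator[OF _ integrable_gauss'])
  then show ?thesis
    by (rule Bochner_Integration.integrable_cong[THEN iffD1, OF refl, rotated]) (auto simp: indicator_def)
qed

text \<open>Once the shift is below \<open>\<delta> / 4\<close>, tail points are at least
  \<open>3 / 4 * \<delta>\<close> from the centre of the Gaussian, while points within
  \<open>\<delta> / 4\<close> of \<open>z n\<close> are within \<open>\<delta> / 2\<close> of the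
  centre and alone bound the normalisation from below. The quotient decays like
  \<open>exp (- k / h n)\<close>, which beats \<open>1 / h n\<close>.\<close>

lemma gauss_tail:
  assumes z: "\<And>n. z n \<in> M" "z \<longlonglongrightarrow> z0" "z0 \<in> M" and h: "\<And>n. h n > 0" "h \<longlonglongrightarrow> 0"
    and \<alpha>: "(\<lambda>n. \<alpha> n /\<^sub>R h n) \<longlonglongrightarrow> \<omega>" and \<delta>: "\<delta> > 0"
  shows "(\<lambda>n. (\<integral>y. indicator {y. \<delta> \<le> norm (y - z n)} y * gauss_weight (h n) (z n - \<alpha> n) y \<partial>vol)
     / gauss_norm (h n) (z n - \<alpha> n) / h n) \<longlonglongrightarrow> 0"
    (is "(\<lambda>n. ?T n / ?Z n / h n) \<longlonglongrightarrow> 0")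
proof -
  have "(\<lambda>n. h n *\<^sub>R (\<alpha> n /\<^sub>R h n)) \<longlonglongrightarrow> 0 *\<^sub>R \<omega>" by (intro tendsto_intros h \<alpha>)
  then have \<alpha>0: "\<alpha> \<longlonglongrightarrow> 0" using h(1) by (simp add: less_imp_neq[symmetric])
  \<comment> \<open>The ball is centred at the limit point, so its mass does not depend on
    \<open>n\<close>; eventually it lies in the ball of radius \<open>\<delta> / 4\<close> around
    \<open>z n\<close>.\<close>
  define m where "m = measure vol (M \<inter> ball z0 (\<delta> / 8))"
  have m: "m > 0" unfolding m_def using z(3) \<delta> by (intro measure_ball_pos) auto
  \<comment> \<open>The two exponents differ by (9/16 - 1/4) / 2 = 5/32 times the square of
    \<open>\<delta>\<close>, divided by \<open>h n\<close>.\<close>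
  define k where "k = 5 / 32 * \<delta>\<^sup>2"
  have k: "k > 0" using \<delta> by (simp add: k_def)
  have ev: "\<forall>\<^sub>F n in sequentially. norm (\<alpha> n) < \<delta> / 4 \<and> dist (z n) z0 < \<delta> / 8"
    using tendstoD[OF \<alpha>0, of "\<delta> / 4"] tendstoD[OF z(2), of "\<delta> / 8"] \<delta> by (auto intro: eventually_conj simp: dist_norm)
  have Zpos: "?Z n > 0" for n using gauss_norm_pos[OF h(1) z(1)] .
  have "\<forall>\<^sub>F n in sequentially. norm (?T n / ?Z n / h n) \<le> (measure vol M / m) * (exp (- k / h n) / h n)"
    using ev
  proof eventually_elim
    case (elim n)
    let ?c = "z n - \<alpha> n"
    have T: "?T n \<le> measure vol M * exp (- (3 / 4 * \<delta>)\<^sup>2 / (2 * h n))"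
    proof -
      have "?T n \<le> (\<integral>y. exp (- (3 / 4 * \<delta>)\<^sup>2 / (2 * h n)) \<partial>vol)"
      proof (rule integral_mono[OF gauss_tail_integrable])
        fix y
        show "indicator {y. \<delta> \<le> norm (y - z n)} y * gauss_weight (h n) ?c y \<le> exp (- (3 / 4 * \<delta>)\<^sup>2 / (2 * h n))"
        proof (cases "\<delta> \<le> norm (y - z n)")
          case True
          have "norm (y - z n) \<le> norm (?c - y) + norm (\<alpha> n)"
            using norm_triangle_ineq4[of "y - ?c" "\<alpha> n"] by (simp add: norm_minus_commute[of y ?c])
          then have "3 / 4 * \<delta> \<le> norm (?c - y)" using True elim by linarith
          have "gauss_weight (h n) ?c y \<le> exp (- (3 / 4 * \<delta>)\<^sup>2 / (2 * h n))"
            by (rule gauss_weight_antimono[OF h(1) _ \<open>3 / 4 * \<delta> \<le> norm (?c - y)\<close>]) (use \<delta> in simp)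
          then show ?thesis using True by simp
        qed simp
      qed simp
      also have "\<dots> = measure vol M * exp (- (3 / 4 * \<delta>)\<^sup>2 / (2 * h n))" by (simp add: space_vol)
      finally show ?thesis .
    qed
    have "m \<le> measure vol (M \<inter> ball (z n) (\<delta> / 4))"
      unfolding m_def
    proof (intro finite_measure_mono sets_open)
      show "M \<inter> ball z0 (\<delta> / 8) \<subseteq> M \<inter> ball (z n) (\<delta> / 4)"
      proof
        fix y assume "y \<in> M \<inter> ball z0 (\<delta> / 8)"
        then show "y \<in> M \<inter> ball (z n) (\<delta> / 4)" using elim dist_triangle[of "z n" y z0] by auto
      qed
    qed auto
    then have "exp (- (\<delta> / 2)\<^sup>2 / (2 * h n)) * m \<le> exp (- (\<delta> / 2)\<^sup>2 / (2 * h n)) * measure vol (M \<inter> ball (z n) (\<delta> / 4))"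
      by (intro mult_left_mono) auto
    also have "\<dots> \<le> ?Z n"
    proof (rule gauss_norm_lower[OF h(1)])
      fix y assume "norm (y - z n) < \<delta> / 4"
      then show "norm (?c - y) \<le> \<delta> / 2"
        using norm_triangle_ineq4[of "z n - y" "\<alpha> n"] elim by (simp add: algebra_simps norm_minus_commute)
    qed
    finally have Zl: "exp (- (\<delta> / 2)\<^sup>2 / (2 * h n)) * m \<le> ?Z n" .
    have T0: "0 \<le> ?T n" using gauss_weight_pos[of "h n" ?c] by (intro integral_nonneg_AE AE_I2) (simp add: less_imp_le)
    have "?T n / ?Z n \<le> (measure vol M * exp (- (3 / 4 * \<delta>)\<^sup>2 / (2 * h n))) / (exp (- (\<delta> / 2)\<^sup>2 / (2 * h n)) * m)"
      using T Zl m T0 by (intro frac_le) auto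
    also have "\<dots> = (measure vol M / m) * exp (- k / h n)"
    proof -
      have "exp (- (3 / 4 * \<delta>)\<^sup>2 / (2 * h n)) = exp (- k / h n) * exp (- (\<delta> / 2)\<^sup>2 / (2 * h n))"
        unfolding k_def exp_add[symmetric] using h(1)[of n] by (simp add: field_simps power2_eq_square)
      then show ?thesis by simp
    qed
    finally have "?T n / ?Z n / h n \<le> (measure vol M / m) * exp (- k / h n) / h n"
      using h(1)[of n] by (intro divide_right_mono) auto
    moreover have "0 \<le> ?T n / ?Z n / h n" using T0 Zpos[of n] h(1)[of n] by simp
    ultimately show ?case by simp
  qed
  moreover have "(\<lambda>n. (measure vol M / m) * (exp (- k / h n) / h n)) \<longlonglongrightarrow> 0"
    using tendsto_mult_left[OF exp_inverse_tendsto[OF h k], of "measure vol M / m"] by simp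
  ultimately show ?thesis by (rule Lim_null_comparison)
qed

section \<open>The generator of the averaging kernels\<close>

text \<open>The centre \<open>c\<close> ranges over the ambient space: it will be a base point
  displaced by an increment of \<open>\<phi>\<close>, which need not lie on
  \<open>M\<close>.\<close>

definition kern_avg :: "real \<Rightarrow> 'a \<Rightarrow> ('a \<Rightarrow> real) \<Rightarrow> real" where
  "kern_avg h c f = (\<integral>y. gauss_weight h c y * f y \<partial>vol) / gauss_norm h c"

lemma integral_gauss_param:
  fixes U :: "(real ^ 'd) set"
  assumes lp: "local_param M U \<psi>" and C: "compact C" "C \<subseteq> U" and f: "continuous_on M f"
  shows "(\<integral>y. indicator (\<psi> ` C) y * (gauss_weight h c y * f y) \<partial>vol) =
     (\<integral>u. indicator C u * (gauss_weight h c (\<psi> u) * f (\<psi> u) * vol_density \<psi> u) \<partial>lborel)"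
proof (rule integral_param[OF lp _ C(2)])
  show Cb: "C \<in> sets borel" using C by (simp add: borel_compact)
  have "continuous_on C \<psi>"
    using Ck_on_continuous_on[OF local_param_smooth[OF lp]] continuous_on_subset[OF _ C(2)] by blast
  moreover have "\<psi> ` C \<subseteq> M" using local_param_subset[OF lp] C(2) by blast
  ultimately have "continuous_on C (\<lambda>u. gauss_weight h c (\<psi> u) * f (\<psi> u))"
    by (intro continuous_intros continuous_on_compose2[OF continuous_on_gauss_weight[of UNIV]] continuous_on_compose2[OF f]) auto
  from borel_measurable_continuous_on_indicator[OF Cb this]
  show "(\<lambda>u. indicator C u * (gauss_weight h c (\<psi> u) * f (\<psi> u))) \<in> borel_measurable borel" by simp
qed

text \<open>Mass outside the chart ball is a Gaussian tail, negligible even after division by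
  \<open>h\<close>; this puts the averages into the locale \<open>chart_kernels\<close>. The limit
  found there is the generator because the second derivatives of \<open>u \<circ> \<psi>\<close>,
  corrected by those of \<open>\<psi>\<close> along the gradient, sum to minus the
  Laplacian.\<close>

lemma kernel_limit_chart:
  fixes U :: "(real ^ 'd) set" and a :: "nat \<Rightarrow> real ^ 'd"
  assumes lp: "local_param M U \<psi>" and a0: "a0 \<in> U"
    and orth: "\<And>i j. frechet_derivative \<psi> (at a0) (axis i 1) \<bullet> frechet_derivative \<psi> (at a0) (axis j 1) = (if i = j then 1 else 0)"
    and \<rho>: "\<rho> > 0" "cball a0 (2 * \<rho>) \<subseteq> U"
      "\<And>b v. b \<in> cball a0 (2 * \<rho>) \<Longrightarrow> norm (frechet_derivative \<psi> (at b) v - frechet_derivative \<psi> (at a0) v) \<le> norm v / 4"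
    and a: "a \<longlonglongrightarrow> a0" "\<And>n. a n \<in> cball a0 \<rho>"
    and h: "\<And>n. h n > 0" "h \<longlonglongrightarrow> 0" and \<alpha>: "(\<lambda>n. \<alpha> n /\<^sub>R h n) \<longlonglongrightarrow> \<omega>"
    and f: "\<And>n. continuous_on M (f n)" "\<And>n y. y \<in> M \<Longrightarrow> \<bar>f n y\<bar> \<le> C" "\<And>n. Ck_on 2 U (f n \<circ> \<psi>)"
    and u: "Ck_on 2 U (u \<circ> \<psi>)"
    and D: "\<And>k. (\<lambda>n. frechet_derivative (f n \<circ> \<psi>) (at (a n)) (axis k 1)) \<longlonglongrightarrow> frechet_derivative (u \<circ> \<psi>) (at a0) (axis k 1)"
    and D2: "\<And>i j. ((\<lambda>x. frechet_derivative (\<lambda>b. frechet_derivative (f (fst x) \<circ> \<psi>) (at b) (axis i 1)) (at (snd x)) (axis j 1)) \<longlongrightarrow>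
       frechet_derivative (\<lambda>b. frechet_derivative (u \<circ> \<psi>) (at b) (axis i 1)) (at a0) (axis j 1)) (sequentially \<times>\<^sub>F nhds a0)"
  shows "(\<lambda>n. (kern_avg (h n) (\<psi> (a n) - \<alpha> n) (f n) - f n (\<psi> (a n))) / h n) \<longlonglongrightarrow>
     - (\<omega> \<bullet> mgrad M u (\<psi> a0)) - 1 / 2 * laplace_beltrami M u (\<psi> a0)"
proof -
  interpret NC: normal_chart a a0 U \<psi> \<rho>
    by unfold_locales (use lp a \<rho> orth local_param_smooth[OF lp] local_param_open[OF lp] in auto)
  define z where "z n = \<psi> (a n)" for n
  define c where "c n = z n - \<alpha> n" for n
  define Z where "Z n = gauss_norm (h n) (c n)" for n
  define G where "G n = gauss_weight (h n) (c n)" for n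
  define K where "K n = cball (a n) \<rho>" for n
  have KU: "K n \<subseteq> U" for n unfolding K_def by (rule NC.Kn_U)
  have zM: "z n \<in> M" for n unfolding z_def using NC.a_U[of n] local_param_subset[OF lp] by blast
  have z0M: "\<psi> a0 \<in> M" using a0 local_param_subset[OF lp] by blast
  have \<psi>c: "continuous_on U \<psi>" using Ck_on_continuous_on[OF local_param_smooth[OF lp]] by blast
  have zlim: "z \<longlonglongrightarrow> \<psi> a0"
    unfolding z_def
    by (rule filterlim_compose[OF continuous_on_open_tendsto_nhds[OF local_param_open[OF lp] a0 \<psi>c] a(1)])
  have Zpos: "Z n > 0" for n unfolding Z_def using gauss_norm_pos[OF h(1) zM] .
  have Gpos: "G n y > 0" for n y unfolding G_def by (rule gauss_weight_pos)
  define T where "T \<delta> n = (\<integral>y. indicator {y. \<delta> \<le> norm (y - z n)} y * G n y \<partial>vol)" for \<delta> n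
  have Tint: "integrable vol (\<lambda>y. indicator {y. \<delta> \<le> norm (y - z n)} y * G n y)" for \<delta> n
    unfolding G_def by (rule gauss_tail_integrable)
  have tail: "(\<lambda>n. T \<delta> n / Z n / h n) \<longlonglongrightarrow> 0" if "\<delta> > 0" for \<delta>
    unfolding T_def Z_def c_def G_def by (rule gauss_tail[OF zM zlim z0M h \<alpha> that])
  define J where "J n g = (\<integral>b. indicator (cball (a n) \<rho>) b * (g b * (gauss_weight (h n) (\<psi> (a n) - \<alpha> n) (\<psi> b) * vol_density \<psi> b)) \<partial>lborel) / Z n" for n g
  have J_param: "J n (\<lambda>b. indicator B b * g (\<psi> b)) = (\<integral>y. indicator (\<psi> ` (K n \<inter> B)) y * (G n y * g y) \<partial>vol) / Z n"
    if "continuous_on M g" "closed B" for n g B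
  proof -
    have "compact (K n \<inter> B)" using that(2) by (simp add: K_def compact_Int_closed)
    then show ?thesis unfolding J_def G_def
      using KU[of n] by (subst integral_gauss_param[OF lp _ _ that(1)])
        (auto simp: K_def c_def z_def indicator_def intro!: arg_cong2[where f = "(/)"] Bochner_Integration.integral_cong)
  qed
  have J_param': "J n (\<lambda>b. g (\<psi> b)) = (\<integral>y. indicator (\<psi> ` K n) y * (G n y * g y) \<partial>vol) / Z n"
    if "continuous_on M g" for n g using J_param[OF that closed_UNIV, of n] by simp
  have Gint: "integrable vol (\<lambda>y. G n y * g y)" if "continuous_on M g" for n g
    unfolding G_def by (rule integrable_gauss[OF that])
  have setsK: "\<psi> ` (K n \<inter> B) \<in> sets vol" if "closed B" for n B
    using KU[of n] that by (intro param_image_sets[OF lp]) (auto simp: K_def)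
  have setsK': "\<psi> ` K n \<in> sets vol" for n using setsK[of UNIV n] by simp
  have Gint': "integrable vol (\<lambda>y. indicator A y * (G n y * g y))" if "continuous_on M g" "A \<in> sets vol" for n g A
    using integrable_mult_indicator[OF that(2) Gint[OF that(1), of n]] by simp
  have ZG: "Z n = (\<integral>y. G n y * 1 \<partial>vol)" for n by (simp add: Z_def G_def gauss_norm_def)
  \<comment> \<open>The radius is uniform in \<open>n\<close>: the image of the ball of radius
    \<open>\<rho> / 2\<close> around \<open>a0\<close> is relatively open, and this ball is
    contained in \<open>K n\<close> for all late \<open>n\<close>.\<close>
  obtain \<delta>0 where \<delta>0: "\<delta>0 > 0" "\<forall>\<^sub>F n in sequentially. \<forall>y\<in>M. norm (y - z n) < \<delta>0 \<longrightarrow> y \<in> \<psi> ` K n"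
  proof -
    obtain \<xi> where \<xi>: "homeomorphism U (\<psi> ` U) \<psi> \<xi>" using lp by (auto simp: local_param_def)
    have bU: "ball a0 (\<rho> / 2) \<subseteq> U" using \<rho>(1,2) by auto
    then have "openin (top_of_set U) (ball a0 (\<rho> / 2))" by (simp add: openin_open_eq local_param_open[OF lp])
    then have "openin (top_of_set (\<psi> ` U)) (\<psi> ` ball a0 (\<rho> / 2))" using homeomorphism_imp_open_map[OF \<xi>] by blast
    then have "openin (top_of_set M) (\<psi> ` ball a0 (\<rho> / 2))" using lp openin_trans unfolding local_param_def by blast
    then obtain V where V: "open V" "\<psi> ` ball a0 (\<rho> / 2) = M \<inter> V" unfolding openin_open by blast
    have "\<psi> a0 \<in> V" using V(2) \<rho>(1) by auto
    then obtain e where e: "e > 0" "ball (\<psi> a0) e \<subseteq> V" using V(1) openE by blast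
    have "\<forall>\<^sub>F n in sequentially. dist (z n) (\<psi> a0) < e / 2 \<and> dist (a n) a0 < \<rho> / 2"
      using tendstoD[OF zlim, of "e / 2"] tendstoD[OF a(1), of "\<rho> / 2"] e(1) \<rho>(1) by (auto intro: eventually_conj)
    then have "\<forall>\<^sub>F n in sequentially. \<forall>y\<in>M. norm (y - z n) < e / 2 \<longrightarrow> y \<in> \<psi> ` K n"
    proof eventually_elim
      case (elim n)
      show ?case
      proof (intro ballI impI)
        fix y assume y: "y \<in> M" "norm (y - z n) < e / 2"
        have "dist (\<psi> a0) y < e" using y(2) elim dist_triangle[of "\<psi> a0" y "z n"] by (simp add: dist_norm norm_minus_commute)
        then have "y \<in> V" using e(2) by auto
        then obtain b where b: "b \<in> ball a0 (\<rho> / 2)" "y = \<psi> b" using V(2) y(1) by blast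
        have "dist (a n) b \<le> \<rho>" using b(1) elim dist_triangle[of "a n" b a0] by (simp add: dist_commute)
        then show "y \<in> \<psi> ` K n" using b(2) by (auto simp: K_def)
      qed
    qed
    then show thesis using that e(1) by (meson half_gt_zero)
  qed
  have out: "\<forall>\<^sub>F n in sequentially. \<bar>(\<integral>y. G n y * g n y \<partial>vol) / Z n - J n (\<lambda>b. g n (\<psi> b))\<bar> \<le> B * (T \<delta>0 n / Z n)"
    if g: "\<And>n. continuous_on M (g n)" "\<And>n y. y \<in> M \<Longrightarrow> \<bar>g n y\<bar> \<le> B" for g B
    using \<delta>0(2)
  proof eventually_elim
    case (elim n)
    have "(\<integral>y. G n y * g n y \<partial>vol) / Z n - J n (\<lambda>b. g n (\<psi> b)) =
       (\<integral>y. G n y * g n y - indicator (\<psi> ` K n) y * (G n y * g n y) \<partial>vol) / Z n"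
      unfolding J_param'[OF g(1)]
      by (simp add: Bochner_Integration.integral_diff[OF Gint Gint'] g setsK' diff_divide_distrib)
    also have "\<bar>\<dots>\<bar> \<le> (B * T \<delta>0 n) / Z n"
      unfolding abs_divide abs_of_pos[OF Zpos]
    proof (intro divide_right_mono less_imp_le[OF Zpos])
      have "\<bar>\<integral>y. G n y * g n y - indicator (\<psi> ` K n) y * (G n y * g n y) \<partial>vol\<bar> \<le>
          (\<integral>y. \<bar>G n y * g n y - indicator (\<psi> ` K n) y * (G n y * g n y)\<bar> \<partial>vol)"
        by (rule integral_abs_bound)
      also have "\<dots> \<le> (\<integral>y. B * (indicator {y. \<delta>0 \<le> norm (y - z n)} y * G n y) \<partial>vol)"
      proof (rule integral_mono)
        show "integrable vol (\<lambda>y. \<bar>G n y * g n y - indicator (\<psi> ` K n) y * (G n y * g n y)\<bar>)"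
          by (intro integrable_abs Bochner_Integration.integrable_diff Gint Gint' g setsK')
        show "integrable vol (\<lambda>y. B * (indicator {y. \<delta>0 \<le> norm (y - z n)} y * G n y))"
          by (intro integrable_mult_right Tint)
        fix y assume "y \<in> space vol"
        then have y: "y \<in> M" by (simp add: space_vol)
        have B0: "0 \<le> B" using g(2)[OF y, of n] by linarith
        show "\<bar>G n y * g n y - indicator (\<psi> ` K n) y * (G n y * g n y)\<bar> \<le> B * (indicator {y. \<delta>0 \<le> norm (y - z n)} y * G n y)"
        proof (cases "y \<in> \<psi> ` K n")
          case True
          then show ?thesis using B0 less_imp_le[OF Gpos[of n y]] by simp
        next
          case False
          then have "\<delta>0 \<le> norm (y - z n)" using elim y by force
          then show ?thesis using False g(2)[OF y, of n] Gpos[of n y] by (simp add: abs_mult mult.commute[of _ "G n y"])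
        qed
      qed
      also have "\<dots> = B * T \<delta>0 n" unfolding T_def by simp
      finally show "\<bar>\<integral>y. G n y * g n y - indicator (\<psi> ` K n) y * (G n y * g n y) \<partial>vol\<bar> \<le> B * T \<delta>0 n" .
    qed
    finally show ?case by simp
  qed
  have tail': "(\<lambda>n. T \<delta> n / Z n) \<longlonglongrightarrow> 0" if "\<delta> > 0" for \<delta>
  proof -
    have "(\<lambda>n. T \<delta> n / Z n / h n * h n) \<longlonglongrightarrow> 0 * 0" by (intro tendsto_intros tail that h)
    then show ?thesis using h(1) by (simp add: less_imp_neq[symmetric])
  qed
  interpret CK: chart_kernels a a0 U \<psi> \<rho> "vol_density \<psi>" h Z \<alpha> \<omega> J
  proof unfold_locales
    show "Ck_on 1 U (vol_density \<psi>)" by (rule Ck_on_vol_density[OF lp])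
    show "b \<in> U \<Longrightarrow> vol_density \<psi> b > 0" for b by (rule vol_density_pos[OF lp])
    show "J n (\<lambda>_. 1) \<le> 1" for n
    proof -
      have "(\<integral>y. indicator (\<psi> ` K n) y * (G n y * 1) \<partial>vol) \<le> Z n"
        unfolding ZG using less_imp_le[OF Gpos[of n]]
        by (intro integral_mono Gint Gint' setsK' continuous_on_const) (auto simp: indicator_def)
      then show ?thesis using J_param'[OF continuous_on_const, of n 1] Zpos[of n] by simp
    qed
    show "(\<lambda>n. J n (\<lambda>_. 1)) \<longlonglongrightarrow> 1"
    proof -
      have "\<forall>\<^sub>F n in sequentially. \<bar>(\<integral>y. G n y * 1 \<partial>vol) / Z n - J n (\<lambda>_. 1)\<bar> \<le> 1 * (T \<delta>0 n / Z n)"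
        by (rule out) auto
      then have "\<forall>\<^sub>F n in sequentially. norm (J n (\<lambda>_. 1) - 1) \<le> T \<delta>0 n / Z n"
      proof eventually_elim
        case (elim n)
        then show ?case unfolding ZG[symmetric] using Zpos[of n] by (simp add: abs_minus_commute)
      qed
      from Lim_null_comparison[OF this tail'[OF \<delta>0(1)]] show ?thesis by (simp add: LIM_zero_iff)
    qed
    fix \<delta> :: real assume \<delta>: "\<delta> > 0"
    \<comment> \<open>By \<open>X_lower\<close> a parameter distance of \<open>\<delta>\<close>
      means an ambient distance of at least \<open>3/4 * \<delta>\<close>, so the parameter tail is
      dominated by an ambient one.\<close>
    have "\<forall>\<^sub>F n in sequentially. norm (J n (indicator (- ball (a n) \<delta>)) / h n) \<le> T (3/4 * \<delta>) n / Z n / h n"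
    proof (rule always_eventually, rule allI)
      fix n
      have "J n (indicator (- ball (a n) \<delta>)) = (\<integral>y. indicator (\<psi> ` (K n \<inter> - ball (a n) \<delta>)) y * (G n y * 1) \<partial>vol) / Z n"
        using J_param[OF continuous_on_const[of M "1 :: real"], of "- ball (a n) \<delta>" n] by (simp add: closed_Compl)
      moreover have "(\<integral>y. indicator (\<psi> ` (K n \<inter> - ball (a n) \<delta>)) y * (G n y * 1) \<partial>vol) \<le> T (3/4 * \<delta>) n"
        unfolding T_def
      proof (rule integral_mono)
        show "integrable vol (\<lambda>y. indicator (\<psi> ` (K n \<inter> - ball (a n) \<delta>)) y * (G n y * 1))"
          by (intro Gint' setsK continuous_on_const) (auto simp: closed_Compl)
        fix y
        show "indicator (\<psi> ` (K n \<inter> - ball (a n) \<delta>)) y * (G n y * 1) \<le> indicator {y. 3/4 * \<delta> \<le> norm (y - z n)} y * G n y"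
        proof (cases "y \<in> \<psi> ` (K n \<inter> - ball (a n) \<delta>)")
          case True
          then obtain b where b: "b \<in> cball (a n) \<rho>" "\<delta> \<le> norm (b - a n)" "y = \<psi> b"
            by (auto simp: K_def dist_norm norm_minus_commute)
          have "3/4 * norm (b - a n) \<le> norm (\<psi> b - \<psi> (a n))"
            by (intro NC.X_lower subsetD[OF NC.Kn_sub b(1)] subsetD[OF NC.Kn_sub NC.a_Kn])
          then have "3/4 * \<delta> \<le> norm (y - z n)" using b(2,3) by (simp add: z_def)
          then show ?thesis using True by simp
        next
          case False
          then show ?thesis using less_imp_le[OF Gpos[of n y]] by simp
        qed
      qed (rule Tint)
      moreover have "0 \<le> (\<integral>y. indicator (\<psi> ` (K n \<inter> - ball (a n) \<delta>)) y * (G n y * 1) \<partial>vol)"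
        using less_imp_le[OF Gpos[of n]] by (intro integral_nonneg_AE AE_I2) simp
      ultimately show "norm (J n (indicator (- ball (a n) \<delta>)) / h n) \<le> T (3/4 * \<delta>) n / Z n / h n"
        using Zpos[of n] h(1)[of n] by (simp add: divide_right_mono)
    qed
    from Lim_null_comparison[OF this tail] \<delta> show "(\<lambda>n. J n (indicator (- ball (a n) \<delta>)) / h n) \<longlonglongrightarrow> 0" by simp
  next
    show "frechet_derivative (vol_density \<psi>) (at a0) (axis k 1) / vol_density \<psi> a0 =
       (\<Sum>i\<in>UNIV. frechet_derivative \<psi> (at a0) (axis i 1) \<bullet>
          frechet_derivative (\<lambda>b. frechet_derivative \<psi> (at b) (axis i 1)) (at a0) (axis k 1))" for k
      by (rule vol_density_derivative_orthonormal[OF lp a0 orth])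
  qed (use h \<alpha> Zpos J_def in auto)
  define v where "v k = frechet_derivative (u \<circ> \<psi>) (at a0) (axis k 1)" for k
  define H where "H i j = frechet_derivative (\<lambda>b. frechet_derivative (u \<circ> \<psi>) (at b) (axis i 1)) (at a0) (axis j 1)" for i j
  have main: "(\<lambda>n. J n (\<lambda>b. (f n \<circ> \<psi>) b - (f n \<circ> \<psi>) (a n)) / h n) \<longlonglongrightarrow> (\<Sum>k\<in>UNIV. v k * CK.\<mu> k) + (1/2) * (\<Sum>i\<in>UNIV. H i i)"
  proof (rule CK.generator_limit[where H = H and v = v, OF f(3)])
    show "\<bar>(f n \<circ> \<psi>) b\<bar> \<le> C" if "b \<in> cball (a n) \<rho>" for n b
      using f(2) NC.Kn_U[of n] that local_param_subset[OF lp] by (simp add: image_subset_iff subset_iff)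
    show "((\<lambda>x. frechet_derivative (\<lambda>b. frechet_derivative (f (fst x) \<circ> \<psi>) (at b) (axis i 1)) (at (snd x)) (axis j 1)) \<longlongrightarrow> H i j) NC.F" for i j
      unfolding NC.F_def H_def by (rule D2)
  qed (use D in \<open>simp add: v_def\<close>)
  \<comment> \<open>The constant is subtracted under the integral before localising, since the full
    kernel has mass 1 while \<open>J\<close> has lost the mass outside the chart ball.\<close>
  have "\<forall>\<^sub>F n in sequentially. norm ((kern_avg (h n) (\<psi> (a n) - \<alpha> n) (f n) - f n (\<psi> (a n))) / h n - J n (\<lambda>b. (f n \<circ> \<psi>) b - (f n \<circ> \<psi>) (a n)) / h n) \<le> 2 * C * (T \<delta>0 n / Z n / h n)"
  proof -
    have fb: "\<bar>f n y - f n (z n)\<bar> \<le> 2 * C" if "y \<in> M" for n y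
      using f(2)[OF that, of n] f(2)[OF zM[of n], of n] by linarith
    have "\<forall>\<^sub>F n in sequentially. \<bar>(\<integral>y. G n y * (f n y - f n (z n)) \<partial>vol) / Z n - J n (\<lambda>b. f n (\<psi> b) - f n (z n))\<bar> \<le> 2 * C * (T \<delta>0 n / Z n)"
      using out[of "\<lambda>n y. f n y - f n (z n)" "2 * C"] fb f(1) by (simp add: continuous_on_diff)
    then show ?thesis
    proof eventually_elim
      case (elim n)
      have "(\<integral>y. G n y * (f n y - f n (z n)) \<partial>vol) = (\<integral>y. G n y * f n y - f n (z n) * (G n y * 1) \<partial>vol)"
        by (simp add: algebra_simps)
      also have "\<dots> = (\<integral>y. G n y * f n y \<partial>vol) - f n (z n) * Z n"
        unfolding ZG using Gint[OF f(1)] Gint[OF continuous_on_const[of M 1], of n]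
        by (subst Bochner_Integration.integral_diff) auto
      finally have "(\<integral>y. G n y * (f n y - f n (z n)) \<partial>vol) / Z n = kern_avg (h n) (\<psi> (a n) - \<alpha> n) (f n) - f n (\<psi> (a n))"
        using Zpos[of n] by (simp add: kern_avg_def G_def Z_def c_def z_def diff_divide_distrib)
      with elim have "\<bar>(kern_avg (h n) (\<psi> (a n) - \<alpha> n) (f n) - f n (\<psi> (a n))) - J n (\<lambda>b. f n (\<psi> b) - f n (z n))\<bar> / h n \<le> 2 * C * (T \<delta>0 n / Z n) / h n"
        using h(1)[of n] by (intro divide_right_mono) auto
      then show ?case using h(1)[of n] by (simp add: z_def o_def diff_divide_distrib[symmetric] abs_divide)
    qed
  qed
  from Lim_null_comparison[OF this tendsto_mult_right_zero[OF tail[OF \<delta>0(1)]]]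
  have "(\<lambda>n. (kern_avg (h n) (\<psi> (a n) - \<alpha> n) (f n) - f n (\<psi> (a n))) / h n - J n (\<lambda>b. (f n \<circ> \<psi>) b - (f n \<circ> \<psi>) (a n)) / h n) \<longlonglongrightarrow> 0" .
  from tendsto_add[OF this main]
  have lim: "(\<lambda>n. (kern_avg (h n) (\<psi> (a n) - \<alpha> n) (f n) - f n (\<psi> (a n))) / h n) \<longlonglongrightarrow> (\<Sum>k\<in>UNIV. v k * CK.\<mu> k) + (1/2) * (\<Sum>i\<in>UNIV. H i i)"
    by simp
  \<comment> \<open>The frame at \<open>a0\<close> is orthonormal, so the gradient has the
    coefficients \<open>v k\<close> in it, and sums weighted by \<open>v k\<close> become inner
    products with the gradient.\<close>
  define W where "W = mgrad M u (\<psi> a0)"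
  let ?E = "\<lambda>k. frechet_derivative \<psi> (at a0) (axis k 1)"
  have u2: "Ck_on (Suc 1) U (u \<circ> \<psi>)" using u by (simp add: numeral_2_eq_2)
  note mg = mgrad_chart[OF lp a0 Ck_on_has_derivative[OF u2 a0]]
  have vW: "v k = W \<bullet> ?E k" for k unfolding v_def W_def mg(2) ..
  obtain p where p: "W = frechet_derivative \<psi> (at a0) p" using mg(1) unfolding W_def by blast
  have Wp: "W = (\<Sum>k\<in>UNIV. p $ k *\<^sub>R ?E k)" unfolding p by (rule linear_axis_expansion[OF local_param_linear[OF lp a0]])
  have "W \<bullet> ?E k = p $ k" for k
    unfolding Wp by (simp add: inner_sum_left orth if_distrib[where f = "\<lambda>x. _ * x"] cong: if_cong)
  then have W: "W = (\<Sum>k\<in>UNIV. v k *\<^sub>R ?E k)" using Wp vW by simp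
  let ?D2 = "\<lambda>i. frechet_derivative (\<lambda>b. frechet_derivative \<psi> (at b) (axis i 1)) (at a0) (axis i 1)"
  have dot: "x \<bullet> W = (\<Sum>k\<in>UNIV. v k * (x \<bullet> ?E k))" for x by (simp add: W inner_sum_right)
  have "(\<Sum>k\<in>UNIV. v k * CK.\<mu> k) = (\<Sum>k\<in>UNIV. - (v k * (\<omega> \<bullet> ?E k)) - (1/2) * (\<Sum>i\<in>UNIV. v k * (?D2 i \<bullet> ?E k)))"
    unfolding CK.\<mu>_def by (intro sum.cong refl) (simp add: algebra_simps sum_distrib_left)
  also have "\<dots> = - (\<omega> \<bullet> W) - (1/2) * (\<Sum>k\<in>UNIV. \<Sum>i\<in>UNIV. v k * (?D2 i \<bullet> ?E k))"
    unfolding dot by (simp add: sum_subtractf sum_negf sum_distrib_left)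
  also have "(\<Sum>k\<in>UNIV. \<Sum>i\<in>UNIV. v k * (?D2 i \<bullet> ?E k)) = (\<Sum>i\<in>UNIV. ?D2 i \<bullet> W)"
    unfolding dot by (rule sum.swap)
  finally have "(\<Sum>k\<in>UNIV. v k * CK.\<mu> k) + (1/2) * (\<Sum>i\<in>UNIV. H i i) = - (\<omega> \<bullet> W) + (1/2) * (\<Sum>i\<in>UNIV. H i i - W \<bullet> ?D2 i)"
    by (simp add: sum_subtractf inner_commute right_diff_distrib)
  also have "\<dots> = - (\<omega> \<bullet> mgrad M u (\<psi> a0)) - 1 / 2 * laplace_beltrami M u (\<psi> a0)"
    unfolding laplace_beltrami_chart[OF lp a0 orth u] W_def H_def by simp
  finally show ?thesis using lim by simp
qed

text \<open>Convergence of derivatives is required in every chart because the normalised chart at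
  \<open>z0\<close> is chosen inside the proof. The base points lie in its domain from some index
  \<open>n0\<close> on, and all sequences are shifted by \<open>n0\<close>.\<close>

lemma kernel_limit:
  assumes z: "\<And>n. z n \<in> M" "z \<longlonglongrightarrow> z0" "z0 \<in> M"
    and h: "\<And>n. h n > 0" "h \<longlonglongrightarrow> 0" and \<alpha>: "(\<lambda>n. \<alpha> n /\<^sub>R h n) \<longlonglongrightarrow> \<omega>"
    and f: "\<And>n. continuous_on M (f n)" "\<And>n y. y \<in> M \<Longrightarrow> \<bar>f n y\<bar> \<le> C"
    and f2: "\<And>(U :: (real ^ 'd) set) \<psi> n. local_param M U \<psi> \<Longrightarrow> Ck_on 2 U (f n \<circ> \<psi>)"
    and u2: "\<And>(U :: (real ^ 'd) set) \<psi>. local_param M U \<psi> \<Longrightarrow> Ck_on 2 U (u \<circ> \<psi>)"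
    and D: "\<And>(U :: (real ^ 'd) set) \<psi> a0 v. local_param M U \<psi> \<Longrightarrow> a0 \<in> U \<Longrightarrow>
      ((\<lambda>x. frechet_derivative (f (fst x) \<circ> \<psi>) (at (snd x)) v) \<longlongrightarrow> frechet_derivative (u \<circ> \<psi>) (at a0) v) (sequentially \<times>\<^sub>F nhds a0)"
    and D2: "\<And>(U :: (real ^ 'd) set) \<psi> a0 v w. local_param M U \<psi> \<Longrightarrow> a0 \<in> U \<Longrightarrow>
      ((\<lambda>x. frechet_derivative (\<lambda>b. frechet_derivative (f (fst x) \<circ> \<psi>) (at b) v) (at (snd x)) w) \<longlongrightarrow>
       frechet_derivative (\<lambda>b. frechet_derivative (u \<circ> \<psi>) (at b) v) (at a0) w) (sequentially \<times>\<^sub>F nhds a0)"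
  shows "(\<lambda>n. (kern_avg (h n) (z n - \<alpha> n) (f n) - f n (z n)) / h n) \<longlonglongrightarrow>
     - (\<omega> \<bullet> mgrad M u z0) - 1 / 2 * laplace_beltrami M u z0"
proof -
  obtain U0 :: "(real ^ 'd) set" and \<psi>0 where "local_param M U0 \<psi>0" "z0 \<in> \<psi>0 ` U0"
    using M_submanifold z(3) unfolding embedded_submanifold_def by blast
  then obtain a where a: "local_param M U0 \<psi>0" "a \<in> U0" "z0 = \<psi>0 a" by blast
  obtain U :: "(real ^ 'd) set" and \<psi> where lp: "local_param M U \<psi>" and 0: "0 \<in> U" and \<psi>0: "\<psi> 0 = z0"
    and orth: "\<And>i j. frechet_derivative \<psi> (at 0) (axis i 1) \<bullet> frechet_derivative \<psi> (at 0) (axis j 1) = (if i = j then 1 else 0)"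
    using orthonormal_chart[OF a(1,2)] unfolding a(3) by metis
  obtain \<rho> where \<rho>: "\<rho> > 0" "cball 0 (2 * \<rho>) \<subseteq> U"
    "\<And>b v. b \<in> cball 0 (2 * \<rho>) \<Longrightarrow> norm (frechet_derivative \<psi> (at b) v - frechet_derivative \<psi> (at 0) v) \<le> norm v / 4"
    using local_param_near[OF lp 0] by metis
  obtain \<xi> where \<xi>: "homeomorphism U (\<psi> ` U) \<psi> \<xi>" using lp by (auto simp: local_param_def)
  obtain V where V: "open V" "\<psi> ` U = M \<inter> V" using lp unfolding local_param_def openin_open by blast
  have z0: "z0 \<in> \<psi> ` U" using 0 \<psi>0 by blast
  have ev: "\<forall>\<^sub>F n in sequentially. z n \<in> \<psi> ` U"
    using topological_tendstoD[OF z(2) V(1)] z0 V(2) z(1) by (auto elim: eventually_mono)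
  have "continuous_on (\<psi> ` U) \<xi>" using \<xi> by (simp add: homeomorphism_def)
  from continuous_on_tendsto_compose[OF this z(2) z0 ev]
  have \<xi>z: "(\<lambda>n. \<xi> (z n)) \<longlonglongrightarrow> 0" using homeomorphism_apply1[OF \<xi> 0] \<psi>0 by simp
  have "\<forall>\<^sub>F n in sequentially. z n \<in> \<psi> ` U \<and> dist (\<xi> (z n)) 0 < \<rho>"
    by (rule eventually_conj[OF ev tendstoD[OF \<xi>z \<rho>(1)]])
  then obtain n0 where n0: "\<And>n. n \<ge> n0 \<Longrightarrow> z n \<in> \<psi> ` U \<and> dist (\<xi> (z n)) 0 < \<rho>"
    unfolding eventually_sequentially by blast
  define b where "b n = \<xi> (z (n + n0))" for n
  have \<psi>b: "\<psi> (b n) = z (n + n0)" for n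
    unfolding b_def using homeomorphism_apply2[OF \<xi>] n0[of "n + n0"] by simp
  have blim: "b \<longlonglongrightarrow> 0" unfolding b_def using LIMSEQ_ignore_initial_segment[OF \<xi>z] .
  have shift: "filterlim (\<lambda>x. (fst x + n0, snd x)) (sequentially \<times>\<^sub>F nhds (0 :: real ^ 'd)) (sequentially \<times>\<^sub>F nhds 0)"
    by (intro filterlim_Pair filterlim_compose[OF _ filterlim_fst] filterlim_snd filterlim_add_const_nat_at_top)
  have shift2: "filterlim (\<lambda>n. (n + n0, b n)) (sequentially \<times>\<^sub>F nhds (0 :: real ^ 'd)) sequentially"
    by (intro filterlim_Pair filterlim_add_const_nat_at_top blim)
  have "(\<lambda>n. (kern_avg (h (n + n0)) (\<psi> (b n) - \<alpha> (n + n0)) (f (n + n0)) - f (n + n0) (\<psi> (b n))) / h (n + n0)) \<longlonglongrightarrow>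
     - (\<omega> \<bullet> mgrad M u (\<psi> 0)) - 1 / 2 * laplace_beltrami M u (\<psi> 0)"
  proof (rule kernel_limit_chart[OF lp 0 orth \<rho> blim])
    show "b n \<in> cball 0 \<rho>" for n using n0[of "n + n0"] by (simp add: b_def dist_commute)
    show "(\<lambda>n. h (n + n0)) \<longlonglongrightarrow> 0" "(\<lambda>n. \<alpha> (n + n0) /\<^sub>R h (n + n0)) \<longlonglongrightarrow> \<omega>"
      using LIMSEQ_ignore_initial_segment[OF h(2)] LIMSEQ_ignore_initial_segment[OF \<alpha>] .
    show "(\<lambda>n. frechet_derivative (f (n + n0) \<circ> \<psi>) (at (b n)) (axis k 1)) \<longlonglongrightarrow> frechet_derivative (u \<circ> \<psi>) (at 0) (axis k 1)" for k
      using filterlim_compose[OF D[OF lp 0] shift2] by simp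
    show "((\<lambda>x. frechet_derivative (\<lambda>b. frechet_derivative (f (fst x + n0) \<circ> \<psi>) (at b) (axis i 1)) (at (snd x)) (axis j 1)) \<longlongrightarrow>
       frechet_derivative (\<lambda>b. frechet_derivative (u \<circ> \<psi>) (at b) (axis i 1)) (at 0) (axis j 1)) (sequentially \<times>\<^sub>F nhds 0)" for i j
      using filterlim_compose[OF D2[OF lp 0] shift] by simp
  qed (use h f f2[OF lp] u2[OF lp] in auto)
  then show ?thesis unfolding \<psi>b \<psi>0 by (rule LIMSEQ_offset)
qed

text \<open>By compactness a violation of the estimate would produce a sequence of base points converging
  to one point, so that a single chart suffices.\<close>

lemma backward_consistency:
  fixes \<phi> \<phi>' :: "real \<Rightarrow> 'a"
  assumes t: "0 < t" "t \<le> 1"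
    and \<phi>: "\<And>r. r \<in> {0..1} \<Longrightarrow> (\<phi> has_vector_derivative \<phi>' r) (at r within {0..1})"
    and \<phi>': "continuous_on {0..1} \<phi>'"
    and sol: "backward_solution d M (\<lambda>r f x. \<phi>' r \<bullet> mgrad M f x - 1 / 2 * laplace_beltrami M f x) t f u"
    and \<epsilon>: "\<epsilon> > 0"
  shows "\<exists>\<delta>>0. \<forall>r r' z. 0 \<le> r \<and> r < r' \<and> r' \<le> t \<and> r' - r < \<delta> \<and> z \<in> M \<longrightarrow>
    \<bar>kern_avg (r' - r) (z - (\<phi> r - \<phi> r')) (u r') - u r z\<bar> \<le> \<epsilon> * (r' - r)"
proof (rule ccontr)
  assume not: "\<not> ?thesis"
  have "\<exists>r r' z. 0 \<le> r \<and> r < r' \<and> r' \<le> t \<and> r' - r < inverse (real (Suc n)) \<and> z \<in> M \<and>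
    \<not> \<bar>kern_avg (r' - r) (z - (\<phi> r - \<phi> r')) (u r') - u r z\<bar> \<le> \<epsilon> * (r' - r)" for n
  proof -
    have "inverse (real (Suc n)) > 0" by simp
    with not show ?thesis by blast
  qed
  then obtain r0 r0' z0 where seq: "\<And>n. 0 \<le> r0 n \<and> r0 n < r0' n \<and> r0' n \<le> t \<and> r0' n - r0 n < inverse (real (Suc n)) \<and> z0 n \<in> M \<and>
    \<not> \<bar>kern_avg (r0' n - r0 n) (z0 n - (\<phi> (r0 n) - \<phi> (r0' n))) (u (r0' n)) - u (r0 n) (z0 n)\<bar> \<le> \<epsilon> * (r0' n - r0 n)"
    by metis
  \<comment> \<open>Right end points of the time steps and base points are extracted together; as
    the step length tends to 0, the left end points have the same limit.\<close>
  have "seq_compact ({0..t} \<times> M)" by (intro compact_imp_seq_compact compact_Times M_compact) auto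
  moreover have mem: "\<forall>n. (r0' n, z0 n) \<in> {0..t} \<times> M"
  proof
    fix n show "(r0' n, z0 n) \<in> {0..t} \<times> M" using seq[of n] by auto
  qed
  ultimately obtain l k where lk: "l \<in> {0..t} \<times> M" "strict_mono k" "((\<lambda>n. (r0' n, z0 n)) \<circ> k) \<longlonglongrightarrow> l"
    by (rule seq_compactE)
  obtain R Z where l: "l = (R, Z)" by fastforce
  have R: "R \<in> {0..t}" and Z: "Z \<in> M" using lk(1) l by auto
  define r where "r n = r0 (k n)" for n
  define r' where "r' n = r0' (k n)" for n
  define z where "z n = z0 (k n)" for n
  define h where "h n = r' n - r n" for n
  define \<alpha> where "\<alpha> n = \<phi> (r n) - \<phi> (r' n)" for n
  have S: "0 \<le> r n" "r n < r' n" "r' n \<le> t" "h n < inverse (real (Suc (k n)))" "z n \<in> M"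
    "\<bar>kern_avg (h n) (z n - \<alpha> n) (u (r' n)) - u (r n) (z n)\<bar> > \<epsilon> * h n" for n
    using seq[of "k n"] by (auto simp: r_def r'_def z_def h_def \<alpha>_def not_le)
  have hpos: "h n > 0" for n using S(2)[of n] by (simp add: h_def)
  have r'lim: "r' \<longlonglongrightarrow> R" and zlim: "z \<longlonglongrightarrow> Z"
    using tendsto_fst[OF lk(3)] tendsto_snd[OF lk(3)] by (simp_all add: l o_def r'_def[abs_def] z_def[abs_def])
  have hlim: "h \<longlonglongrightarrow> 0"
  proof (rule tendsto_sandwich[of "\<lambda>_. 0" h _ "\<lambda>n. inverse (real (Suc n))"])
    show "\<forall>\<^sub>F n in sequentially. h n \<le> inverse (real (Suc n))"
    proof (rule always_eventually, rule allI)
      fix n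
      have "inverse (real (Suc (k n))) \<le> inverse (real (Suc n))"
        using strict_mono_imp_increasing[OF lk(2), of n] by (intro le_imp_inverse_le) auto
      then show "h n \<le> inverse (real (Suc n))" using S(4)[of n] by linarith
    qed
    show "\<forall>\<^sub>F n in sequentially. 0 \<le> h n" using hpos by (simp add: less_imp_le)
  qed (rule tendsto_const LIMSEQ_inverse_real_of_nat)+
  have rlim: "r \<longlonglongrightarrow> R"
    using tendsto_diff[OF r'lim hlim] by (simp add: h_def)
  have c12: "C12_on d M t u" using sol by (simp add: backward_solution_def)
  then obtain u' where u': "\<And>s x. s \<in> {0..t} \<Longrightarrow> x \<in> M \<Longrightarrow> ((\<lambda>r. u r x) has_real_derivative u' s x) (at s within {0..t})"
    "continuous_on ({0..t} \<times> M) (\<lambda>(s, x). u' s x)" unfolding C12_on_def by blast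
  have uc: "continuous_on ({0..t} \<times> M) (\<lambda>(s, x). u s x)" using c12 by (simp add: C12_on_def)
  have uM: "continuous_on M (u s)" if "s \<in> {0..t}" for s
  proof -
    have "continuous_on M ((\<lambda>(s, x). u s x) \<circ> (\<lambda>x. (s, x)))"
      by (rule continuous_on_compose[OF _ continuous_on_subset[OF uc]]) (use that in \<open>auto intro!: continuous_intros\<close>)
    then show ?thesis by (simp add: o_def)
  qed
  have r't: "r' n \<in> {0..t}" for n using S(1-3)[of n] by auto
  have "bounded ((\<lambda>(s, x). u s x) ` ({0..t} \<times> M))"
    by (intro compact_imp_bounded compact_continuous_image uc compact_Times M_compact) auto
  then obtain C where C: "\<And>s x. s \<in> {0..t} \<Longrightarrow> x \<in> M \<Longrightarrow> \<bar>u s x\<bar> \<le> C" by (force simp: bounded_iff)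
  have uchart: "Ck_on 2 U (u s \<circ> \<psi>)" if "local_param M U \<psi>" "s \<in> {0..t}" for U :: "(real ^ 'd) set" and \<psi> s
    using c12 that unfolding C12_on_def by blast
  have uD: "continuous_on ({0..t} \<times> U) (\<lambda>(s, a). frechet_derivative (u s \<circ> \<psi>) (at a) v)"
    and uD2: "continuous_on ({0..t} \<times> U) (\<lambda>(s, a). frechet_derivative (\<lambda>b. frechet_derivative (u s \<circ> \<psi>) (at b) v) (at a) w)"
    if "local_param M U \<psi>" for U :: "(real ^ 'd) set" and \<psi> v w
    using c12 that unfolding C12_on_def by blast+
  have joint: "((\<lambda>x. g (r' (fst x)) (snd x)) \<longlongrightarrow> g R a0) (sequentially \<times>\<^sub>F nhds a0)"
    if g: "continuous_on ({0..t} \<times> U) (\<lambda>(s, a). g s a)" and U: "open U" "a0 \<in> U"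
    for g :: "real \<Rightarrow> real ^ 'd \<Rightarrow> real" and U a0
  proof -
    have lim: "((\<lambda>x. (r' (fst x), snd x)) \<longlongrightarrow> (R, a0)) (sequentially \<times>\<^sub>F nhds a0)"
      by (intro tendsto_Pair filterlim_compose[OF r'lim filterlim_fst] filterlim_snd)
    have "\<forall>\<^sub>F x in sequentially \<times>\<^sub>F nhds a0. snd x \<in> U"
      using eventually_nhds_in_open[OF U] filterlim_snd[of "nhds a0" sequentially] unfolding filterlim_iff by blast
    then have ev: "\<forall>\<^sub>F x in sequentially \<times>\<^sub>F nhds a0. (r' (fst x), snd x) \<in> {0..t} \<times> U"
      by eventually_elim (use r't in auto)
    from continuous_on_tendsto_compose[OF g lim _ ev] show ?thesis using R U(2) by simp
  qed
  \<comment> \<open>The shift is minus the increment of \<open>\<phi>\<close> over a step whose two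
    ends both move; uniform continuity of \<open>\<phi>'\<close> controls the difference
    quotient.\<close>
  have \<alpha>lim: "(\<lambda>n. \<alpha> n /\<^sub>R h n) \<longlonglongrightarrow> - \<phi>' R"
  proof -
    have "R \<in> {0..1}" using R t by auto
    have 1: "(\<lambda>n. \<phi>' (r n)) \<longlonglongrightarrow> \<phi>' R"
    proof (rule continuous_on_tendsto_compose[OF \<phi>' rlim \<open>R \<in> {0..1}\<close>])
      show "\<forall>\<^sub>F n in sequentially. r n \<in> {0..1}"
      proof (rule always_eventually, rule allI)
        fix n show "r n \<in> {0..1}" using S(1-3)[of n] t by auto
      qed
    qed
    have "uniformly_continuous_on {0..1} \<phi>'" using \<phi>' by (rule compact_uniformly_continuous) auto
    have 2: "(\<lambda>n. \<alpha> n /\<^sub>R h n + \<phi>' (r n)) \<longlonglongrightarrow> 0"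
    proof (rule tendstoI)
      fix e :: real assume e: "e > 0"
      then obtain \<delta> where \<delta>: "\<delta> > 0" "\<And>x y. x \<in> {0..1} \<Longrightarrow> y \<in> {0..1} \<Longrightarrow> dist y x < \<delta> \<Longrightarrow> dist (\<phi>' y) (\<phi>' x) < e / 2"
        using \<open>uniformly_continuous_on {0..1} \<phi>'\<close> unfolding uniformly_continuous_on_def by (meson half_gt_zero)
      show "\<forall>\<^sub>F n in sequentially. dist (\<alpha> n /\<^sub>R h n + \<phi>' (r n)) 0 < e"
        using order_tendstoD(2)[OF hlim \<delta>(1)]
      proof eventually_elim
        case (elim n)
        have sub: "{r n..r' n} \<subseteq> {0..1}" using S(1-3)[of n] t by auto
        have "norm (\<phi> (r' n) - \<phi> (r n) - (r' n - r n) *\<^sub>R \<phi>' (r n)) \<le> norm (r' n - r n) * (e / 2)"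
        proof (rule vector_differentiable_bound_linearization[where S = "{r n..r' n}"])
          show "(\<phi> has_vector_derivative \<phi>' x) (at x within {r n..r' n})" if "x \<in> {r n..r' n}" for x
            using has_vector_derivative_within_subset[OF \<phi> sub] that sub by blast
          show "norm (\<phi>' x - \<phi>' (r n)) \<le> e / 2" if x: "x \<in> {r n..r' n}" for x
          proof -
            have "dist x (r n) < \<delta>" using x elim by (auto simp: dist_real_def h_def)
            moreover have "r n \<in> {0..1}" "x \<in> {0..1}" using x sub S(2)[of n] by auto
            ultimately show ?thesis using \<delta>(2)[of "r n" x] by (simp add: dist_norm)
          qed
        qed (use S(2)[of n] in \<open>auto simp: closed_segment_eq_real_ivl\<close>)
        also have "\<phi> (r' n) - \<phi> (r n) - (r' n - r n) *\<^sub>R \<phi>' (r n) = - h n *\<^sub>R (\<alpha> n /\<^sub>R h n + \<phi>' (r n))"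
          using hpos[of n] by (simp add: \<alpha>_def h_def[symmetric] scaleR_add_right scaleR_diff_right)
        finally have "h n * norm (\<alpha> n /\<^sub>R h n + \<phi>' (r n)) \<le> h n * (e / 2)" using hpos[of n] by (simp add: h_def[symmetric])
        then have "norm (\<alpha> n /\<^sub>R h n + \<phi>' (r n)) \<le> e / 2" using hpos[of n] by simp
        then show ?case using e by simp
      qed
    qed
    from tendsto_diff[OF 2 1] show ?thesis by simp
  qed
  let ?A = "\<phi>' R \<bullet> mgrad M (u R) Z - 1 / 2 * laplace_beltrami M (u R) Z"
  have "(\<lambda>n. (kern_avg (h n) (z n - \<alpha> n) (u (r' n)) - u (r' n) (z n)) / h n) \<longlonglongrightarrow>
     - (- \<phi>' R \<bullet> mgrad M (u R) Z) - 1 / 2 * laplace_beltrami M (u R) Z"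
  proof (rule kernel_limit[OF S(5) zlim Z hpos hlim \<alpha>lim])
    show "continuous_on M (u (r' n))" for n by (rule uM[OF r't])
    show "\<bar>u (r' n) y\<bar> \<le> C" if "y \<in> M" for n y by (rule C[OF r't that])
    fix U :: "(real ^ 'd) set" and \<psi> assume lp: "local_param M U \<psi>"
    show "Ck_on 2 U (u (r' n) \<circ> \<psi>)" for n by (rule uchart[OF lp r't])
    show "Ck_on 2 U (u R \<circ> \<psi>)" by (rule uchart[OF lp R])
    fix a0 v w assume a0: "a0 \<in> U"
    show "((\<lambda>x. frechet_derivative (u (r' (fst x)) \<circ> \<psi>) (at (snd x)) v) \<longlongrightarrow> frechet_derivative (u R \<circ> \<psi>) (at a0) v) (sequentially \<times>\<^sub>F nhds a0)"
      by (rule joint[OF uD[OF lp] local_param_open[OF lp] a0])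
    show "((\<lambda>x. frechet_derivative (\<lambda>b. frechet_derivative (u (r' (fst x)) \<circ> \<psi>) (at b) v) (at (snd x)) w) \<longlongrightarrow>
       frechet_derivative (\<lambda>b. frechet_derivative (u R \<circ> \<psi>) (at b) v) (at a0) w) (sequentially \<times>\<^sub>F nhds a0)"
      by (rule joint[OF uD2[OF lp] local_param_open[OF lp] a0])
  qed
  then have L1: "(\<lambda>n. (kern_avg (h n) (z n - \<alpha> n) (u (r' n)) - u (r' n) (z n)) / h n) \<longlonglongrightarrow> ?A" by simp
  \<comment> \<open>The remaining part is a pure time increment at a fixed base point. The
    intermediate times are squeezed to \<open>R\<close>, so joint continuity of \<open>u'\<close>
    gives the limit.\<close>
  have "\<exists>\<theta>. r n < \<theta> \<and> \<theta> < r' n \<and> u (r' n) (z n) - u (r n) (z n) = h n * u' \<theta> (z n)" for n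
  proof -
    have "\<exists>\<theta>\<in>{r n<..<r' n}. (\<lambda>s. u s (z n)) (r' n) - (\<lambda>s. u s (z n)) (r n) = (\<lambda>x. u' \<theta> (z n) * x) (r' n - r n)"
    proof (rule mvt_simple[OF S(2)])
      fix x assume x: "r n \<le> x" "x \<le> r' n"
      have "{r n..r' n} \<subseteq> {0..t}" "x \<in> {0..t}" using S(1,3)[of n] x by auto
      then show "((\<lambda>s. u s (z n)) has_derivative (\<lambda>y. u' x (z n) * y)) (at x within {r n..r' n})"
        using has_derivative_subset[OF u'(1)[of x "z n", unfolded has_field_derivative_def]] S(5)[of n] by blast
    qed
    then show ?thesis by (auto simp: h_def mult.commute)
  qed
  then obtain \<theta> where \<theta>: "\<And>n. r n < \<theta> n \<and> \<theta> n < r' n \<and> u (r' n) (z n) - u (r n) (z n) = h n * u' (\<theta> n) (z n)" by metis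
  have \<theta>lim: "\<theta> \<longlonglongrightarrow> R"
    by (rule tendsto_sandwich[OF _ _ rlim r'lim]) (use \<theta> in \<open>auto intro: always_eventually less_imp_le\<close>)
  have "(\<lambda>n. (\<lambda>(s, x). u' s x) (\<theta> n, z n)) \<longlonglongrightarrow> (\<lambda>(s, x). u' s x) (R, Z)"
  proof (rule continuous_on_tendsto_compose[OF u'(2) tendsto_Pair[OF \<theta>lim zlim]])
    show "\<forall>\<^sub>F n in sequentially. (\<theta> n, z n) \<in> {0..t} \<times> M"
    proof (rule always_eventually, rule allI)
      fix n show "(\<theta> n, z n) \<in> {0..t} \<times> M" using \<theta>[of n] S(1,3,5)[of n] by auto
    qed
  qed (use R Z in auto)
  moreover have "u' (\<theta> n) (z n) = (u (r' n) (z n) - u (r n) (z n)) / h n" for n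
    using \<theta>[of n] hpos[of n] by simp
  ultimately have L2: "(\<lambda>n. (u (r' n) (z n) - u (r n) (z n)) / h n) \<longlonglongrightarrow> u' R Z" by simp
  \<comment> \<open>Both are time derivatives of the solution at the limit point, one-sided if
    \<open>R\<close> is an end point, and agree because the interval is nondegenerate. The spatial
    and the temporal limit then cancel.\<close>
  have "u' R Z = - ?A"
  proof -
    have d1: "((\<lambda>r. u r Z) has_vector_derivative u' R Z) (at R within cbox 0 t)"
      using u'(1)[OF R Z] by (simp add: has_real_derivative_iff_has_vector_derivative)
    have d2: "((\<lambda>r. u r Z) has_vector_derivative - ?A) (at R within cbox 0 t)"
      using sol R Z unfolding backward_solution_def has_real_derivative_iff_has_vector_derivative cbox_interval by blast
    have "R \<in> cbox 0 t" using R by simp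
    from vector_derivative_unique_within_closed_interval[OF t(1) this d1 d2] show ?thesis .
  qed
  then have "(\<lambda>n. (kern_avg (h n) (z n - \<alpha> n) (u (r' n)) - u (r n) (z n)) / h n) \<longlonglongrightarrow> 0"
    using tendsto_add[OF L1 L2] by (simp add: add_divide_distrib[symmetric])
  from tendstoD[OF this \<epsilon>] obtain n where "\<bar>(kern_avg (h n) (z n - \<alpha> n) (u (r' n)) - u (r n) (z n)) / h n\<bar> < \<epsilon>"
    unfolding eventually_sequentially by (auto simp: dist_real_def)
  then show False using S(6)[of n] hpos[of n] by (simp add: abs_divide divide_less_eq)
qed

section \<open>Telescoping over partitions\<close>

lemma continuous_on_integral_compact:
  fixes f :: "'c::metric_space \<Rightarrow> 'a \<Rightarrow> real"
  assumes S: "compact S" and cont: "continuous_on (S \<times> M) (\<lambda>(x, y). f x y)"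
  shows "continuous_on S (\<lambda>x. \<integral>y. f x y \<partial>vol)"
proof -
  have "bounded ((\<lambda>(x, y). f x y) ` (S \<times> M))"
    by (intro compact_imp_bounded compact_continuous_image cont compact_Times S M_compact)
  then obtain B where "\<And>x y. x \<in> S \<Longrightarrow> y \<in> M \<Longrightarrow> \<bar>f x y\<bar> \<le> B" by (force simp: bounded_iff)
  then show ?thesis by (rule continuous_on_integral[OF cont])
qed

lemma continuous_on_section:
  fixes f :: "'c::topological_space \<Rightarrow> 'e::topological_space \<Rightarrow> 'f::topological_space"
  assumes "continuous_on (S \<times> T) (\<lambda>(x, y). f x y)" "x \<in> S"
  shows "continuous_on T (f x)"
proof -
  have "continuous_on T ((\<lambda>(x, y). f x y) \<circ> (\<lambda>y. (x, y)))"
    by (rule continuous_on_compose[OF _ continuous_on_subset[OF assms(1)]]) (use assms(2) in \<open>auto intro!: continuous_intros\<close>)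
  then show ?thesis by (simp add: o_def)
qed

text \<open>Joint measurability is inherited from the Borel sets of the product space, where
  \<open>M \<times> M\<close> is compact; boundedness on a finite measure gives
  integrability.\<close>

lemma integral_swap_continuous:
  fixes f :: "'a \<Rightarrow> 'a \<Rightarrow> real"
  assumes cont: "continuous_on (M \<times> M) (\<lambda>(x, y). f x y)"
  shows "(\<integral>y. \<integral>x. f x y \<partial>vol \<partial>vol) = (\<integral>x. \<integral>y. f x y \<partial>vol \<partial>vol)"
proof -
  interpret P: pair_sigma_finite vol vol ..
  have MM: "M \<times> M \<in> sets (borel :: ('a \<times> 'a) measure)" using M_compact by (simp add: borel_compact compact_Times)
  have id: "(\<lambda>x. x) \<in> measurable vol borel"
    by (rule continuous_measurable[OF continuous_on_id])
  have "(\<lambda>p. indicator (M \<times> M) p *\<^sub>R (\<lambda>(x, y). f x y) p) \<in> borel_measurable (borel :: ('a \<times> 'a) measure)"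
    by (rule borel_measurable_continuous_on_indicator[OF MM cont])
  moreover have "(\<lambda>p. (fst p, snd p)) \<in> measurable (vol \<Otimes>\<^sub>M vol) (borel :: ('a \<times> 'a) measure)"
    unfolding borel_prod[symmetric]
    by (intro measurable_Pair measurable_compose[OF measurable_fst id] measurable_compose[OF measurable_snd id])
  ultimately have "(\<lambda>p. indicator (M \<times> M) p *\<^sub>R (\<lambda>(x, y). f x y) p) \<in> borel_measurable (vol \<Otimes>\<^sub>M vol)"
    using measurable_compose by fastforce
  then have meas: "(\<lambda>(x, y). f x y) \<in> borel_measurable (vol \<Otimes>\<^sub>M vol)"
    by (rule measurable_cong[THEN iffD1, rotated]) (auto simp: space_pair_measure space_vol)
  have "bounded ((\<lambda>(x, y). f x y) ` (M \<times> M))"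
    by (intro compact_imp_bounded compact_continuous_image cont compact_Times M_compact)
  then obtain B where B: "\<And>x y. x \<in> M \<Longrightarrow> y \<in> M \<Longrightarrow> \<bar>f x y\<bar> \<le> B" by (force simp: bounded_iff)
  interpret PF: finite_measure "vol \<Otimes>\<^sub>M vol"
    by (rule finite_measure_pair_measure) unfold_locales
  have "integrable (vol \<Otimes>\<^sub>M vol) (\<lambda>(x, y). f x y)"
    by (rule PF.integrable_const_bound[of _ B]) (use B meas in \<open>auto intro!: AE_I2 simp: space_pair_measure space_vol\<close>)
  then show ?thesis by (rule P.Fubini_integral)
qed

section \<open>The kernels and their iterates as averaging operators\<close>

lemma q_kernel_eq:
  "q_kernel vol \<phi> s x t y = gauss_weight (t - s) (x - (\<phi> s - \<phi> t)) y / gauss_norm (t - s) (x - (\<phi> s - \<phi> t))"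
  unfolding q_kernel_def gauss_weight_def gauss_norm_def by (simp add: algebra_simps)

lemma integral_q_kernel: "(\<integral>y. q_kernel vol \<phi> s x t y * f y \<partial>vol) = kern_avg (t - s) (x - (\<phi> s - \<phi> t)) f"
  unfolding q_kernel_eq kern_avg_def by (simp add: mult.commute[of _ "f _"])

lemma continuous_on_gauss_joint: "continuous_on S (\<lambda>(x, y). gauss_weight h (x - c) y)"
  unfolding gauss_weight_def divide_inverse split_beta by (intro continuous_intros)

lemma continuous_on_q_kernel:
  assumes "s < t"
  shows "continuous_on (M \<times> M) (\<lambda>(x, y). q_kernel vol \<phi> s x t y)"
proof -
  have n: "continuous_on M (\<lambda>x. gauss_norm (t - s) (x - (\<phi> s - \<phi> t)))"
    unfolding gauss_norm_def by (rule continuous_on_integral_compact[OF M_compact continuous_on_gauss_joint])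
  have "continuous_on (M \<times> M) (\<lambda>p. gauss_norm (t - s) (fst p - (\<phi> s - \<phi> t)))"
    by (rule continuous_on_compose2[OF n]) (auto intro: continuous_intros)
  then show ?thesis
    using gauss_norm_pos[of "t - s"] assms continuous_on_gauss_joint[of "M \<times> M"]
    unfolding q_kernel_eq split_beta by (intro continuous_on_divide) (auto simp: less_imp_neq[symmetric])
qed

text \<open>The kernel is positive with total mass 1, hence a contraction in the supremum norm. The
  point \<open>x\<close> witnesses that \<open>M\<close> is nonempty, so that the normalisation is
  positive whatever the centre.\<close>

lemma kern_avg_bound:
  assumes h: "h > 0" and f: "continuous_on M f" "continuous_on M g" "\<And>y. y \<in> M \<Longrightarrow> \<bar>f y - g y\<bar> \<le> B" and x: "x \<in> M"
  shows "\<bar>kern_avg h c f - kern_avg h c g\<bar> \<le> B"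
proof -
  have Z: "gauss_norm h c > 0" using gauss_norm_pos[OF h x] .
  have "kern_avg h c f - kern_avg h c g = (\<integral>y. gauss_weight h c y * f y - gauss_weight h c y * g y \<partial>vol) / gauss_norm h c"
    unfolding kern_avg_def by (simp add: integrable_gauss f diff_divide_distrib)
  moreover have "\<bar>\<integral>y. gauss_weight h c y * f y - gauss_weight h c y * g y \<partial>vol\<bar> \<le> B * gauss_norm h c"
  proof -
    have "\<bar>\<integral>y. gauss_weight h c y * f y - gauss_weight h c y * g y \<partial>vol\<bar> \<le> (\<integral>y. \<bar>gauss_weight h c y * f y - gauss_weight h c y * g y\<bar> \<partial>vol)"
      by (rule integral_abs_bound)
    also have "\<dots> \<le> (\<integral>y. B * gauss_weight h c y \<partial>vol)"
    proof (rule integral_mono)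
      show "integrable vol (\<lambda>y. \<bar>gauss_weight h c y * f y - gauss_weight h c y * g y\<bar>)"
        by (intro integrable_abs Bochner_Integration.integrable_diff integrable_gauss f)
      show "integrable vol (\<lambda>y. B * gauss_weight h c y)" by (intro integrable_mult_right integrable_gauss')
      fix y assume "y \<in> space vol"
      then have "gauss_weight h c y * \<bar>f y - g y\<bar> \<le> gauss_weight h c y * B"
        using f(3) gauss_weight_pos[of h c y] by (intro mult_left_mono) (auto simp: space_vol)
      then show "\<bar>gauss_weight h c y * f y - gauss_weight h c y * g y\<bar> \<le> B * gauss_weight h c y"
        unfolding right_diff_distrib[symmetric] abs_mult abs_of_pos[OF gauss_weight_pos] mult.commute[of B] .
    qed
    finally show ?thesis by (simp add: gauss_norm_def)
  qed
  ultimately show ?thesis using Z by (simp add: abs_divide divide_le_eq)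
qed

text \<open>Joint continuity in both end points is what the interchange of integrals rests on. The
  induction follows the recursion of \<open>q_partition\<close>, with lists of two points as the
  base.\<close>

lemma continuous_on_q_partition:
  "2 \<le> length P \<Longrightarrow> sorted_wrt (<) P \<Longrightarrow> continuous_on (M \<times> M) (\<lambda>(x, y). q_partition vol \<phi> P x y)"
proof (induction P rule: induct_list012)
  case (3 s r P)
  show ?case
  proof (cases P)
    case Nil
    then show ?thesis using continuous_on_q_kernel[of s r \<phi>] 3(4) by simp
  next
    case (Cons t P')
    have IH: "continuous_on (M \<times> M) (\<lambda>(x, y). q_partition vol \<phi> (r # P) x y)"
      using 3(2,3,4) Cons by simp
    have K: "continuous_on (M \<times> M) (\<lambda>(x, y). q_kernel vol \<phi> s x r y)"
      using continuous_on_q_kernel[of s r \<phi>] 3(4) by simp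
    have "continuous_on ((M \<times> M) \<times> M) (\<lambda>(p, z). q_kernel vol \<phi> s (fst p) r z * q_partition vol \<phi> (r # P) z (snd p))"
      unfolding split_beta
    proof (intro continuous_on_mult)
      show "continuous_on ((M \<times> M) \<times> M) (\<lambda>q. q_kernel vol \<phi> s (fst (fst q)) r (snd q))"
      proof -
        have m: "continuous_on ((M \<times> M) \<times> M) (\<lambda>q. (fst (fst q), snd q))" by (intro continuous_intros)
        have im: "(\<lambda>q. (fst (fst q), snd q)) ` ((M \<times> M) \<times> M) \<subseteq> M \<times> M" by auto
        show ?thesis using continuous_on_compose2[OF K m im] by simp
      qed
      show "continuous_on ((M \<times> M) \<times> M) (\<lambda>q. q_partition vol \<phi> (r # P) (snd q) (snd (fst q)))"
      proof -
        have m: "continuous_on ((M \<times> M) \<times> M) (\<lambda>q. (snd q, snd (fst q)))" by (intro continuous_intros)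
        have im: "(\<lambda>q. (snd q, snd (fst q))) ` ((M \<times> M) \<times> M) \<subseteq> M \<times> M" by auto
        show ?thesis using continuous_on_compose2[OF IH m im] by simp
      qed
    qed
    from continuous_on_integral_compact[OF compact_Times[OF M_compact M_compact] this]
    show ?thesis by (simp add: Cons split_beta)
  qed
qed auto

lemma continuous_on_integral_q_partition:
  assumes "2 \<le> length P" "sorted_wrt (<) P" "continuous_on M g"
  shows "continuous_on M (\<lambda>x. \<integral>y. q_partition vol \<phi> P x y * g y \<partial>vol)"
proof (rule continuous_on_integral_compact[OF M_compact])
  have "continuous_on (M \<times> M) (\<lambda>p. g (snd p))" by (rule continuous_on_compose2[OF assms(3)]) (auto intro: continuous_intros)
  then show "continuous_on (M \<times> M) (\<lambda>(x, y). q_partition vol \<phi> P x y * g y)"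
    using continuous_on_q_partition[OF assms(1,2), of \<phi>] unfolding split_beta by (intro continuous_on_mult)
qed

text \<open>After interchanging the integrals the leftmost kernel acts on the function produced by
  the remaining partition, so iterated kernels are compositions of averaging operators.\<close>

lemma integral_q_partition_Cons:
  assumes P: "s < r" "sorted_wrt (<) (r # t # P)" and g: "continuous_on M g" and x: "x \<in> M"
  shows "(\<integral>y. q_partition vol \<phi> (s # r # t # P) x y * g y \<partial>vol) =
    kern_avg (r - s) (x - (\<phi> s - \<phi> r)) (\<lambda>z. \<integral>y. q_partition vol \<phi> (r # t # P) z y * g y \<partial>vol)"
proof -
  let ?q = "\<lambda>z y. q_partition vol \<phi> (r # t # P) z y"
  have "continuous_on M (q_kernel vol \<phi> s x r)"
    by (rule continuous_on_section[OF continuous_on_q_kernel[OF P(1)] x])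
  then have "continuous_on (M \<times> M) (\<lambda>p. q_kernel vol \<phi> s x r (fst p))"
    by (rule continuous_on_compose2) (auto intro: continuous_intros)
  moreover have "continuous_on (M \<times> M) (\<lambda>p. g (snd p))" by (rule continuous_on_compose2[OF g]) (auto intro: continuous_intros)
  moreover have "continuous_on (M \<times> M) (\<lambda>(z, y). ?q z y)" using P(2) by (intro continuous_on_q_partition) auto
  ultimately have c: "continuous_on (M \<times> M) (\<lambda>(z, y). q_kernel vol \<phi> s x r z * (?q z y * g y))"
    unfolding split_beta by (intro continuous_on_mult)
  have "(\<integral>y. q_partition vol \<phi> (s # r # t # P) x y * g y \<partial>vol) = (\<integral>y. \<integral>z. q_kernel vol \<phi> s x r z * (?q z y * g y) \<partial>vol \<partial>vol)"
    by (simp add: mult.assoc[symmetric])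
  also have "\<dots> = (\<integral>z. \<integral>y. q_kernel vol \<phi> s x r z * (?q z y * g y) \<partial>vol \<partial>vol)"
    by (rule integral_swap_continuous[OF c])
  also have "\<dots> = (\<integral>z. q_kernel vol \<phi> s x r z * (\<integral>y. ?q z y * g y \<partial>vol) \<partial>vol)" by simp
  finally show ?thesis unfolding integral_q_kernel .
qed

lemma integral_q_partition_bound:
  assumes "2 \<le> length P" "sorted_wrt (<) P" "continuous_on M f" "continuous_on M g" "\<And>y. y \<in> M \<Longrightarrow> \<bar>f y - g y\<bar> \<le> B" "x \<in> M"
  shows "\<bar>(\<integral>y. q_partition vol \<phi> P x y * f y \<partial>vol) - (\<integral>y. q_partition vol \<phi> P x y * g y \<partial>vol)\<bar> \<le> B"
  using assms(1,2,6)
proof (induction P arbitrary: x rule: induct_list012)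
  case (3 s r P)
  show ?case
  proof (cases P)
    case Nil
    then show ?thesis using 3(4,5) assms(3-5) by (simp add: integral_q_kernel kern_avg_bound)
  next
    case (Cons t P')
    have P: "s < r" "sorted_wrt (<) (r # t # P')" using 3(4) Cons by auto
    show ?thesis
      unfolding Cons integral_q_partition_Cons[OF P assms(3) 3(5)] integral_q_partition_Cons[OF P assms(4) 3(5)]
    proof (rule kern_avg_bound)
      show "\<bar>(\<integral>y. q_partition vol \<phi> (r # t # P') z y * f y \<partial>vol) - (\<integral>y. q_partition vol \<phi> (r # t # P') z y * g y \<partial>vol)\<bar> \<le> B"
        if "z \<in> M" for z
        using 3(2)[OF _ _ that] P Cons by simp
    qed (use P 3(5) assms(3,4) in \<open>auto intro!: continuous_on_integral_q_partition\<close>)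
  qed
qed auto

text \<open>Induction from the left: the error \<open>\<epsilon> * (t - r)\<close> of the remaining
  points passes unchanged through a contraction, and the step from \<open>s\<close> to
  \<open>r\<close> adds \<open>\<epsilon> * (r - s)\<close>. At the last point \<open>u t\<close> is
  the terminal value \<open>f\<close>.\<close>

lemma integral_q_partition_telescope:
  assumes step: "\<And>r r' z. 0 \<le> r \<Longrightarrow> r < r' \<Longrightarrow> r' \<le> t \<Longrightarrow> r' - r < \<delta> \<Longrightarrow> z \<in> M \<Longrightarrow>
      \<bar>kern_avg (r' - r) (z - (\<phi> r - \<phi> r')) (u r') - u r z\<bar> \<le> \<epsilon> * (r' - r)"
    and u: "\<And>r. r \<in> {0..t} \<Longrightarrow> continuous_on M (u r)" and f: "continuous_on M f" "\<And>x. x \<in> M \<Longrightarrow> u t x = f x"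
    and P: "2 \<le> length P" "sorted_wrt (<) P" "0 \<le> hd P" "last P = t" "\<And>i. Suc i < length P \<Longrightarrow> P ! Suc i - P ! i < \<delta>"
    and x: "x \<in> M"
  shows "\<bar>(\<integral>y. q_partition vol \<phi> P x y * f y \<partial>vol) - u (hd P) x\<bar> \<le> \<epsilon> * (t - hd P)"
  using P x
proof (induction P arbitrary: x rule: induct_list012)
  case (3 s r P)
  have sr: "s < r" "0 \<le> s" "r - s < \<delta>" using 3(4,5) 3(7)[of 0] by auto
  have "r \<le> t"
  proof (cases P)
    case (Cons t' P')
    then have "t \<in> set P" using 3(6) by (metis last.simps last_in_set list.distinct(1))
    then show ?thesis using 3(4) by auto
  qed (use 3(6) in simp)
  note st = step[OF sr(2,1) \<open>r \<le> t\<close> sr(3)]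
  show ?case
  proof (cases P)
    case Nil
    then have "r = t" using 3(6) by simp
    have "kern_avg (r - s) c f = kern_avg (r - s) c (u r)" for c
      unfolding kern_avg_def using f(2) \<open>r = t\<close>
      by (intro arg_cong2[where f = "(/)"] Bochner_Integration.integral_cong refl) (simp add: space_vol)
    then show ?thesis using st[OF 3(8)] Nil \<open>r = t\<close> by (simp add: integral_q_kernel)
  next
    case (Cons t' P')
    have P: "s < r" "sorted_wrt (<) (r # t' # P')" using 3(4) Cons by auto
    let ?F = "\<lambda>z. \<integral>y. q_partition vol \<phi> (r # t' # P') z y * f y \<partial>vol"
    have IH: "\<bar>?F z - u r z\<bar> \<le> \<epsilon> * (t - r)" if "z \<in> M" for z
    proof -
      have "Suc i < length (r # P) \<Longrightarrow> (r # P) ! Suc i - (r # P) ! i < \<delta>" for i using 3(7)[of "Suc i"] by simp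
      then show ?thesis using 3(2)[OF _ _ _ _ _ that] 3(4,5,6) sr Cons by auto
    qed
    have "\<bar>kern_avg (r - s) (x - (\<phi> s - \<phi> r)) ?F - kern_avg (r - s) (x - (\<phi> s - \<phi> r)) (u r)\<bar> \<le> \<epsilon> * (t - r)"
      using sr \<open>r \<le> t\<close> P
      by (intro kern_avg_bound[OF _ _ _ IH 3(8)] continuous_on_integral_q_partition f u) auto
    with st[OF 3(8)] show ?thesis
      unfolding Cons integral_q_partition_Cons[OF P f(1) 3(8)] list.sel by (simp add: algebra_simps)
  qed
qed auto

end

section \<open>Convergence as the mesh tends to zero\<close>

lemma eventually_mesh_to_0:
  assumes "\<delta> > 0"
  shows "\<forall>\<^sub>F P in mesh_to_0 s t. P \<in> partitions s t \<and> (\<forall>i. Suc i < length P \<longrightarrow> P ! Suc i - P ! i < \<delta>)"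
proof -
  have "\<forall>\<^sub>F m in at_right (0::real). m < \<delta>" using assms by (auto simp: eventually_at_right_field)
  then have "\<forall>\<^sub>F P in filtercomap mesh (at_right 0). mesh P < \<delta>" by (rule eventually_filtercomapI)
  then show ?thesis
    unfolding mesh_to_0_def eventually_inf_principal
  proof eventually_elim
    case (elim P)
    show ?case
    proof (intro impI conjI allI)
      fix i assume i: "Suc i < length P"
      let ?S = "{P ! Suc i - P ! i | i. Suc i < length P}"
      have "?S \<subseteq> (\<lambda>i. P ! Suc i - P ! i) ` {..<length P}" by auto
      then have "finite ?S" by (rule finite_subset) auto
      then have "P ! Suc i - P ! i \<le> mesh P" unfolding mesh_def using i by (intro Max_ge) auto
      then show "P ! Suc i - P ! i < \<delta>" using elim by simp
    qed
  qed
qed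

theorem theorem5:
  fixes M :: "(real ^ 'm::finite) set"
    and vol :: "(real ^ 'm) measure"
    and \<phi> \<phi>' \<phi>'' :: "real \<Rightarrow> real ^ 'm"
    and N :: "real \<Rightarrow> real ^ 'm \<Rightarrow> 'w measure"
    and X :: "real \<Rightarrow> real ^ 'm \<Rightarrow> real \<Rightarrow> 'w \<Rightarrow> real ^ 'm"
    and p :: "real \<Rightarrow> real ^ 'm \<Rightarrow> real \<Rightarrow> real ^ 'm \<Rightarrow> real"
    and g :: "real ^ 'm \<Rightarrow> real"
    and s t :: real
  assumes "compact M" and "embedded_submanifold TYPE('d::finite) M"
    and "volume_measure TYPE('d) M vol"
    and "\<And>r. r \<in> {0..1} \<Longrightarrow> \<phi> r \<in> M"
    and "\<And>r. r \<in> {0..1} \<Longrightarrow> (\<phi> has_vector_derivative \<phi>' r) (at r within {0..1})"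
    and "\<And>r. r \<in> {0..1} \<Longrightarrow> (\<phi>' has_vector_derivative \<phi>'' r) (at r within {0..1})"
    and "continuous_on {0..1} \<phi>''"
    and "diffusion_generated_by TYPE('d) M
           (\<lambda>r f x. \<phi>' r \<bullet> mgrad M f x - 1 / 2 * laplace_beltrami M f x) N X"
    and "transition_density M vol N X p"
    and "0 \<le> s" and "s < t" and "t \<le> 1"
    and "continuous_on M g"
  shows "(\<forall>P\<in>partitions s t. continuous_on M (\<lambda>x. \<integral>y. q_partition vol \<phi> P x y * g y \<partial>vol)) \<and>
    continuous_on M (\<lambda>x. \<integral>y. p s x t y * g y \<partial>vol) \<and>
    uniform_limit M (\<lambda>P x. \<integral>y. q_partition vol \<phi> P x y * g y \<partial>vol)
      (\<lambda>x. \<integral>y. p s x t y * g y \<partial>vol) (mesh_to_0 s t)"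
proof -
  interpret riemannian_volume "TYPE('d)" M vol
    by unfold_locales (rule assms)+
  let ?Q = "\<lambda>P f x. \<integral>y. q_partition vol \<phi> P x y * f y \<partial>vol"
  let ?S = "\<lambda>f x. \<integral>y. p s x t y * f y \<partial>vol"
  have gen: "prob_space (N s x)" "X s x t \<in> measurable (N s x) (restrict_space borel M)" if "x \<in> M" for x
    using assms(8,10-12) that unfolding diffusion_generated_by_def by auto
  \<comment> \<open>Rewritten as an expectation, the integral against the density is the function
    that the hypothesis on the diffusion makes a solution of the backward equation.\<close>
  have S_eq: "?S f x = (\<integral>\<omega>. f (X s x t \<omega>) \<partial>N s x)" if x: "x \<in> M" and f: "continuous_on M f" for f x
  proof -
    have p: "\<And>y. y \<in> M \<Longrightarrow> 0 \<le> p s x t y" "distributed (N s x) vol (X s x t) (\<lambda>y. ennreal (p s x t y))"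
      using assms(9-12) x unfolding transition_density_def by auto
    show ?thesis
      by (rule distributed_integral[OF p(2) continuous_measurable[OF f]]) (simp add: space_vol p(1))
  qed
  \<comment> \<open>As an expectation the limit operator is a contraction too, so on both sides
    \<open>g\<close> may be replaced by a uniformly close function.\<close>
  have S_bound: "\<bar>?S f x - ?S f' x\<bar> \<le> B"
    if x: "x \<in> M" and f: "continuous_on M f" "continuous_on M f'" and B: "\<And>y. y \<in> M \<Longrightarrow> \<bar>f y - f' y\<bar> \<le> B" for f f' x B
  proof -
    interpret PS: prob_space "N s x" by (rule gen[OF x])
    note X = gen(2)[OF x]
    have XM: "X s x t \<omega> \<in> M" if "\<omega> \<in> space (N s x)" for \<omega>
      using measurable_space[OF X that] by (simp add: space_restrict_space)
    have int: "integrable (N s x) (\<lambda>\<omega>. f (X s x t \<omega>))" if f: "continuous_on M f" for f :: "real ^ 'm \<Rightarrow> real"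
    proof -
      have "bounded (f ` M)" using compact_continuous_image[OF f assms(1)] compact_imp_bounded by blast
      then obtain C where "\<And>y. y \<in> M \<Longrightarrow> norm (f y) \<le> C" by (auto simp: bounded_iff)
      with XM have "AE \<omega> in N s x. norm (f (X s x t \<omega>)) \<le> C" by (intro AE_I2) auto
      then show ?thesis
        by (rule PS.integrable_const_bound) (rule measurable_compose[OF X borel_measurable_continuous_on_restrict[OF f]])
    qed
    have "\<bar>?S f x - ?S f' x\<bar> = \<bar>\<integral>\<omega>. f (X s x t \<omega>) - f' (X s x t \<omega>) \<partial>N s x\<bar>"
      using int f by (simp add: S_eq x)
    also have "\<dots> \<le> (\<integral>\<omega>. \<bar>f (X s x t \<omega>) - f' (X s x t \<omega>)\<bar> \<partial>N s x)" by (rule integral_abs_bound)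
    also have "\<dots> \<le> (\<integral>\<omega>. B \<partial>N s x)"
      using int f B XM by (intro integral_mono) auto
    finally show ?thesis by (simp add: PS.prob_space)
  qed
  have \<phi>'c: "continuous_on {0..1} \<phi>'"
    unfolding continuous_on_eq_continuous_within using has_vector_derivative_continuous[OF assms(6)] by blast
  have sol: "\<exists>u. backward_solution TYPE('d) M (\<lambda>r f x. \<phi>' r \<bullet> mgrad M f x - 1 / 2 * laplace_beltrami M f x) t f u \<and>
      (\<forall>x\<in>M. u s x = ?S f x)" if f: "real_polynomial_function f" for f
  proof -
    have fc: "continuous_on M f" by (rule continuous_on_polymonial_function[OF f[unfolded real_polynomial_function_eq]])
    have "smooth_fun TYPE('d) M f"
      unfolding smooth_fun_def using real_polynomial_function_smooth_on[OF f] by (auto simp: local_param_def)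
    moreover have "0 < t" using assms(10,11) by simp
    ultimately have "backward_solution TYPE('d) M (\<lambda>r f x. \<phi>' r \<bullet> mgrad M f x - 1 / 2 * laplace_beltrami M f x) t f
        (\<lambda>s x. \<integral>\<omega>. f (X s x t \<omega>) \<partial>N s x)"
      using assms(8,12) unfolding diffusion_generated_by_def by blast
    then show ?thesis using S_eq[OF _ fc] by (intro exI conjI ballI) (assumption, simp)
  qed
  have C12: "continuous_on M (u r)" if "C12_on TYPE('d) M t u" "r \<in> {0..t}" for u r
  proof -
    have "continuous_on ({0..t} \<times> M) (\<lambda>(s, x). u s x)" using that(1) unfolding C12_on_def by blast
    from continuous_on_section[OF this that(2)] show ?thesis .
  qed
  have approx: "\<exists>f. real_polynomial_function f \<and> (\<forall>x\<in>M. \<bar>g x - f x\<bar> < e)" if "e > 0" for e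
    using Stone_Weierstrass_real_polynomial_function[OF assms(1,13) that] by metis
  have Qc: "continuous_on M (?Q P g)" if "P \<in> partitions s t" for P
    using that assms(13) by (intro continuous_on_integral_q_partition) (auto simp: partitions_def)
  \<comment> \<open>The density is not assumed continuous in its starting point. For a polynomial
    terminal value continuity is that of the solution at time \<open>s\<close>, and it survives
    uniform limits.\<close>
  have Sc: "continuous_on M (?S g)"
  proof -
    have "\<forall>n. \<exists>f. real_polynomial_function f \<and> (\<forall>x\<in>M. \<bar>g x - f x\<bar> < inverse (real (Suc n)))" using approx by simp
    then obtain f where f: "\<And>n. real_polynomial_function (f n)" "\<And>n x. x \<in> M \<Longrightarrow> \<bar>g x - f n x\<bar> < inverse (real (Suc n))"
      by metis
    have fc: "continuous_on M (f n)" for n by (rule continuous_on_polymonial_function[OF f(1)[unfolded real_polynomial_function_eq]])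
    have ul: "uniform_limit M (\<lambda>n. ?S (f n)) (?S g) sequentially"
    proof (rule uniform_limitI)
      fix e :: real assume "e > 0"
      then have "\<forall>\<^sub>F n in sequentially. inverse (real (Suc n)) < e"
        using order_tendstoD(2)[OF LIMSEQ_inverse_real_of_nat] by blast
      then show "\<forall>\<^sub>F n in sequentially. \<forall>x\<in>M. dist (?S (f n) x) (?S g x) < e"
      proof eventually_elim
        case (elim n)
        show ?case
        proof
          fix x assume x: "x \<in> M"
          have "\<bar>?S (f n) x - ?S g x\<bar> \<le> inverse (real (Suc n))"
            using f(2)[of _ n] by (intro S_bound x fc assms(13)) (simp add: abs_minus_commute less_imp_le)
          then show "dist (?S (f n) x) (?S g x) < e" using elim by (simp add: dist_real_def)
        qed
      qed
    qed
    have c: "continuous_on M (?S (f n))" for n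
    proof -
      obtain u where u: "backward_solution TYPE('d) M (\<lambda>r f x. \<phi>' r \<bullet> mgrad M f x - 1 / 2 * laplace_beltrami M f x) t (f n) u"
        "\<forall>x\<in>M. u s x = ?S (f n) x" using sol[OF f(1)] by blast
      have "continuous_on M (u s)" using u(1) assms(10,11) by (intro C12) (auto simp: backward_solution_def)
      then show ?thesis using u(2) by (simp cong: continuous_on_cong)
    qed
    show ?thesis by (rule uniform_limit_theorem[OF always_eventually[OF allI[OF c]] ul]) simp
  qed
  have "uniform_limit M (\<lambda>P. ?Q P g) (?S g) (mesh_to_0 s t)"
  proof (rule uniform_limitI)
    fix e :: real assume e: "e > 0"
    \<comment> \<open>Three errors of at most \<open>e / 4\<close> occur: two from replacing
      \<open>g\<close> by \<open>f\<close>, and one from the telescoped consistency estimate, where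
      \<open>t - s \<le> 1\<close>. Their sum is strictly below \<open>e\<close>.\<close>
    then have e4: "e / 4 > 0" by simp
    obtain f where f: "real_polynomial_function f" "\<And>x. x \<in> M \<Longrightarrow> \<bar>g x - f x\<bar> < e / 4" using approx[OF e4] by blast
    have fc: "continuous_on M f" by (rule continuous_on_polymonial_function[OF f(1)[unfolded real_polynomial_function_eq]])
    obtain u where u: "backward_solution TYPE('d) M (\<lambda>r f x. \<phi>' r \<bullet> mgrad M f x - 1 / 2 * laplace_beltrami M f x) t f u"
      "\<forall>x\<in>M. u s x = ?S f x" using sol[OF f(1)] by blast
    obtain \<delta> where \<delta>: "\<delta> > 0" "\<And>r r' z. 0 \<le> r \<Longrightarrow> r < r' \<Longrightarrow> r' \<le> t \<Longrightarrow> r' - r < \<delta> \<Longrightarrow> z \<in> M \<Longrightarrow>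
        \<bar>kern_avg (r' - r) (z - (\<phi> r - \<phi> r')) (u r') - u r z\<bar> \<le> e / 4 * (r' - r)"
      using backward_consistency[OF _ assms(12,5) \<phi>'c u(1) e4] assms(10,11) by (metis le_less_trans)
    show "\<forall>\<^sub>F P in mesh_to_0 s t. \<forall>x\<in>M. dist (?Q P g x) (?S g x) < e"
      using eventually_mesh_to_0[OF \<delta>(1), of s t]
    proof eventually_elim
      case (elim P)
      then have P: "2 \<le> length P" "sorted_wrt (<) P" "hd P = s" "last P = t" "\<And>i. Suc i < length P \<Longrightarrow> P ! Suc i - P ! i < \<delta>"
        by (auto simp: partitions_def)
      show ?case
      proof
        fix x assume x: "x \<in> M"
        have "\<bar>?Q P f x - u (hd P) x\<bar> \<le> e / 4 * (t - hd P)"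
          using u(1) assms(10) P C12 x
          by (intro integral_q_partition_telescope[OF \<delta>(2) _ fc]) (auto simp: backward_solution_def)
        then have "\<bar>?Q P f x - ?S f x\<bar> \<le> e / 4 * (t - s)" using u(2) x P(3) by simp
        also have "\<dots> \<le> e / 4 * 1" using assms(10,12) e by (intro mult_left_mono) auto
        finally have 1: "\<bar>?Q P f x - ?S f x\<bar> \<le> e / 4" by simp
        have 2: "\<bar>?Q P g x - ?Q P f x\<bar> \<le> e / 4"
          using f(2) by (intro integral_q_partition_bound P assms(13) fc x) (simp add: less_imp_le)
        have 3: "\<bar>?S g x - ?S f x\<bar> \<le> e / 4"
          using f(2) by (intro S_bound assms(13) fc x) (simp add: less_imp_le)
        show "dist (?Q P g x) (?S g x) < e" unfolding dist_real_def using 1 2 3 e by linarith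
      qed
    qed
  qed
  then show ?thesis using Qc Sc by simp
qed

end
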